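(* There exist a neighborhood $W$ of the zero potential in $X$ and a sequence of nondegenerate rectangles $$R^{\varepsilon,\delta}_n=\big\{\lambda\in\mathbb{C}:\ |\operatorname{Re}\lambda-\dot\lambda^1_n(0)|<\delta_n,\ |\operatorname{Im}\lambda|<\varepsilon_n\big\},\qquad n\in\mathbb{Z},$$ with $\varepsilon=(\varepsilon_n)_{n\in\mathbb{Z}},\ \delta=(\delta_n)_{n\in\mathbb{Z}}\in\ell^{\infty,1/2}_{\mathbb{R}}$, such that for all $\psi\in W\cap(X_{\mathcal R}\cup X_{\mathcal I})$ and every $n\in\mathbb{Z}\setminus\{0\}$, $$\{\lambda\in\mathbb{C}:\Delta(\lambda,\psi)\in\mathbb{R}\}\cap R^{\varepsilon,\delta}_n=\gamma_n(\psi)\cup(R^{\varepsilon,\delta}_n\cap\mathbb{R}),$$ where the subset $\gamma_n(\psi)\subseteq\mathbb{C}$ forms an analytic arc transversal to the real axis, which crosses the real line in the critical point $\dot\lambda^1_n(\psi)$ of $\Delta(\cdot,\psi)$. These arcs are symmetric under reflection in the real axis, and the orthogonal projection of $\gamma_n(\psi)$ to the imaginary axis is a real analytic diffeomorphism onto its image.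
   Context: $X=H^1(\mathbb{T},\mathbb{C})^4$, $\mathbb{T}=\mathbb{R}/\mathbb{Z}$, with its Hilbert norm; $\psi=(\psi^1,\dots,\psi^4)\in X$. Set $\psi^*=(\overline{\psi^2},\overline{\psi^1},\overline{\psi^4},\overline{\psi^3})$; $X_{\mathcal R}=\{\psi\in X:\psi^*=\psi\}$ (real type), $X_{\mathcal I}=\{\psi\in X:\psi^*=-\psi\}$ (imaginary type). Let $\sigma_3=\mathrm{diag}(1,-1)$ and $V=\begin{pmatrix}-i\psi^1\psi^2 & 2\lambda\psi^1+i\psi^3\\ 2\lambda\psi^2-i\psi^4 & i\psi^1\psi^2\end{pmatrix}$. $M(t,\lambda,\psi)$ is the unique matrix solution of $\partial_tM=(-2i\lambda^2\sigma_3+V)M$, $M(0)=I$; $\Delta(\lambda,\psi)=\operatorname{tr}M(1,\lambda,\psi)$, $\dot\Delta=\partial_\lambda\Delta$. The space $\ell^{\infty,1/2}_{\mathbb{R}}$ consists of real sequences $(u_n)_{n\in\mathbb{Z}}$ with $\sup_n(1+n^2)^{1/4}|u_n|<\infty$. A rectangle is nondegenerate if both its side lengths are positive. Critical points are the roots of $\dot\Delta(\cdot,\psi)$. For $n\ge1$ let $U_n=\{\lambda\in\mathbb{C}:|2\lambda^2-n\pi|<\pi/4\}$, $D^1_n=U_n\cap\{\operatorname{Re}\lambda>0\}$ and $D^1_{-n}=U_n\cap\{\operatorname{Re}\lambda<0\}$. There is a neighborhood of the zero potential in $X$ such that for all $\psi$ in it and all $n\ne0$ the function $\dot\Delta(\cdot,\psi)$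 has exactly one root in $D^1_n$; this root is denoted $\dot\lambda^1_n(\psi)$ ($W$ is understood to lie in such a neighborhood). At $\psi=0$: $\dot\lambda^1_n(0)=\operatorname{sgn}(n)\sqrt{|n|\pi/2}$ for $n\in\mathbb{Z}$. *)

theory Defs
  imports "HOL-Analysis.Analysis"
begin

subsection \<open>The phase space\<close>

text \<open>
  An element of \<open>H\<^sup>1(\<real>/\<int>, \<complex>)\<close> is represented by its continuous representative, viewed as a
  1-periodic function on the real line: these are exactly the 1-periodic functions that on
  \<open>[0,1]\<close> are the primitive of a square integrable function.
\<close>

definition has_L2_derivative :: "(real \<Rightarrow> complex) \<Rightarrow> (real \<Rightarrow> complex) \<Rightarrow> bool" where
  "has_L2_derivative f g \<longleftrightarrow>
     set_borel_measurable lborel {0..1} g \<and>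
     set_integrable lborel {0..1} (\<lambda>t. (cmod (g t))\<^sup>2) \<and>
     (\<forall>t\<in>{0..1}. f t = f 0 + set_lebesgue_integral lborel {0..t} g)"

definition H1 :: "(real \<Rightarrow> complex) set" where
  "H1 = {f. (\<forall>t. f (t + 1) = f t) \<and> (\<exists>g. has_L2_derivative f g)}"

text \<open>
  The \<open>L\<^sup>2\<close> derivative is unique up to a null set of \<open>[0,1]\<close>, so the choice below does not
  affect the norm.
\<close>

definition H1_norm :: "(real \<Rightarrow> complex) \<Rightarrow> real" where
  "H1_norm f =
     sqrt (set_lebesgue_integral lborel {0..1} (\<lambda>t. (cmod (f t))\<^sup>2) +
           set_lebesgue_integral lborel {0..1} (\<lambda>t. (cmod ((SOME g. has_L2_derivative f g) t))\<^sup>2))"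

type_synonym potential = "real \<Rightarrow> complex^4"

definition X :: "potential set" where
  "X = {\<psi>. \<forall>j. (\<lambda>t. \<psi> t $ j) \<in> H1}"

definition X_norm :: "potential \<Rightarrow> real" where
  "X_norm \<psi> = sqrt (\<Sum>j\<in>UNIV. (H1_norm (\<lambda>t. \<psi> t $ j))\<^sup>2)"

definition nbhd_of_zero :: "potential set \<Rightarrow> bool" where
  "nbhd_of_zero W \<longleftrightarrow> W \<subseteq> X \<and> (\<exists>r>0. {\<psi>\<in>X. X_norm \<psi> < r} \<subseteq> W)"

definition star :: "potential \<Rightarrow> potential" where
  "star \<psi> = (\<lambda>t. vector [cnj (\<psi> t $ 2), cnj (\<psi> t $ 1), cnj (\<psi> t $ 4), cnj (\<psi> t $ 3)])"

lemma star_nth: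
  "star \<psi> t $ 1 = cnj (\<psi> t $ 2)" "star \<psi> t $ 2 = cnj (\<psi> t $ 1)"
  "star \<psi> t $ 3 = cnj (\<psi> t $ 4)" "star \<psi> t $ 4 = cnj (\<psi> t $ 3)"
  unfolding star_def vector_def by simp_all

definition X_real :: "potential set" where
  "X_real = {\<psi>\<in>X. star \<psi> = \<psi>}"

definition X_imag :: "potential set" where
  "X_imag = {\<psi>\<in>X. star \<psi> = (\<lambda>t. - \<psi> t)}"

subsection \<open>Fundamental solution, discriminant and critical points\<close>

definition sigma3 :: "complex^2^2" where
  "sigma3 = vector [vector [1, 0], vector [0, -1]]"

definition V :: "complex \<Rightarrow> complex^4 \<Rightarrow> complex^2^2" where
  "V z p =
     vector [vector [- \<i> * p$1 * p$2, 2 * z * p$1 + \<i> * p$3],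
             vector [2 * z * p$2 - \<i> * p$4, \<i> * p$1 * p$2]]"

text \<open>The factor \<open>mat c\<close> is the scalar matrix \<open>c I\<close>.\<close>

definition fundamental_solution :: "complex \<Rightarrow> potential \<Rightarrow> real \<Rightarrow> complex^2^2" where
  "fundamental_solution z \<psi> =
     (THE M. M 0 = mat 1 \<and>
        (\<forall>t. (M has_vector_derivative
               ((mat (- 2 * \<i> * z\<^sup>2) ** sigma3 + V z (\<psi> t)) ** M t)) (at t)))"

definition discr :: "complex \<Rightarrow> potential \<Rightarrow> complex" where
  "discr z \<psi> = trace (fundamental_solution z \<psi> 1)"

definition discr_dot :: "complex \<Rightarrow> potential \<Rightarrow> complex" where
  "discr_dot z \<psi> = deriv (\<lambda>w. discr w \<psi>) z"

definition U :: "int \<Rightarrow> complex set" where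
  "U n = {z. cmod (2 * z\<^sup>2 - of_int n * of_real pi) < pi / 4}"

text \<open>Only the values for \<open>n \<noteq> 0\<close> are meaningful.\<close>

definition D1 :: "int \<Rightarrow> complex set" where
  "D1 n = (if n > 0 then {z\<in>U n. Re z > 0} else {z\<in>U (- n). Re z < 0})"

text \<open>
  Meaningful only for those potentials for which the root in \<open>D1 n\<close> exists and is unique.
\<close>

definition crit_point :: "potential \<Rightarrow> int \<Rightarrow> complex" where
  "crit_point \<psi> n = (THE z. z \<in> D1 n \<and> discr_dot z \<psi> = 0)"

text \<open>The critical points of the zero potential, including the index \<open>n = 0\<close>.\<close>

definition crit_point_zero :: "int \<Rightarrow> real" where
  "crit_point_zero n = of_int (sgn n) * sqrt (of_int \<bar>n\<bar> * pi / 2)"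

subsection \<open>The rectangles\<close>

definition linf_half :: "(int \<Rightarrow> real) set" where
  "linf_half = {u. bdd_above (range (\<lambda>n. (1 + (of_int n)\<^sup>2) powr (1/4) * \<bar>u n\<bar>))}"

definition rect :: "(int \<Rightarrow> real) \<Rightarrow> (int \<Rightarrow> real) \<Rightarrow> int \<Rightarrow> complex set" where
  "rect \<epsilon> \<delta> n = {z. \<bar>Re z - crit_point_zero n\<bar> < \<delta> n \<and> \<bar>Im z\<bar> < \<epsilon> n}"

subsection \<open>Analytic arcs\<close>

definition real_analytic_on :: "(real \<Rightarrow> 'a::real_normed_vector) \<Rightarrow> real set \<Rightarrow> bool" where
  "real_analytic_on f S \<longleftrightarrow>
     (\<forall>x\<in>S. \<exists>r>0. \<exists>a. \<forall>y. \<bar>y - x\<bar> < r \<longrightarrow> (\<lambda>k. (y - x) ^ k *\<^sub>R a k) sums f y)"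

definition real_analytic_diffeo :: "(real \<Rightarrow> real) \<Rightarrow> real set \<Rightarrow> real set \<Rightarrow> bool" where
  "real_analytic_diffeo f S T \<longleftrightarrow>
     open S \<and> open T \<and> bij_betw f S T \<and>
     real_analytic_on f S \<and> real_analytic_on (inv_into S f) T"

text \<open>
  \<open>analytic_arc c J \<gamma>\<close>: the set \<open>\<gamma>\<close> is an analytic arc in the plane, with regular analytic
  parametrization \<open>c\<close> defined on the open interval \<open>J\<close>.
\<close>

definition analytic_arc :: "(real \<Rightarrow> complex) \<Rightarrow> real set \<Rightarrow> complex set \<Rightarrow> bool" where
  "analytic_arc c J \<gamma> \<longleftrightarrow>
     J \<noteq> {} \<and> open J \<and> is_interval J \<and>
     real_analytic_on c J \<and> (\<forall>t\<in>J. vector_derivative c (at t) \<noteq> 0) \<and>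
     (\<exists>c'. homeomorphism J \<gamma> c c')"

text \<open>At each parameter where the curve meets the real axis, its tangent is not real.\<close>

definition transversal_to_reals :: "(real \<Rightarrow> complex) \<Rightarrow> real set \<Rightarrow> bool" where
  "transversal_to_reals c J \<longleftrightarrow>
     (\<forall>t\<in>J. c t \<in> \<real> \<longrightarrow> Im (vector_derivative c (at t)) \<noteq> 0)"

text \<open>
  The orthogonal projection to the imaginary axis is the map \<open>Im\<close>, the imaginary axis being
  identified with the reals. The parametrization serves as a global analytic chart of the arc,
  so the projection is a real analytic diffeomorphism of the arc onto its image exactly when
  its expression \<open>Im \<circ> c\<close> in this chart is; this does not depend on the parametrization.
\<close>

definition Im_projection_diffeo :: "(real \<Rightarrow> complex) \<Rightarrow> real set \<Rightarrow> complex set \<Rightarrow> bool" where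
  "Im_projection_diffeo c J \<gamma> \<longleftrightarrow> real_analytic_diffeo (Im \<circ> c) J (Im ` \<gamma>)"

end

theory Submission
  imports Defs "HOL-Complex_Analysis.Complex_Analysis"
begin

text \<open>
  Write \<open>\<Delta>\<close> for the discriminant and \<open>\<lambda>\<^sub>n\<close> for the critical points of the zero potential. The proof
  rests on one uniform statement: if the potential is small in \<open>X\<close>, then \<open>\<Delta>(z, \<psi>)\<close> is uniformly close
  to \<open>2 cos (2 z\<^sup>2)\<close>, its value at the zero potential, for all \<open>z\<close> with \<open>\<bar>z\<bar> \<ge> 1/2\<close> in the unbounded region
  \<open>\<bar>Im (2 z\<^sup>2)\<bar> \<le> 2\<close>, which contains the sets \<open>D1 n\<close> and the rectangles for all \<open>n \<noteq> 0\<close> (\<open>discr_estimate\<close>).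
  No decay as \<open>\<bar>n\<bar>\<close> grows is needed, because every later step takes place in a chart in which
  the functions for different \<open>n\<close> look alike.

  The uniform statement is not a naive perturbation result, since the potential enters the system
  multiplied by \<open>2 z\<close>. The vectors \<open>(1, \<i> \<psi>\<^sup>2 / (2 z)) exp (- 2 \<i> z\<^sup>2 t)\<close> and
  \<open>(- \<i> \<psi>\<^sup>1 / (2 z), 1) exp (2 \<i> z\<^sup>2 t)\<close>, however, solve the system up to a residual in which all
  terms of positive order in \<open>z\<close> cancel, as does the diagonal entry \<open>\<i> \<psi>\<^sup>1 \<psi>\<^sup>2\<close>. What remains is
  controlled by \<open>\<bar>\<psi>\<bar>\<close> and by the derivatives of \<open>\<psi>\<^sup>1\<close> and \<open>\<psi>\<^sup>2\<close> in the mean; this is where the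
  regularity \<open>H\<^sup>1\<close> is used (\<open>quasimode_residual\<close>, \<open>approximate_fundamental_system_bound\<close>).
  Those derivatives exist only almost everywhere, so \<open>\<psi>\<^sup>1\<close> and \<open>\<psi>\<^sup>2\<close> are first replaced by moving averages,
  whose distance from the functions may be chosen depending on \<open>z\<close> (\<open>smooth_approximation\<close>).

  Cauchy's estimates turn closeness of the functions into closeness of two derivatives. In the
  coordinate \<open>2 z\<^sup>2 - \<bar>n\<bar> \<pi>\<close> the discriminant is, up to sign, a perturbation of \<open>2 cos w\<close>, whose derivative has a
  single zero near \<open>w = 0\<close>, a nondegenerate one; a contraction argument gives existence and uniqueness of the critical
  point (\<open>unique_critical_point\<close>).

  For potentials of real or imaginary type \<open>\<Delta>\<close> commutes with complex conjugation. In the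
  coordinate \<open>w = 4 \<lambda>\<^sub>n (z - \<lambda>\<^sub>n)\<close> let \<open>F\<close> be the discriminant up to sign, so that \<open>F''\<close> is close to \<open>-2\<close>.
  For real \<open>x\<close> and \<open>y \<noteq> 0\<close> the value \<open>F (x + \<i> y)\<close> is real exactly if the quotient
  \<open>(F (x + \<i> y) - F (x - \<i> y)) / (2 \<i> y)\<close> vanishes. This quotient extends holomorphically to \<open>y = 0\<close>
  with value \<open>F' x\<close>, and its derivative in \<open>x\<close> is close to \<open>-2\<close>. Solving for \<open>x\<close> by iteration, for complex
  \<open>y\<close>, gives a holomorphic function \<open>\<xi>\<close> whose restriction to real \<open>y\<close> describes the nonreal part of the
  level set as a graph over the imaginary axis, passing through the critical point at \<open>y = 0\<close>
  (\<open>graph_of_real_level\<close>). Parametrized by its imaginary part, the arc is visibly real analytic,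
  transversal to the real axis and projects diffeomorphically to the imaginary axis.
\<close>

section \<open>Linear systems depending polynomially on a parameter\<close>

text \<open>
  The sign for negative \<open>t\<close> makes this an antiderivative on the whole line.
\<close>
definition signed_integral :: "(real \<Rightarrow> complex) \<Rightarrow> real \<Rightarrow> complex" where
  "signed_integral f t = integral {0..t} f - integral {t..0} f"

lemma signed_integral_0 [simp]: "signed_integral f 0 = 0"
  by (simp add: signed_integral_def)

lemma signed_integral_has_vector_derivative:
  assumes "continuous_on UNIV f"
  shows "(signed_integral f has_vector_derivative f t) (at t)"
proof -
  \<comment> \<open>On a symmetric interval around \<open>0\<close> the signed integral differs from an ordinary indefinite integral by a constant.\<close>
  define T where "T = \<bar>t\<bar> + 1"
  have cont: "continuous_on {a..b} f" for a b
    using assms continuous_on_subset by blast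
  have eq: "signed_integral f s = integral {-T..s} f - integral {-T..0} f" if "s \<in> {-T<..<T}" for s
  proof (cases "s \<ge> 0")
    case True
    have "integral {-T..0} f + integral {0..s} f = integral {-T..s} f"
      using True that by (intro Henstock_Kurzweil_Integration.integral_combine integrable_continuous_real cont) (auto simp: T_def)
    moreover have "integral {s..0} f = 0"
      using True by (cases "s = 0") auto
    ultimately show ?thesis
      by (simp add: signed_integral_def algebra_simps)
  next
    case False
    have "integral {-T..s} f + integral {s..0} f = integral {-T..0} f"
      using False that by (intro Henstock_Kurzweil_Integration.integral_combine integrable_continuous_real cont) (auto simp: T_def)
    then show ?thesis using False
      by (simp add: signed_integral_def algebra_simps)
  qed
  have t: "t \<in> {-T<..<T}"
    by (auto simp: T_def)
  have "((\<lambda>s. integral {-T..s} f) has_vector_derivative f t) (at t within {-T..T})"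
    using t by (intro integral_has_vector_derivative cont) auto
  then have "((\<lambda>s. integral {-T..s} f) has_vector_derivative f t) (at t)"
    using t by (subst (asm) at_within_interior) auto
  then have "((\<lambda>s. integral {-T..s} f - integral {-T..0} f) has_vector_derivative f t - 0) (at t)"
    by (intro has_vector_derivative_diff has_vector_derivative_const)
  then show ?thesis
    using has_vector_derivative_transform_within_open[of "\<lambda>s. integral {-T..s} f - integral {-T..0} f" "f t" t "{-T<..<T}" "signed_integral f"]
      t eq by auto
qed

lemma continuous_on_signed_integral:
  assumes "continuous_on UNIV f"
  shows "continuous_on UNIV (signed_integral f)"
  using signed_integral_has_vector_derivative[OF assms]
  by (meson continuous_at_imp_continuous_on has_vector_derivative_continuous)

lemma signed_integral_add:
  assumes "continuous_on UNIV f" "continuous_on UNIV g"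
  shows "signed_integral (\<lambda>s. f s + g s) t = signed_integral f t + signed_integral g t"
proof -
  have "f integrable_on {a..b}" "g integrable_on {a..b}" for a b
    using assms by (auto intro!: integrable_continuous_real intro: continuous_on_subset)
  then show ?thesis
    by (simp add: signed_integral_def integral_add)
qed

lemma signed_integral_cmult: "signed_integral (\<lambda>s. c * f s) t = c * signed_integral f t"
  by (simp add: signed_integral_def algebra_simps)

text \<open>
  Iterating this estimate produces the factorials that make the Picard series converge.
\<close>
lemma norm_signed_integral_le:
  assumes f: "continuous_on UNIV f"
    and b: "\<And>s. \<bar>s\<bar> \<le> \<bar>t\<bar> \<Longrightarrow> norm (f s) \<le> K * \<bar>s\<bar> ^ k"
  shows "norm (signed_integral f t) \<le> K * \<bar>t\<bar> ^ Suc k / Suc k"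
proof (cases "t \<ge> 0")
  case True
  have "((\<lambda>s. K * s ^ k) has_integral (K * t ^ Suc k / Suc k - K * 0 ^ Suc k / Suc k)) {0..t}"
    using True by (intro fundamental_theorem_of_calculus)
      (auto simp flip: has_real_derivative_iff_has_vector_derivative intro!: derivative_eq_intros simp del: power_Suc)
  then have i: "((\<lambda>s. K * s ^ k) has_integral (K * t ^ Suc k / Suc k)) {0..t}"
    by simp
  have "norm (integral {0..t} f) \<le> integral {0..t} (\<lambda>s. K * s ^ k)"
  proof (intro integral_norm_bound_integral integrable_continuous_real continuous_on_subset[OF f])
    show "continuous_on {0..t} (\<lambda>s. K * s ^ k)" by (intro continuous_intros)
    show "norm (f x) \<le> K * x ^ k" if "x \<in> {0..t}" for x
      using b[of x] that by auto
  qed auto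
  moreover have "integral {t..0} f = 0"
    using True by (cases "t = 0") auto
  ultimately show ?thesis
    unfolding integral_unique[OF i] using True by (simp add: signed_integral_def)
next
  case False
  have "((\<lambda>s. K * (-s) ^ k) has_integral (- (K * (-0) ^ Suc k / Suc k) - (- (K * (-t) ^ Suc k / Suc k)))) {t..0}"
    using False by (intro fundamental_theorem_of_calculus)
      (auto simp flip: has_real_derivative_iff_has_vector_derivative intro!: derivative_eq_intros simp del: power_Suc)
  then have i: "((\<lambda>s. K * (-s) ^ k) has_integral (K * (-t) ^ Suc k / Suc k)) {t..0}"
    by simp
  have "norm (integral {t..0} f) \<le> integral {t..0} (\<lambda>s. K * (-s) ^ k)"
  proof (intro integral_norm_bound_integral integrable_continuous_real continuous_on_subset[OF f])
    show "continuous_on {t..0} (\<lambda>s. K * (-s) ^ k)" by (intro continuous_intros)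
    show "norm (f x) \<le> K * (- x) ^ k" if "x \<in> {t..0}" for x
      using b[of x] that False by auto
  qed auto
  then show ?thesis
    unfolding integral_unique[OF i] using False by (simp add: signed_integral_def)
qed

text \<open>
  Polynomials in the parameter \<open>z\<close> whose coefficients are continuous functions of the time \<open>t\<close>.
  The class is closed under products and integration in \<open>t\<close>, so that all Picard iterates belong to it;
  holomorphy in the parameter then needs no differentiation under the integral sign.
\<close>
inductive param_poly :: "(complex \<Rightarrow> real \<Rightarrow> complex) \<Rightarrow> bool" where
  param_poly_const: "continuous_on UNIV f \<Longrightarrow> param_poly (\<lambda>z. f)"
| param_poly_add: "param_poly f \<Longrightarrow> param_poly g \<Longrightarrow> param_poly (\<lambda>z t. f z t + g z t)"
| param_poly_param: "param_poly f \<Longrightarrow> param_poly (\<lambda>z t. z * f z t)"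

lemma param_poly_continuous: "param_poly f \<Longrightarrow> continuous_on UNIV (f z)"
  by (induction arbitrary: z rule: param_poly.induct) (auto intro!: continuous_intros)

lemma param_poly_holomorphic: "param_poly f \<Longrightarrow> (\<lambda>z. f z t) holomorphic_on S"
  by (induction rule: param_poly.induct) (auto intro!: holomorphic_intros)

lemma param_poly_bounded:
  "param_poly f \<Longrightarrow> \<exists>M\<ge>0. \<forall>z t. norm z \<le> R \<and> \<bar>t\<bar> \<le> T \<longrightarrow> norm (f z t) \<le> M"
proof (induction rule: param_poly.induct)
  case (param_poly_const f)
  have "compact (f ` {-T..T})"
    using param_poly_const by (intro compact_continuous_image) (auto intro: continuous_on_subset)
  then obtain B where B: "\<And>x. x \<in> f ` {-T..T} \<Longrightarrow> norm x \<le> B"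
    using compact_imp_bounded bounded_iff by metis
  have "norm (f t) \<le> max B 0" if "\<bar>t\<bar> \<le> T" for t
    using B[of "f t"] that by (auto simp: le_max_iff_disj abs_le_iff)
  then show ?case
    by (intro exI[of _ "max B 0"]) auto
next
  case (param_poly_add f g)
  then obtain M N where "M \<ge> 0" "\<forall>z t. norm z \<le> R \<and> \<bar>t\<bar> \<le> T \<longrightarrow> norm (f z t) \<le> M"
    "N \<ge> 0" "\<forall>z t. norm z \<le> R \<and> \<bar>t\<bar> \<le> T \<longrightarrow> norm (g z t) \<le> N" by blast
  then show ?case
    by (intro exI[of _ "M + N"]) (auto intro!: norm_triangle_le add_mono)
next
  case (param_poly_param f)
  then obtain M where "M \<ge> 0" "\<forall>z t. norm z \<le> R \<and> \<bar>t\<bar> \<le> T \<longrightarrow> norm (f z t) \<le> M" by blast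
  then show ?case
    by (intro exI[of _ "max R 0 * M"]) (auto simp: norm_mult intro!: mult_mono)
qed

lemma param_poly_mult:
  assumes "param_poly f" "param_poly g"
  shows "param_poly (\<lambda>z t. f z t * g z t)"
proof -
  have const: "param_poly (\<lambda>z t. h t * g z t)" if h: "continuous_on UNIV h" for h
    using assms(2)
  proof (induction rule: param_poly.induct)
    case (param_poly_const f)
    then show ?case using h by (intro param_poly.param_poly_const continuous_intros)
  next
    case (param_poly_add f g)
    then show ?case using param_poly.param_poly_add by (fastforce simp: algebra_simps)
  next
    case (param_poly_param f)
    then show ?case using param_poly.param_poly_param[OF param_poly_param.IH] by (simp add: mult.left_commute)
  qed
  show ?thesis
    using assms(1)
  proof (induction rule: param_poly.induct)
    case (param_poly_const f)
    then show ?case by (rule const)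
  next
    case (param_poly_add f g)
    then show ?case using param_poly.param_poly_add by (fastforce simp: algebra_simps)
  next
    case (param_poly_param f)
    then show ?case using param_poly.param_poly_param[OF param_poly_param.IH] by (simp add: mult.assoc)
  qed
qed

lemma param_poly_signed_integral: "param_poly f \<Longrightarrow> param_poly (\<lambda>z. signed_integral (f z))"
proof (induction rule: param_poly.induct)
  case (param_poly_const f)
  then show ?case by (intro param_poly.param_poly_const continuous_on_signed_integral)
next
  case (param_poly_add f g)
  have "(\<lambda>z. signed_integral (\<lambda>t. f z t + g z t)) = (\<lambda>z t. signed_integral (f z) t + signed_integral (g z) t)"
    using param_poly_add.hyps by (intro ext signed_integral_add param_poly_continuous)
  then show ?case using param_poly.param_poly_add[OF param_poly_add.IH] by simp
next
  case (param_poly_param f)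
  then show ?case using param_poly.param_poly_param[OF param_poly_param.IH] by (simp add: signed_integral_cmult)
qed

lemma param_poly_cong: "param_poly f \<Longrightarrow> (\<And>z t. f z t = g z t) \<Longrightarrow> param_poly g"
  by (metis ext)

text \<open>
  The terms of the Picard series of the linear system with coefficient matrix \<open>((A, B), (C, D))\<close>.
\<close>
primrec picard_term ::
  "(complex \<Rightarrow> real \<Rightarrow> complex) \<Rightarrow> (complex \<Rightarrow> real \<Rightarrow> complex) \<Rightarrow> (complex \<Rightarrow> real \<Rightarrow> complex) \<Rightarrow>
   (complex \<Rightarrow> real \<Rightarrow> complex) \<Rightarrow> complex \<Rightarrow> complex \<Rightarrow> nat \<Rightarrow>
   (complex \<Rightarrow> real \<Rightarrow> complex) \<times> (complex \<Rightarrow> real \<Rightarrow> complex)" where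
  "picard_term A B C D u v 0 = (\<lambda>z t. u, \<lambda>z t. v)"
| "picard_term A B C D u v (Suc k) =
     (\<lambda>z. signed_integral (\<lambda>s. A z s * fst (picard_term A B C D u v k) z s + B z s * snd (picard_term A B C D u v k) z s),
      \<lambda>z. signed_integral (\<lambda>s. C z s * fst (picard_term A B C D u v k) z s + D z s * snd (picard_term A B C D u v k) z s))"

text \<open>
  For \<open>\<bar>z\<bar> \<le> R\<close> and \<open>\<bar>t\<bar> \<le> T\<close> the term of index \<open>k\<close> of the Picard series is at most \<open>N (2 M T)\<^sup>k / k!\<close>,
  where \<open>M\<close> bounds the coefficients. Hence the series and the series of its time derivatives converge
  uniformly there, and the sum is holomorphic in \<open>z\<close> as a locally uniform limit of polynomials.
\<close>
lemma linear_ode_solution: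
  fixes u v :: complex
  assumes param_poly: "param_poly A" "param_poly B" "param_poly C" "param_poly D"
  obtains a b where "\<And>z. a z 0 = u" "\<And>z. b z 0 = v"
    "\<And>z t. (a z has_vector_derivative A z t * a z t + B z t * b z t) (at t)"
    "\<And>z t. (b z has_vector_derivative C z t * a z t + D z t * b z t) (at t)"
    "\<And>t. (\<lambda>z. a z t) holomorphic_on UNIV" "\<And>t. (\<lambda>z. b z t) holomorphic_on UNIV"
proof -
  define p q where "p k = fst (picard_term A B C D u v k)" and "q k = snd (picard_term A B C D u v k)" for k
  have p0: "p 0 z t = u" and q0: "q 0 z t = v" for z t
    by (auto simp: p_def q_def)
  have pS: "p (Suc k) z = signed_integral (\<lambda>s. A z s * p k z s + B z s * q k z s)"
    and qS: "q (Suc k) z = signed_integral (\<lambda>s. C z s * p k z s + D z s * q k z s)" for k z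
    by (auto simp: p_def q_def)
  have poly_pq: "param_poly (p k) \<and> param_poly (q k)" for k
  proof (induction k)
    case 0
    have "param_poly (\<lambda>z t. c)" for c
      by (intro param_poly_const continuous_intros)
    then show ?case using param_poly_cong p0 q0 by metis
  next
    case (Suc k)
    then show ?case
      by (auto intro!: param_poly param_poly_signed_integral param_poly_add param_poly_mult simp: pS[abs_def] qS[abs_def])
  qed
  have cont: "continuous_on UNIV (A z)" "continuous_on UNIV (B z)" "continuous_on UNIV (C z)"
    "continuous_on UNIV (D z)" "continuous_on UNIV (p k z)" "continuous_on UNIV (q k z)" for k z
    using param_poly poly_pq param_poly_continuous by blast+
  define N where "N = max (norm u) (norm v)"
  have bd: "\<exists>M\<ge>0. (\<forall>z t. norm z \<le> R \<and> \<bar>t\<bar> \<le> T \<longrightarrow> norm (A z t) \<le> M \<and> norm (B z t) \<le> M \<and>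
       norm (C z t) \<le> M \<and> norm (D z t) \<le> M) \<and>
    (\<forall>z t k. norm z \<le> R \<and> \<bar>t\<bar> \<le> T \<longrightarrow> norm (p k z t) \<le> N * (2 * M * T) ^ k / fact k \<and>
       norm (q k z t) \<le> N * (2 * M * T) ^ k / fact k)" if "T \<ge> 0" for R T
  proof -
    from param_poly_bounded[OF param_poly(1), of R T] param_poly_bounded[OF param_poly(2), of R T] param_poly_bounded[OF param_poly(3), of R T]
      param_poly_bounded[OF param_poly(4), of R T] obtain M1 M2 M3 M4 where
      M: "M1 \<ge> 0" "\<forall>z t. norm z \<le> R \<and> \<bar>t\<bar> \<le> T \<longrightarrow> norm (A z t) \<le> M1"
      "M2 \<ge> 0" "\<forall>z t. norm z \<le> R \<and> \<bar>t\<bar> \<le> T \<longrightarrow> norm (B z t) \<le> M2"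
      "M3 \<ge> 0" "\<forall>z t. norm z \<le> R \<and> \<bar>t\<bar> \<le> T \<longrightarrow> norm (C z t) \<le> M3"
      "M4 \<ge> 0" "\<forall>z t. norm z \<le> R \<and> \<bar>t\<bar> \<le> T \<longrightarrow> norm (D z t) \<le> M4"
      by blast
    define M where "M = M1 + M2 + M3 + M4"
    have M0: "M \<ge> 0" using M by (auto simp: M_def)
    have MM: "norm (A z t) \<le> M \<and> norm (B z t) \<le> M \<and> norm (C z t) \<le> M \<and> norm (D z t) \<le> M"
      if "norm z \<le> R" "\<bar>t\<bar> \<le> T" for z t
      using that M by (smt (verit) M_def)
    have N0: "N \<ge> 0" by (simp add: N_def le_max_iff_disj)
    have two: "norm (x1 * y1 + x2 * y2) \<le> (2 * M) * w"
      if "norm x1 \<le> M" "norm x2 \<le> M" "norm y1 \<le> w" "norm y2 \<le> w" "w \<ge> 0" for x1 x2 y1 y2 :: complex and w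
    proof -
      have "norm (x1 * y1 + x2 * y2) \<le> norm x1 * norm y1 + norm x2 * norm y2"
        by (metis norm_mult norm_triangle_ineq)
      also have "\<dots> \<le> M * w + M * w"
        using that M0 by (intro add_mono mult_mono) auto
      finally show ?thesis by simp
    qed
    have pq: "norm (p k z t) \<le> N * (2 * M) ^ k / fact k * \<bar>t\<bar> ^ k \<and>
       norm (q k z t) \<le> N * (2 * M) ^ k / fact k * \<bar>t\<bar> ^ k" if "norm z \<le> R" "\<bar>t\<bar> \<le> T" for k z t
      using that(2)
    proof (induction k arbitrary: t)
      case 0
      then show ?case by (auto simp: p0 q0 N_def)
    next
      case (Suc k)
      let ?K = "(2 * M) * (N * (2 * M) ^ k / fact k)"
      have K: "N * (2 * M) ^ k / fact k \<ge> 0" using M0 N0 by simp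
      have IH: "norm (p k z s) \<le> N * (2 * M) ^ k / fact k * \<bar>s\<bar> ^ k"
        "norm (q k z s) \<le> N * (2 * M) ^ k / fact k * \<bar>s\<bar> ^ k" if "\<bar>s\<bar> \<le> \<bar>t\<bar>" for s
        using Suc.IH[of s] that Suc.prems by auto
      have eq: "?K * \<bar>t\<bar> ^ Suc k / Suc k = N * (2 * M) ^ Suc k / fact (Suc k) * \<bar>t\<bar> ^ Suc k"
        by (simp add: field_simps)
      have "norm (A z s * p k z s + B z s * q k z s) \<le> ?K * \<bar>s\<bar> ^ k \<and>
        norm (C z s * p k z s + D z s * q k z s) \<le> ?K * \<bar>s\<bar> ^ k" if s: "\<bar>s\<bar> \<le> \<bar>t\<bar>" for s
      proof -
        have w: "N * (2 * M) ^ k / fact k * \<bar>s\<bar> ^ k \<ge> 0"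
          using K by (intro mult_nonneg_nonneg) auto
        have "norm (A z s) \<le> M" "norm (B z s) \<le> M" "norm (C z s) \<le> M" "norm (D z s) \<le> M"
          using MM[of z s] s Suc.prems \<open>norm z \<le> R\<close> by auto
        then show ?thesis
          using two[OF _ _ IH[OF s] w] by (simp only: mult.assoc)
      qed
      then show ?case
        unfolding pS qS eq[symmetric]
        by (intro conjI norm_signed_integral_le continuous_intros cont) auto
    qed
    have "N * (2 * M) ^ k / fact k * \<bar>t\<bar> ^ k \<le> N * (2 * M * T) ^ k / fact k" if "\<bar>t\<bar> \<le> T" for t k
    proof -
      have "N * (2 * M) ^ k / fact k * \<bar>t\<bar> ^ k \<le> N * (2 * M) ^ k / fact k * T ^ k"
        using M0 N0 that by (intro mult_left_mono power_mono) auto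
      then show ?thesis by (simp add: power_mult_distrib)
    qed
    then show ?thesis
      using M0 MM pq by (intro exI[of _ M]) (meson order_trans)
  qed
  define a b where "a z t = (\<Sum>k. p k z t)" and "b z t = (\<Sum>k. q k z t)" for z t
  have summ: "summable (\<lambda>k. N * x ^ k / fact k)" for x
    using summable_mult[OF summable_exp, of N x] by (simp add: field_simps)
  have sums: "(\<lambda>k. p k z t) sums a z t" "(\<lambda>k. q k z t) sums b z t" for z t
  proof -
    obtain M where "\<forall>z' t' k. norm z' \<le> norm z \<and> \<bar>t'\<bar> \<le> \<bar>t\<bar> \<longrightarrow> norm (p k z' t') \<le> N * (2 * M * \<bar>t\<bar>) ^ k / fact k \<and>
       norm (q k z' t') \<le> N * (2 * M * \<bar>t\<bar>) ^ k / fact k"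
      using bd[of "\<bar>t\<bar>" "norm z"] by auto
    then have "summable (\<lambda>k. p k z t)" "summable (\<lambda>k. q k z t)"
      by (auto intro!: summable_comparison_test'[OF summ])
    then show "(\<lambda>k. p k z t) sums a z t" "(\<lambda>k. q k z t) sums b z t"
      by (auto simp: a_def b_def summable_sums)
  qed
  have hol: "(\<lambda>z. a z t) holomorphic_on UNIV" "(\<lambda>z. b z t) holomorphic_on UNIV" for t
  proof -
    have *: "(\<lambda>z. \<Sum>k. r k z t) holomorphic_on UNIV" if r: "r = p \<or> r = q" for r
    proof (rule holomorphic_uniform_sequence[where f = "\<lambda>n z. \<Sum>k<n. r k z t"])
      show "(\<lambda>z. \<Sum>k<n. r k z t) holomorphic_on UNIV" for n
      proof (intro holomorphic_on_sum)
        fix k show "(\<lambda>z. r k z t) holomorphic_on UNIV"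
          using r poly_pq[of k] param_poly_holomorphic[of "p k" t UNIV] param_poly_holomorphic[of "q k" t UNIV] by auto
      qed
      fix z :: complex
      obtain M where "\<forall>z' t' k. norm z' \<le> norm z + 1 \<and> \<bar>t'\<bar> \<le> \<bar>t\<bar> \<longrightarrow> norm (p k z' t') \<le> N * (2 * M * \<bar>t\<bar>) ^ k / fact k \<and>
        norm (q k z' t') \<le> N * (2 * M * \<bar>t\<bar>) ^ k / fact k"
        using bd[of "\<bar>t\<bar>" "norm z + 1"] by auto
      moreover have "norm z' \<le> norm z + 1" if "z' \<in> cball z 1" for z'
        using that norm_triangle_ineq4[of z' z] norm_triangle_sub[of z' z] by (auto simp: dist_norm norm_minus_commute)
      ultimately have "uniform_limit (cball z 1) (\<lambda>n z. \<Sum>k<n. r k z t) (\<lambda>z. \<Sum>k. r k z t) sequentially"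
        using r by (intro Weierstrass_m_test[OF _ summ[of "2 * M * \<bar>t\<bar>"]]) auto
      then show "\<exists>d>0. cball z d \<subseteq> UNIV \<and> uniform_limit (cball z d) (\<lambda>n z. \<Sum>k<n. r k z t) (\<lambda>z. \<Sum>k. r k z t) sequentially"
        by (intro exI[of _ 1]) auto
    qed auto
    show "(\<lambda>z. a z t) holomorphic_on UNIV" "(\<lambda>z. b z t) holomorphic_on UNIV"
      using *[of p] *[of q] by (auto simp: a_def b_def)
  qed
  have der: "(a z has_vector_derivative A z t * a z t + B z t * b z t) (at t) \<and>
    (b z has_vector_derivative C z t * a z t + D z t * b z t) (at t)" for z t
  proof -
    define T where "T = \<bar>t\<bar> + 1"
    obtain M where M0: "M \<ge> 0" and M: "\<And>s. \<bar>s\<bar> \<le> T \<Longrightarrow> norm (A z s) \<le> M \<and> norm (B z s) \<le> M \<and>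
       norm (C z s) \<le> M \<and> norm (D z s) \<le> M"
      and pq: "\<And>s k. \<bar>s\<bar> \<le> T \<Longrightarrow> norm (p k z s) \<le> N * (2 * M * T) ^ k / fact k \<and>
        norm (q k z s) \<le> N * (2 * M * T) ^ k / fact k"
      using bd[of T "norm z"] by (force simp: T_def)
    have *: "(f has_vector_derivative E z t * a z t + F z t * b z t) (at t)"
      if f: "\<And>s. f s = (\<Sum>k. r k s)" "\<And>s. summable (\<lambda>k. r k s)"
        and r0: "\<And>s. r 0 s = c" and r: "\<And>k. r (Suc k) = signed_integral (\<lambda>s. E z s * p k z s + F z s * q k z s)"
        and EF: "continuous_on UNIV (E z)" "continuous_on UNIV (F z)"
          "\<And>s. \<bar>s\<bar> \<le> T \<Longrightarrow> norm (E z s) \<le> M \<and> norm (F z s) \<le> M" for f r c E F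
    proof -
      let ?d = "\<lambda>k s. E z s * p k z s + F z s * q k z s"
      have sd: "(\<lambda>k. ?d k s) sums (E z s * a z s + F z s * b z s)" for s
        by (intro sums_add sums_mult sums)
      have "uniform_limit {-T<..<T} (\<lambda>n s. \<Sum>k<n. ?d k s) (\<lambda>s. \<Sum>k. ?d k s) sequentially"
      proof (rule Weierstrass_m_test)
        show "summable (\<lambda>k. 2 * M * (N * (2 * M * T) ^ k / fact k))"
          by (intro summable_mult summ)
        fix k s assume s: "s \<in> {-T<..<T}"
        have "norm (?d k s) \<le> norm (E z s) * norm (p k z s) + norm (F z s) * norm (q k z s)"
          by (metis norm_mult norm_triangle_ineq)
        also have "\<dots> \<le> M * (N * (2 * M * T) ^ k / fact k) + M * (N * (2 * M * T) ^ k / fact k)"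
          using s EF(3)[of s] pq[of s k] M0 by (intro add_mono mult_mono) auto
        finally show "norm (?d k s) \<le> 2 * M * (N * (2 * M * T) ^ k / fact k)" by simp
      qed
      then have ul: "uniform_limit {-T<..<T} (\<lambda>n s. \<Sum>k<n. ?d k s) (\<lambda>s. E z s * a z s + F z s * b z s) sequentially"
        using sd by (simp add: sums_iff)
      have "\<exists>g. \<forall>x\<in>{-T<..<T}. (\<lambda>k. r (Suc k) x) sums g x \<and>
          (g has_derivative (\<lambda>h. h *\<^sub>R (E z x * a z x + F z x * b z x))) (at x within {-T<..<T})"
      proof (rule has_derivative_series[where f' = "\<lambda>k x h. h *\<^sub>R ?d k x" and x = 0 and l = "f 0 - r 0 0"])
        show "(r (Suc k) has_derivative (\<lambda>h. h *\<^sub>R ?d k x)) (at x within {-T<..<T})" for k x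
        proof -
          have "continuous_on UNIV (?d k)"
            using EF cont by (intro continuous_on_add continuous_on_mult) auto
          from signed_integral_has_vector_derivative[OF this, of x] show ?thesis
            unfolding r has_vector_derivative_def by (rule has_derivative_at_withinI)
        qed
        show "\<forall>\<^sub>F n in sequentially. \<forall>x\<in>{-T<..<T}. \<forall>h.
            norm ((\<Sum>i<n. h *\<^sub>R ?d i x) - h *\<^sub>R (E z x * a z x + F z x * b z x)) \<le> e * norm h" if "e > 0" for e
        proof -
          have "\<forall>\<^sub>F n in sequentially. \<forall>x\<in>{-T<..<T}. dist (\<Sum>k<n. ?d k x) (E z x * a z x + F z x * b z x) < e"
            using ul that by (auto simp: uniform_limit_iff)
          then show ?thesis
          proof eventually_elim
            case (elim n)
            show ?case
            proof (intro ballI allI)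
              fix x h assume x: "x \<in> {-T<..<T}"
              have "(\<Sum>i<n. h *\<^sub>R ?d i x) - h *\<^sub>R (E z x * a z x + F z x * b z x) =
                h *\<^sub>R ((\<Sum>i<n. ?d i x) - (E z x * a z x + F z x * b z x))"
                by (simp only: scaleR_diff_right scaleR_sum_right)
              then show "norm ((\<Sum>i<n. h *\<^sub>R ?d i x) - h *\<^sub>R (E z x * a z x + F z x * b z x)) \<le> e * norm h"
                using mult_left_mono[OF less_imp_le[OF elim[rule_format, OF x, unfolded dist_norm]], of "\<bar>h\<bar>"]
                by (simp only: norm_scaleR abs_ge_zero real_norm_def mult.commute)
            qed
          qed
        qed
        show "(\<lambda>n. r (Suc n) 0) sums (f 0 - r 0 0)"
          using summable_sums[OF f(2)[of 0]] by (subst sums_Suc_iff) (simp add: f(1))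
      qed (auto simp: T_def)
      then obtain g where g: "\<And>x. x \<in> {-T<..<T} \<Longrightarrow> (\<lambda>k. r (Suc k) x) sums g x"
        "\<And>x. x \<in> {-T<..<T} \<Longrightarrow>
          (g has_derivative (\<lambda>h. h *\<^sub>R (E z x * a z x + F z x * b z x))) (at x within {-T<..<T})"
        by blast
      have t: "t \<in> {-T<..<T}" by (auto simp: T_def)
      have "(g has_vector_derivative E z t * a z t + F z t * b z t) (at t)"
        using g(2)[OF t] unfolding has_vector_derivative_def at_within_open[OF t open_greaterThanLessThan] .
      then have gd: "((\<lambda>s. g s + c) has_vector_derivative E z t * a z t + F z t * b z t + 0) (at t)"
        by (intro has_vector_derivative_add has_vector_derivative_const)
      have "g s + c = f s" if "s \<in> {-T<..<T}" for s
      proof -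
        have "(\<lambda>k. r k s) sums (g s + r 0 s)"
          using g(1)[OF that] by (subst sums_Suc_iff[symmetric]) auto
        then show ?thesis using f(1)[of s] r0 by (simp add: sums_iff)
      qed
      then show ?thesis
        using has_vector_derivative_transform_within_open[OF gd, of "{-T<..<T}" f] t by auto
    qed
    show ?thesis
    proof
      show "(a z has_vector_derivative A z t * a z t + B z t * b z t) (at t)"
        by (rule *[where r = "\<lambda>k. p k z" and c = u])
          (use sums M cont p0 pS in \<open>simp_all add: a_def sums_iff\<close>)
      show "(b z has_vector_derivative C z t * a z t + D z t * b z t) (at t)"
        by (rule *[where r = "\<lambda>k. q k z" and c = v])
          (use sums M cont q0 qS in \<open>simp_all add: b_def sums_iff\<close>)
    qed
  qed
  have init: "a z 0 = u" "b z 0 = v" for z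
  proof -
    have "(\<lambda>k. p k z 0) sums u" "(\<lambda>k. q k z 0) sums v"
      using sums_single[of 0 "\<lambda>k. p k z 0"] sums_single[of 0 "\<lambda>k. q k z 0"]
    proof -
      have "p k z 0 = (if k = 0 then u else 0)" "q k z 0 = (if k = 0 then v else 0)" for k
        by (cases k; simp add: p0 q0 pS qS)+
      then show "(\<lambda>k. p k z 0) sums u" "(\<lambda>k. q k z 0) sums v"
        using sums_single[of 0 "\<lambda>k. u"] sums_single[of 0 "\<lambda>k. v"] by auto
    qed
    then show "a z 0 = u" "b z 0 = v"
      using sums sums_unique2 by blast+
  qed
  show thesis
    by (rule that[of a b]) (use init der hol in blast)+
qed

section \<open>Variation and smoothing of functions of class \<open>H\<^sup>1\<close>\<close>

text \<open>
  The Cauchy-Schwarz inequality on an interval of length one, obtained from \<open>h \<le> h\<^sup>2 / (2 r) + r / 2\<close>.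
\<close>
lemma integral_le_of_square_integral_le:
  fixes h :: "real \<Rightarrow> real"
  assumes h: "h integrable_on {0..1}" "(\<lambda>t. (h t)\<^sup>2) integrable_on {0..1}"
    and r: "r > 0" "integral {0..1} (\<lambda>t. (h t)\<^sup>2) \<le> r\<^sup>2"
  shows "integral {0..1} h \<le> r"
proof -
  have "h t \<le> (h t)\<^sup>2 / (2 * r) + r / 2" for t
  proof -
    have "0 \<le> (h t - r)\<^sup>2" by simp
    then show ?thesis using r(1) by (simp add: field_simps power2_eq_square)
  qed
  then have "integral {0..1} h \<le> integral {0..1} (\<lambda>t. (h t)\<^sup>2 / (2 * r) + r / 2)"
    using h by (intro integral_le integrable_add integrable_on_divide integrable_const_ivl) auto
  also have "\<dots> = integral {0..1} (\<lambda>t. (h t)\<^sup>2) / (2 * r) + r / 2"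
    using h by (subst integral_add) (auto intro!: integrable_on_divide)
  also have "\<dots> \<le> r\<^sup>2 / (2 * r) + r / 2"
    using r by (intro add_right_mono divide_right_mono) auto
  also have "\<dots> = r" using r by (simp add: power2_eq_square)
  finally show ?thesis .
qed

lemma periodic_continuous:
  fixes f :: "real \<Rightarrow> complex"
  assumes per: "\<And>t. f (t + 1) = f t" and cont: "continuous_on {0..1} f"
  shows "continuous_on UNIV f" "f t = f (frac t)"
proof -
  have nat: "f (t + of_nat n) = f t" for t n
  proof (induction n)
    case (Suc n)
    then show ?case using per[of "t + of_nat n"] by (simp add: add_ac)
  qed auto
  have int: "f (t + of_int k) = f t" for t k
    using nat[of t "nat k"] nat[of "t + of_int k" "nat (-k)"] by (cases "k \<ge> 0") auto
  show "f t = f (frac t)" for t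
    using int[of "frac t" "\<lfloor>t\<rfloor>"] by (simp add: frac_def)
  have c: "continuous_on {of_int k..of_int k + 1} f" for k
  proof -
    have "continuous_on {of_int k..of_int k + 1} (\<lambda>t. f (t - of_int k))"
      by (rule continuous_on_compose2[OF cont]) (auto intro!: continuous_intros)
    moreover have "f (t - of_int k) = f t" for t
      using int[of t "-k"] by simp
    ultimately show ?thesis by simp
  qed
  have "isCont f t" for t
  proof -
    have "continuous_on ({of_int (\<lfloor>t\<rfloor>-1)..of_int (\<lfloor>t\<rfloor>-1) + 1} \<union> {of_int \<lfloor>t\<rfloor>..of_int \<lfloor>t\<rfloor> + 1}) f"
      by (intro continuous_on_closed_Un c) auto
    moreover have "{real_of_int \<lfloor>t\<rfloor> - 1<..<of_int \<lfloor>t\<rfloor> + 1} \<subseteq>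
       {of_int (\<lfloor>t\<rfloor>-1)..of_int (\<lfloor>t\<rfloor>-1) + 1} \<union> {of_int \<lfloor>t\<rfloor>..of_int \<lfloor>t\<rfloor> + 1}"
      by (auto simp: not_le)
    ultimately have "continuous_on {of_int \<lfloor>t\<rfloor> - 1<..<of_int \<lfloor>t\<rfloor> + 1} f"
      using continuous_on_subset by blast
    moreover have "t \<in> {of_int \<lfloor>t\<rfloor> - 1<..<of_int \<lfloor>t\<rfloor> + 1}"
      by simp linarith
    ultimately show ?thesis
      using continuous_on_eq_continuous_at open_greaterThanLessThan by blast
  qed
  then show "continuous_on UNIV f"
    by (simp add: continuous_at_imp_continuous_on)
qed

lemma H1_has_L2_derivative:
  assumes "f \<in> H1"
  shows "has_L2_derivative f (SOME g. has_L2_derivative f g)"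
proof -
  have "\<exists>g. has_L2_derivative f g" using assms by (simp add: H1_def)
  then show ?thesis by (rule someI_ex)
qed

text \<open>
  The asymptotics of the discriminant use a small \<open>H\<^sup>1\<close> norm only through two consequences, a small
  supremum and a small total variation; the latter is recorded by the function \<open>v t = \<integral>\<^sub>0\<^sup>t \<bar>f'\<bar>\<close>. The bound for
  the supremum holds because the values of \<open>f\<close> differ from each other by at most the variation, while the mean
  of \<open>\<bar>f\<bar>\<close> is bounded by the \<open>L\<^sup>2\<close> norm.
\<close>
lemma H1_variation:
  assumes f: "f \<in> H1"
  obtains v where "continuous_on {0..1} v" "continuous_on UNIV f"
    "\<And>a b. 0 \<le> a \<Longrightarrow> a \<le> b \<Longrightarrow> b \<le> 1 \<Longrightarrow> cmod (f b - f a) \<le> v b - v a"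
    "\<And>r. H1_norm f < r \<Longrightarrow> v 1 - v 0 \<le> r" "\<And>r t. H1_norm f < r \<Longrightarrow> cmod (f t) \<le> 2 * r"
proof -
  define g where "g = (SOME g. has_L2_derivative f g)"
  have g: "set_borel_measurable lborel {0..1} g" "set_integrable lborel {0..1} (\<lambda>t. (cmod (g t))\<^sup>2)"
    "\<And>t. t \<in> {0..1} \<Longrightarrow> f t = f 0 + set_lebesgue_integral lborel {0..t} g"
    using H1_has_L2_derivative[OF f, folded g_def] unfolding has_L2_derivative_def by blast+
  have gi: "set_integrable lborel {0..1} g"
  proof (rule set_integrable_bound[OF _ g(1)])
    show "set_integrable lborel {0..1} (\<lambda>t. 1 + (cmod (g t))\<^sup>2)"
      by (intro set_integral_add(1) g(2) borel_integrable_atLeastAtMost') auto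
    have "cmod z \<le> 1 + (cmod z)\<^sup>2" for z
    proof -
      have "0 \<le> (cmod z - 1)\<^sup>2" by simp
      then have "2 * cmod z \<le> 1 + (cmod z)\<^sup>2" by (simp add: power2_diff)
      then show ?thesis using norm_ge_zero[of z] by linarith
    qed
    then show "AE x in lborel. x \<in> {0..1} \<longrightarrow> cmod (g x) \<le> norm (1 + (cmod (g x))\<^sup>2)"
      by (auto intro!: AE_I2 order_trans[OF _ abs_ge_self])
  qed
  have ghk: "g integrable_on {a..b}" "(\<lambda>t. cmod (g t)) integrable_on {a..b}"
    "(\<lambda>t. (cmod (g t))\<^sup>2) integrable_on {a..b}"
    if "0 \<le> a" "b \<le> 1" for a b
  proof -
    have sub: "{a..b} \<subseteq> {0..1}" using that by auto
    show "g integrable_on {a..b}"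
      using set_borel_integral_eq_integral(1)[OF gi] integrable_on_subinterval sub by blast
    show "(\<lambda>t. cmod (g t)) integrable_on {a..b}"
      using set_borel_integral_eq_integral(1)[OF set_integrable_norm[OF gi]] integrable_on_subinterval sub by blast
    show "(\<lambda>t. (cmod (g t))\<^sup>2) integrable_on {a..b}"
      using set_borel_integral_eq_integral(1)[OF g(2)] integrable_on_subinterval sub by blast
  qed
  have ft: "f t = f 0 + integral {0..t} g" if "t \<in> {0..1}" for t
  proof -
    have "set_integrable lborel {0..t} g"
      by (rule set_integrable_subset[OF gi]) (use that in auto)
    then show ?thesis
      using g(3)[OF that] set_borel_integral_eq_integral(2) by metis
  qed
  define v where "v t = integral {0..t} (\<lambda>t. cmod (g t))" for t
  have vc: "continuous_on {0..1} v"
    unfolding v_def by (intro indefinite_integral_continuous_1 ghk) auto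
  have vb: "cmod (f b - f a) \<le> v b - v a" if "0 \<le> a" "a \<le> b" "b \<le> 1" for a b
  proof -
    have "integral {0..a} g + integral {a..b} g = integral {0..b} g"
      using that by (intro Henstock_Kurzweil_Integration.integral_combine ghk) auto
    then have "f b - f a = integral {a..b} g"
      using ft[of a] ft[of b] that by (auto simp: algebra_simps)
    also have "cmod \<dots> \<le> integral {a..b} (\<lambda>t. cmod (g t))"
      using that by (intro integral_norm_bound_integral ghk) auto
    also have "integral {0..a} (\<lambda>t. cmod (g t)) + integral {a..b} (\<lambda>t. cmod (g t)) = integral {0..b} (\<lambda>t. cmod (g t))"
      using that by (intro Henstock_Kurzweil_Integration.integral_combine ghk) auto
    then have "integral {a..b} (\<lambda>t. cmod (g t)) = v b - v a"
      by (simp add: v_def)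
    finally show ?thesis .
  qed
  have fc: "continuous_on {0..1} f"
  proof -
    have "continuous_on {0..1} (\<lambda>t. f 0 + integral {0..t} g)"
      by (intro continuous_intros indefinite_integral_continuous_1 ghk) auto
    then show ?thesis by (rule continuous_on_eq) (metis ft)
  qed
  have per: "f (t + 1) = f t" for t using f by (auto simp: H1_def)
  note fc' = periodic_continuous[OF per fc]
  have nn: "integral {0..1} (\<lambda>t. (cmod (g t))\<^sup>2) \<ge> 0" "integral {0..1} (\<lambda>t. (cmod (f t))\<^sup>2) \<ge> 0"
  proof -
    have "continuous_on {0..1} (\<lambda>t. (cmod (f t))\<^sup>2)" by (intro continuous_intros fc)
    then show "integral {0..1} (\<lambda>t. (cmod (f t))\<^sup>2) \<ge> 0"
      by (intro integral_nonneg integrable_continuous_real) auto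
    show "integral {0..1} (\<lambda>t. (cmod (g t))\<^sup>2) \<ge> 0"
      using ghk(3)[of 0 1] by (intro integral_nonneg) auto
  qed
  have H1: "H1_norm f = sqrt (integral {0..1} (\<lambda>t. (cmod (f t))\<^sup>2) + integral {0..1} (\<lambda>t. (cmod (g t))\<^sup>2))"
  proof -
    have "set_integrable lborel {0..1} (\<lambda>t. (cmod (f t))\<^sup>2)"
      by (rule borel_integrable_atLeastAtMost') (intro continuous_intros fc)
    then show ?thesis
      unfolding H1_norm_def g_def[symmetric] by (metis g(2) set_borel_integral_eq_integral(2))
  qed
  have sq: "r > 0 \<and> integral {0..1} (\<lambda>t. (cmod (g t))\<^sup>2) \<le> r\<^sup>2 \<and> integral {0..1} (\<lambda>t. (cmod (f t))\<^sup>2) \<le> r\<^sup>2"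
    if "H1_norm f < r" for r
  proof -
    have r: "r > 0" using that nn unfolding H1 by (smt (verit) real_sqrt_ge_zero)
    then have "integral {0..1} (\<lambda>t. (cmod (f t))\<^sup>2) + integral {0..1} (\<lambda>t. (cmod (g t))\<^sup>2) \<le> r\<^sup>2"
      using that unfolding H1 by (intro sqrt_le_D) auto
    then show ?thesis using nn r by auto
  qed
  have v1: "v 1 - v 0 \<le> r" if "H1_norm f < r" for r
    using integral_le_of_square_integral_le[of "\<lambda>t. cmod (g t)" r] ghk sq[OF that]
    by (auto simp: v_def)
  have bd: "cmod (f t) \<le> 2 * r" if r: "H1_norm f < r" for r t
  proof -
    let ?t = "frac t"
    have t: "0 \<le> ?t" "?t \<le> 1" using frac_lt_1[of t] by auto
    have mono: "v a \<le> v b" if "0 \<le> a" "a \<le> b" "b \<le> 1" for a b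
      using vb[OF that] norm_ge_zero[of "f b - f a"] by linarith
    have "cmod (f ?t) - r \<le> cmod (f s)" if s: "s \<in> {0..1}" for s
    proof -
      have "cmod (f ?t - f s) \<le> v 1 - v 0"
        using vb[of s ?t] vb[of ?t s] mono[of 0 s] mono[of 0 ?t] mono[of s 1] mono[of ?t 1] t s
        by (cases "s \<le> ?t") (auto simp: norm_minus_commute)
      then show ?thesis using v1[OF r] norm_triangle_ineq2[of "f ?t" "f s"] by linarith
    qed
    then have "integral {0..1} (\<lambda>s::real. cmod (f ?t) - r) \<le> integral {0..1} (\<lambda>s. cmod (f s))"
      by (intro integral_le integrable_continuous_real continuous_intros fc) auto
    also have "\<dots> \<le> r"
    proof (rule integral_le_of_square_integral_le)
      show "(\<lambda>s. cmod (f s)) integrable_on {0..1}" "(\<lambda>s. (cmod (f s))\<^sup>2) integrable_on {0..1}"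
        by (rule integrable_continuous_real, intro continuous_intros fc)+
    qed (use sq[OF r] in auto)
    finally show ?thesis using fc'(2)[of t] by simp
  qed
  show thesis by (rule that[OF vc fc'(1) vb v1 bd])
qed

lemma H1_norm_nonneg: "H1_norm f \<ge> 0"
proof -
  have "set_lebesgue_integral lborel {0..1} (\<lambda>t. (cmod (h t))\<^sup>2) \<ge> 0" for h :: "real \<Rightarrow> complex"
    unfolding set_lebesgue_integral_def by (rule Bochner_Integration.integral_nonneg) auto
  then show ?thesis unfolding H1_norm_def by simp
qed

lemma H1_norm_le_X_norm: "H1_norm (\<lambda>t. \<psi> t $ j) \<le> X_norm \<psi>"
proof -
  have "(H1_norm (\<lambda>t. \<psi> t $ j))\<^sup>2 \<le> (\<Sum>j\<in>UNIV. (H1_norm (\<lambda>t. \<psi> t $ j))\<^sup>2)"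
    by (rule member_le_sum) auto
  then show ?thesis unfolding X_norm_def using H1_norm_nonneg by (simp add: real_le_rsqrt)
qed

text \<open>
  The moving average \<open>(1/h) \<integral>\<^sub>t\<^sup>t\<^sup>+\<^sup>h G\<close>, written with a fixed lower limit so that it can be
  differentiated on both sides of every \<open>t\<close> in \<open>[0, 1]\<close>.
\<close>
definition steklov :: "real \<Rightarrow> (real \<Rightarrow> 'b::banach) \<Rightarrow> real \<Rightarrow> 'b" where
  "steklov h G t = (1 / h) *\<^sub>R (integral {-1..t+h} G - integral {-1..t} G)"

lemma steklov_has_vector_derivative:
  fixes G :: "real \<Rightarrow> 'b::banach"
  assumes G: "\<And>A. continuous_on A G" and t: "t \<in> {0..1}" and h: "0 < h" "h \<le> 1"
  shows "(steklov h G has_vector_derivative (1 / h) *\<^sub>R (G (t + h) - G t)) (at t)"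
proof -
  have ID: "((\<lambda>u. integral {-1..u} G) has_vector_derivative G s) (at s)" if t: "-1 < s" "s < 3" for s
  proof -
    have "((\<lambda>u. integral {-1..u} G) has_vector_derivative G s) (at s within {-1..3})"
      using t by (intro integral_has_vector_derivative[OF G]) auto
    then show ?thesis
      using t by (subst (asm) at_within_interior) auto
  qed
  have "((\<lambda>t. t + h) has_vector_derivative 1) (at t)"
    by (auto intro!: derivative_eq_intros simp flip: has_real_derivative_iff_has_vector_derivative)
  from vector_diff_chain_at[OF this ID]
  have "((\<lambda>t. integral {-1..t + h} G) has_vector_derivative G (t + h)) (at t)"
    using t h by (auto simp: o_def)
  then show ?thesis unfolding steklov_def[abs_def] using t ID[of t]
    by (intro bounded_linear.has_vector_derivative[OF bounded_linear_scaleR_right] has_vector_derivative_diff) auto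
qed

lemma steklov_eq_integral:
  assumes G: "\<And>A. continuous_on A G" and t: "t \<ge> 0" and h: "0 < h"
  shows "steklov h G t = (1 / h) *\<^sub>R integral {t..t+h} G"
proof -
  have "integral {-1..t} G + integral {t..t + h} G = integral {-1..t + h} G"
    using t h by (intro Henstock_Kurzweil_Integration.integral_combine integrable_continuous_real G) auto
  then have "integral {-1..t+h} G - integral {-1..t} G = integral {t..t+h} G"
    by (metis add_diff_cancel_left')
  then show ?thesis
    unfolding steklov_def by simp
qed

text \<open>
  The moving average of \<open>f\<close> over a short interval is continuously differentiable and close to \<open>f\<close>. The
  increments of \<open>f\<close> are dominated by those of \<open>v\<close>, so its derivative is dominated by that of the moving average
  of \<open>v\<close>, whose total increase is at most that of \<open>v\<close>. Thus the mean of \<open>\<bar>p'\<bar>\<close> does not deteriorate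
  as the approximation improves.
\<close>
lemma smooth_approximation:
  fixes f :: "real \<Rightarrow> complex" and v :: "real \<Rightarrow> real"
  assumes v: "continuous_on {0..1} v"
    and fv: "\<And>a b. 0 \<le> a \<Longrightarrow> a \<le> b \<Longrightarrow> b \<le> 1 \<Longrightarrow> cmod (f b - f a) \<le> v b - v a"
    and e: "e > 0"
  obtains p p' \<phi> \<phi>' where
    "\<forall>t\<in>{0..1}. (p has_vector_derivative p' t) (at t)"
    "\<forall>t\<in>{0..1}. cmod (p t - f t) \<le> e"
    "\<forall>t\<in>{0..1}. (\<phi> has_vector_derivative \<phi>' t) (at t)"
    "\<forall>t\<in>{0..1}. cmod (p' t) \<le> \<phi>' t"
    "\<phi> 1 - \<phi> 0 \<le> v 1 - v 0"
proof -
  have mono: "v a \<le> v b" if "0 \<le> a" "a \<le> b" "b \<le> 1" for a b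
    using fv[OF that] norm_ge_zero[of "f b - f a"] by linarith
  have "uniformly_continuous_on {0..1} v"
    using v by (intro compact_uniformly_continuous) auto
  then obtain d where d: "d > 0" "\<And>s t. s \<in> {0..1} \<Longrightarrow> t \<in> {0..1} \<Longrightarrow> dist s t < d \<Longrightarrow> dist (v s) (v t) < e"
    using e unfolding uniformly_continuous_on_def by meson
  define h where "h = min (d / 2) 1"
  have h: "h > 0" "h < d" "h \<le> 1" using d by (auto simp: h_def)
  \<comment> \<open>Constant continuation beyond the unit interval; because of it the average of \<open>v\<close> ends at \<open>v 1\<close>.\<close>
  define c where "c t = max 0 (min 1 t)" for t :: real
  have c: "continuous_on A c" for A
    unfolding c_def by (intro continuous_intros)
  have c01: "c t \<in> {0..1}" for t by (auto simp: c_def)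
  have cid: "c t = t" if "t \<in> {0..1}" for t using that by (auto simp: c_def)
  have cmono: "c s \<le> c t" if "s \<le> t" for s t using that by (auto simp: c_def)
  define F where "F t = f (c t)" for t
  define W where "W t = v (c t)" for t
  have FW: "cmod (F b - F a) \<le> W b - W a" if "a \<le> b" for a b
    using fv[of "c a" "c b"] c01[of a] c01[of b] cmono[OF that] by (auto simp: F_def W_def)
  have Wc: "continuous_on A W" for A
    unfolding W_def by (rule continuous_on_compose2[OF v c]) (use c01 in auto)
  have fc: "continuous_on {0..1} f"
  proof (rule continuous_on_iff[THEN iffD2], intro ballI allI impI)
    fix x e :: real assume x: "x \<in> {0..1}" and "e > 0"
    then obtain d where d: "d > 0" "\<And>y. y \<in> {0..1} \<Longrightarrow> dist y x < d \<Longrightarrow> dist (v y) (v x) < e"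
      using v unfolding continuous_on_iff by meson
    have "dist (f y) (f x) \<le> dist (v y) (v x)" if "y \<in> {0..1}" for y
      using fv[of x y] fv[of y x] x that
      by (cases "x \<le> y") (auto simp: dist_norm norm_minus_commute)
    then show "\<exists>d>0. \<forall>x'\<in>{0..1}. dist x' x < d \<longrightarrow> dist (f x') (f x) < e"
      using d by (meson le_less_trans)
  qed
  have Fc: "continuous_on A F" for A
    unfolding F_def by (rule continuous_on_compose2[OF fc c]) (use c01 in auto)
  have "cmod (steklov h F t - f t) \<le> e" if t: "t \<in> {0..1}" for t
  proof -
    have "steklov h F t - f t = (1 / h) *\<^sub>R integral {t..t+h} (\<lambda>s. F s - f t)"
      using t h steklov_eq_integral[OF Fc, of t h] Fc
      by (subst integral_diff) (auto simp: integrable_continuous_real scaleR_diff_right)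
    moreover have "cmod (integral {t..t+h} (\<lambda>s. F s - f t)) \<le> integral {t..t+h} (\<lambda>s. e)"
    proof (rule integral_norm_bound_integral)
      fix s assume s: "s \<in> {t..t+h}"
      have "cmod (F s - f t) \<le> W s - W t" using FW[of t s] s t cid by (auto simp: F_def)
      also have "dist (c s) (c t) < d" using s t h by (auto simp: c_def dist_real_def)
      then have "W s - W t \<le> e"
        using d(2)[of "c s" "c t"] c01[of s] c01[of t] by (auto simp: W_def dist_real_def)
      finally show "cmod (F s - f t) \<le> e" .
    qed (auto intro!: integrable_continuous_real continuous_intros Fc)
    ultimately show ?thesis using h by (simp add: field_simps)
  qed
  moreover have "cmod ((1 / h) *\<^sub>R (F (t + h) - F t)) \<le> (1 / h) *\<^sub>R (W (t + h) - W t)" for t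
    using FW[of t "t + h"] h by (simp add: divide_right_mono)
  moreover have "steklov h W 1 - steklov h W 0 \<le> v 1 - v 0"
  proof -
    have "integral {1..1+h} W = integral {1..1+h} (\<lambda>s. v 1)"
      by (intro integral_cong) (auto simp: W_def c_def)
    then have 1: "steklov h W 1 = v 1"
      using steklov_eq_integral[OF Wc, of 1 h] h by simp
    have "integral {0..h} (\<lambda>s. v 0) \<le> integral {0..h} W"
      using mono c01 by (intro integral_le integrable_continuous_real continuous_intros Wc) (auto simp: W_def)
    then have "v 0 \<le> steklov h W 0"
      using steklov_eq_integral[OF Wc, of 0 h] h by (simp add: pos_le_divide_eq mult.commute)
    with 1 show ?thesis by simp
  qed
  ultimately show thesis
    by (intro that[of "steklov h F" "\<lambda>t. (1 / h) *\<^sub>R (F (t + h) - F t)" "steklov h W" "\<lambda>t. (1 / h) *\<^sub>R (W (t + h) - W t)"]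
      ballI steklov_has_vector_derivative[OF Fc _ h(1,3)] steklov_has_vector_derivative[OF Wc _ h(1,3)])
qed

section \<open>Solutions of the spectral problem and the discriminant\<close>

lemma has_vector_derivative_vec:
  fixes f :: "real \<Rightarrow> 'a::real_normed_vector ^ 'n"
  shows "(f has_vector_derivative f') (at t) \<longleftrightarrow>
    (\<forall>i. ((\<lambda>s. f s $ i) has_vector_derivative f' $ i) (at t))"
proof
  assume "(f has_vector_derivative f') (at t)"
  then show "\<forall>i. ((\<lambda>s. f s $ i) has_vector_derivative f' $ i) (at t)"
    using bounded_linear.has_vector_derivative[OF bounded_linear_vec_nth] by blast
next
  assume *: "\<forall>i. ((\<lambda>s. f s $ i) has_vector_derivative f' $ i) (at t)"
  show "(f has_vector_derivative f') (at t)"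
    unfolding has_vector_derivative_def has_derivative_def
  proof (intro conjI vec_tendstoI)
    fix i
    show "((\<lambda>y. ((f y - f (Lim (at t) (\<lambda>x. x)) - (y - Lim (at t) (\<lambda>x. x)) *\<^sub>R f') /\<^sub>R
        norm (y - Lim (at t) (\<lambda>x. x))) $ i) \<longlongrightarrow> 0 $ i) (at t)"
      using *[rule_format, of i] by (simp add: has_vector_derivative_def has_derivative_def)
  qed (rule bounded_linear_scaleR_left)
qed

definition coef11 :: "complex \<Rightarrow> complex^4 \<Rightarrow> complex" where
  "coef11 z p = - 2 * \<i> * z\<^sup>2 - \<i> * p$1 * p$2"
definition coef12 :: "complex \<Rightarrow> complex^4 \<Rightarrow> complex" where
  "coef12 z p = 2 * z * p$1 + \<i> * p$3"
definition coef21 :: "complex \<Rightarrow> complex^4 \<Rightarrow> complex" where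
  "coef21 z p = 2 * z * p$2 - \<i> * p$4"

text \<open>
  The columns of the solutions of the matrix system; the coefficient matrix has trace zero.
\<close>
definition zs_solution :: "complex \<Rightarrow> potential \<Rightarrow> (real \<Rightarrow> complex) \<Rightarrow> (real \<Rightarrow> complex) \<Rightarrow> bool" where
  "zs_solution z \<psi> u v \<longleftrightarrow>
     (\<forall>t. (u has_vector_derivative coef11 z (\<psi> t) * u t + coef12 z (\<psi> t) * v t) (at t)) \<and>
     (\<forall>t. (v has_vector_derivative coef21 z (\<psi> t) * u t - coef11 z (\<psi> t) * v t) (at t))"

lemma matrix_ode_iff_columns:
  fixes M :: "real \<Rightarrow> complex^2^2"
  shows "(\<forall>t. (M has_vector_derivative ((mat (- 2 * \<i> * z\<^sup>2) ** sigma3 + V z (\<psi> t)) ** M t)) (at t)) \<longleftrightarrow>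
    (\<forall>j. zs_solution z \<psi> (\<lambda>t. M t $ 1 $ j) (\<lambda>t. M t $ 2 $ j))"
proof -
  have e: "((mat (- 2 * \<i> * z\<^sup>2) ** sigma3 + V z p) ** N) $ 1 $ j = coef11 z p * N $ 1 $ j + coef12 z p * N $ 2 $ j"
    "((mat (- 2 * \<i> * z\<^sup>2) ** sigma3 + V z p) ** N) $ 2 $ j = coef21 z p * N $ 1 $ j - coef11 z p * N $ 2 $ j"
    for N :: "complex^2^2" and p j
    by (simp_all add: matrix_matrix_mult_def sum_2 mat_def sigma3_def V_def coef11_def coef12_def coef21_def algebra_simps)
  show ?thesis
    unfolding has_vector_derivative_vec forall_2[where P = "\<lambda>i. \<forall>j. _ i j"] e zs_solution_def
    by blast
qed

text \<open>
  The Wronskian is constant because the coefficient matrix has trace zero.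
\<close>
lemma zs_wronskian_constant:
  assumes "zs_solution z \<psi> u v" "zs_solution z \<psi> a b"
  shows "u t * b t - v t * a t = u 0 * b 0 - v 0 * a 0"
proof -
  have "((\<lambda>t. u t * b t - v t * a t) has_vector_derivative 0) (at s)" for s
  proof -
    have *: "(u has_vector_derivative coef11 z (\<psi> s) * u s + coef12 z (\<psi> s) * v s) (at s)"
      "(v has_vector_derivative coef21 z (\<psi> s) * u s - coef11 z (\<psi> s) * v s) (at s)"
      "(a has_vector_derivative coef11 z (\<psi> s) * a s + coef12 z (\<psi> s) * b s) (at s)"
      "(b has_vector_derivative coef21 z (\<psi> s) * a s - coef11 z (\<psi> s) * b s) (at s)"
      using assms by (auto simp: zs_solution_def)
    show ?thesis
      by (rule has_vector_derivative_eq_rhs, (rule has_vector_derivative_diff has_vector_derivative_mult *)+)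
        (simp add: algebra_simps)
  qed
  then obtain k where "\<And>t. u t * b t - v t * a t = k"
    using has_vector_derivative_zero_constant[of UNIV "\<lambda>t. u t * b t - v t * a t"] by auto
  then show ?thesis by simp
qed

text \<open>
  By Cramer's rule a solution is determined by its Wronskians with two independent solutions,
  and these are constant. This gives uniqueness without a Gronwall estimate.
\<close>
lemma zs_solution_unique:
  assumes u: "zs_solution z \<psi> u v" and a: "zs_solution z \<psi> a b" and c: "zs_solution z \<psi> c d"
    and init: "a 0 = 1" "b 0 = 0" "c 0 = 0" "d 0 = 1"
  shows "u t = u 0 * a t + v 0 * c t" "v t = u 0 * b t + v 0 * d t"
proof -
  have 1: "u t * b t - v t * a t = - v 0" and 2: "u t * d t - v t * c t = u 0"
    and 3: "a t * d t - b t * c t = 1"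
    using zs_wronskian_constant[OF u a, of t] zs_wronskian_constant[OF u c, of t]
      zs_wronskian_constant[OF a c, of t] init by auto
  show "u t = u 0 * a t + v 0 * c t" "v t = u 0 * b t + v 0 * d t"
    using 1 2 3 by algebra+
qed

text \<open>
  Existence and uniqueness of the solution give access to the definite description in the definition of the discriminant.
\<close>
lemma fundamental_solution_entries:
  fixes \<psi> :: potential
  assumes cont: "\<And>j. continuous_on UNIV (\<lambda>t. \<psi> t $ j)"
  obtains a b c d where
    "\<And>z. zs_solution z \<psi> (a z) (b z)" "\<And>z. zs_solution z \<psi> (c z) (d z)"
    "\<And>z. a z 0 = 1" "\<And>z. b z 0 = 0" "\<And>z. c z 0 = 0" "\<And>z. d z 0 = 1"
    "\<And>z. discr z \<psi> = a z 1 + d z 1"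
    "(\<lambda>z. discr z \<psi>) holomorphic_on UNIV"
proof -
  have c: "param_poly (\<lambda>z t. k)" for k by (intro param_poly_const continuous_intros)
  have z: "param_poly (\<lambda>z t. z)" using param_poly_param[OF c[of 1]] by simp
  have p: "param_poly (\<lambda>z t. \<psi> t $ j)" for j by (rule param_poly_const[OF cont])
  have 1: "param_poly (\<lambda>z t. coef11 z (\<psi> t))"
    using param_poly_add[OF param_poly_mult[OF c[of "-2 * \<i>"] param_poly_mult[OF z z]] param_poly_mult[OF c[of "-\<i>"] param_poly_mult[OF p[of 1] p[of 2]]]]
    by (simp add: coef11_def power2_eq_square mult_ac)
  have 4: "param_poly (\<lambda>z t. - coef11 z (\<psi> t))"
    using param_poly_mult[OF c[of "-1"] 1] by simp
  have 2: "param_poly (\<lambda>z t. coef12 z (\<psi> t))"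
    using param_poly_add[OF param_poly_mult[OF c[of 2] param_poly_mult[OF z p[of 1]]] param_poly_mult[OF c[of "\<i>"] p[of 3]]]
    by (simp add: coef12_def mult_ac)
  have 3: "param_poly (\<lambda>z t. coef21 z (\<psi> t))"
    using param_poly_add[OF param_poly_mult[OF c[of 2] param_poly_mult[OF z p[of 2]]] param_poly_mult[OF c[of "-\<i>"] p[of 4]]]
    by (simp add: coef21_def mult_ac)
  obtain a b where ab: "\<And>z. a z 0 = 1" "\<And>z. b z 0 = 0" 
    "\<And>z t. (a z has_vector_derivative coef11 z (\<psi> t) * a z t + coef12 z (\<psi> t) * b z t) (at t)"
    "\<And>z t. (b z has_vector_derivative coef21 z (\<psi> t) * a z t + - coef11 z (\<psi> t) * b z t) (at t)"
    "\<And>t. (\<lambda>z. a z t) holomorphic_on UNIV" "\<And>t. (\<lambda>z. b z t) holomorphic_on UNIV"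
    using linear_ode_solution[OF 1 2 3 4, of 1 0] by blast
  obtain c d where cd: "\<And>z. c z 0 = 0" "\<And>z. d z 0 = 1" 
    "\<And>z t. (c z has_vector_derivative coef11 z (\<psi> t) * c z t + coef12 z (\<psi> t) * d z t) (at t)"
    "\<And>z t. (d z has_vector_derivative coef21 z (\<psi> t) * c z t + - coef11 z (\<psi> t) * d z t) (at t)"
    "\<And>t. (\<lambda>z. c z t) holomorphic_on UNIV" "\<And>t. (\<lambda>z. d z t) holomorphic_on UNIV"
    using linear_ode_solution[OF 1 2 3 4, of 0 1] by blast
  have sol: "zs_solution z \<psi> (a z) (b z)" "zs_solution z \<psi> (c z) (d z)" for z
    using ab cd by (auto simp: zs_solution_def)
  have fs: "fundamental_solution z \<psi> = (\<lambda>t. vector [vector [a z t, c z t], vector [b z t, d z t]])" (is "_ = ?M") for z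
    unfolding fundamental_solution_def matrix_ode_iff_columns
  proof (rule the_equality)
    show "?M 0 = mat 1 \<and> (\<forall>j. zs_solution z \<psi> (\<lambda>t. ?M t $ 1 $ j) (\<lambda>t. ?M t $ 2 $ j))"
      using sol by (simp add: forall_2 vec_eq_iff mat_def ab(1,2) cd(1,2))
    fix N :: "real \<Rightarrow> complex^2^2" assume N: "N 0 = mat 1 \<and> (\<forall>j. zs_solution z \<psi> (\<lambda>t. N t $ 1 $ j) (\<lambda>t. N t $ 2 $ j))"
    then have col: "zs_solution z \<psi> (\<lambda>t. N t $ 1 $ j) (\<lambda>t. N t $ 2 $ j)" for j by blast
    have "N t $ 1 $ j = N 0 $ 1 $ j * a z t + N 0 $ 2 $ j * c z t"
      "N t $ 2 $ j = N 0 $ 1 $ j * b z t + N 0 $ 2 $ j * d z t" for t j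
      by (rule zs_solution_unique[OF col sol ab(1,2) cd(1,2)])+
    then show "N = ?M"
      using N by (simp add: fun_eq_iff vec_eq_iff forall_2 mat_def)
  qed
  have tr: "discr z \<psi> = a z 1 + d z 1" for z
    by (simp add: discr_def fs trace_def sum_2)
  have "(\<lambda>z. discr z \<psi>) holomorphic_on UNIV"
    unfolding tr by (intro holomorphic_on_add ab(5) cd(6))
  with that[OF sol ab(1,2) cd(1,2) tr] show thesis .
qed

text \<open>
  Potentials of real type (\<open>\<sigma> = 1\<close>) or imaginary type (\<open>\<sigma> = -1\<close>) have a coefficient matrix that, under
  \<open>z \<mapsto> cnj z\<close>, is conjugated and has its two rows and its two columns interchanged, up to the sign \<open>\<sigma>\<close> off
  the diagonal. Conjugation followed by an interchange of the components therefore respects solutions.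
\<close>
lemma cnj_zs_solution:
  fixes \<psi> :: potential
  assumes sol: "zs_solution z \<psi> a b" and \<sigma>: "\<sigma> = 1 \<or> \<sigma> = -1"
    and sym: "\<And>t. \<psi> t $ 2 = \<sigma> * cnj (\<psi> t $ 1)" "\<And>t. \<psi> t $ 4 = \<sigma> * cnj (\<psi> t $ 3)"
  shows "zs_solution (cnj z) \<psi> (\<lambda>t. cnj (b t)) (\<lambda>t. \<sigma> * cnj (a t))"
proof -
  have c: "cnj \<sigma> = \<sigma>" "\<sigma> * \<sigma> = 1" using \<sigma> by auto
  have 1: "cnj (coef11 z (\<psi> t)) = - coef11 (cnj z) (\<psi> t)" for t
    by (simp add: coef11_def sym c mult_ac)
  have 2: "cnj (coef12 z (\<psi> t)) = \<sigma> * coef21 (cnj z) (\<psi> t)" for t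
    using \<sigma> by (auto simp: coef12_def coef21_def sym algebra_simps)
  have 3: "cnj (coef21 z (\<psi> t)) = \<sigma> * coef12 (cnj z) (\<psi> t)" for t
    using \<sigma> by (auto simp: coef12_def coef21_def sym algebra_simps)
  have a: "((\<lambda>t. cnj (a t)) has_vector_derivative cnj (coef11 z (\<psi> t) * a t + coef12 z (\<psi> t) * b t)) (at t)"
   and b: "((\<lambda>t. cnj (b t)) has_vector_derivative cnj (coef21 z (\<psi> t) * a t - coef11 z (\<psi> t) * b t)) (at t)" for t
    using sol unfolding zs_solution_def by (blast intro: bounded_linear.has_vector_derivative[OF bounded_linear_cnj])+
  have "((\<lambda>t. \<sigma> * cnj (a t)) has_vector_derivative \<sigma> * cnj (coef11 z (\<psi> t) * a t + coef12 z (\<psi> t) * b t)) (at t)" for t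
    by (intro has_vector_derivative_mult_right a)
  then show ?thesis
    unfolding zs_solution_def
  proof (intro conjI allI)
    fix t
    show "((\<lambda>t. cnj (b t)) has_vector_derivative
         coef11 (cnj z) (\<psi> t) * cnj (b t) + coef12 (cnj z) (\<psi> t) * (\<sigma> * cnj (a t))) (at t)"
      using b[of t] by (simp add: 1 2 3 algebra_simps)
    have "\<sigma> * cnj (coef11 z (\<psi> t) * a t + coef12 z (\<psi> t) * b t) =
      (\<sigma> * \<sigma>) * coef21 (cnj z) (\<psi> t) * cnj (b t) - coef11 (cnj z) (\<psi> t) * (\<sigma> * cnj (a t))"
      by (simp add: 1 2 algebra_simps)
    then show "((\<lambda>t. \<sigma> * cnj (a t)) has_vector_derivative
         coef21 (cnj z) (\<psi> t) * cnj (b t) - coef11 (cnj z) (\<psi> t) * (\<sigma> * cnj (a t))) (at t)"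
      using \<open>\<And>t. ((\<lambda>t. \<sigma> * cnj (a t)) has_vector_derivative _) (at t)\<close>[of t] c by simp
  qed
qed

lemma discr_cnj:
  fixes \<psi> :: potential
  assumes cont: "\<And>j. continuous_on UNIV (\<lambda>t. \<psi> t $ j)" and \<psi>: "\<psi> \<in> X_real \<union> X_imag"
  shows "discr (cnj z) \<psi> = cnj (discr z \<psi>)"
proof -
  obtain \<sigma> :: complex where \<sigma>: "\<sigma> = 1 \<or> \<sigma> = -1"
    and sym: "\<And>t. \<psi> t $ 2 = \<sigma> * cnj (\<psi> t $ 1)" "\<And>t. \<psi> t $ 4 = \<sigma> * cnj (\<psi> t $ 3)"
  proof (cases "\<psi> \<in> X_real")
    case True
    then have "star \<psi> t $ j = \<psi> t $ j" for t j by (simp add: X_real_def)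
    from this[of _ 2] this[of _ 4] show ?thesis
      by (intro that[of 1]) (auto simp: star_nth)
  next
    case False
    then have "star \<psi> t $ j = - \<psi> t $ j" for t j using \<psi> by (simp add: X_imag_def)
    from this[of _ 2] this[of _ 4] show ?thesis
      by (intro that[of "-1"]) (auto simp: star_nth)
  qed
  obtain a b c d where s: "\<And>z. zs_solution z \<psi> (a z) (b z)" "\<And>z. zs_solution z \<psi> (c z) (d z)"
    and i: "\<And>z. a z 0 = 1" "\<And>z. b z 0 = 0" "\<And>z. c z 0 = 0" "\<And>z. d z 0 = 1"
    and tr: "\<And>z. discr z \<psi> = a z 1 + d z 1"
    using fundamental_solution_entries[OF cont] by metis
  have "cnj (d z 1) = a (cnj z) 1"
    using zs_solution_unique(1)[OF cnj_zs_solution[OF s(2)[of z] \<sigma> sym] s i, of 1] by (simp add: i)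
  moreover have "\<sigma> * cnj (a z 1) = \<sigma> * d (cnj z) 1"
    using zs_solution_unique(2)[OF cnj_zs_solution[OF s(1)[of z] \<sigma> sym] s i, of 1] by (simp add: i)
  ultimately show ?thesis using \<sigma> by (auto simp: tr)
qed

lemma discr_holomorphic:
  fixes \<psi> :: potential
  assumes cont: "\<And>j. continuous_on UNIV (\<lambda>t. \<psi> t $ j)"
  shows "(\<lambda>z. discr z \<psi>) holomorphic_on UNIV"
  by (rule fundamental_solution_entries[OF cont])

section \<open>Uniform asymptotics of the discriminant\<close>

text \<open>
  Let \<open>e\<close> and \<open>f\<close> solve the system up to the residuals \<open>r\<close> and \<open>s\<close>. The Wronskians of the exact solution \<open>m\<close>
  with \<open>e\<close> and \<open>f\<close> change by at most \<open>S q\<close>, where \<open>S\<close> is the maximum modulus of the components of \<open>m\<close> and \<open>q\<close> bounds the integral of the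
  residuals. Cramer's rule recovers \<open>m\<close> from the Wronskians; taken at the point where the maximum is
  attained, it bounds \<open>S\<close> itself, because the contribution of \<open>S q\<close> can be absorbed. Taken at the endpoint, it
  then shows that the Wronskians have almost their initial values; since \<open>m\<close> starts at \<open>(1, 0)\<close>, these are
  close to \<open>0\<close> and \<open>1\<close>, and the first component of \<open>m\<close> is close to that of \<open>e\<close>.
\<close>
lemma approximate_fundamental_system_bound:
  fixes m1 m2 e1 e2 f1 f2 \<alpha> \<beta> \<gamma> r1 r2 s1 s2 :: "real \<Rightarrow> complex" and \<phi> \<phi>' :: "real \<Rightarrow> real"
  assumes m: "\<And>t. t \<in> {0..1} \<Longrightarrow> (m1 has_vector_derivative \<alpha> t * m1 t + \<beta> t * m2 t) (at t)"
      "\<And>t. t \<in> {0..1} \<Longrightarrow> (m2 has_vector_derivative \<gamma> t * m1 t - \<alpha> t * m2 t) (at t)"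
    and e: "\<And>t. t \<in> {0..1} \<Longrightarrow> (e1 has_vector_derivative \<alpha> t * e1 t + \<beta> t * e2 t + r1 t) (at t)"
      "\<And>t. t \<in> {0..1} \<Longrightarrow> (e2 has_vector_derivative \<gamma> t * e1 t - \<alpha> t * e2 t + r2 t) (at t)"
    and f: "\<And>t. t \<in> {0..1} \<Longrightarrow> (f1 has_vector_derivative \<alpha> t * f1 t + \<beta> t * f2 t + s1 t) (at t)"
      "\<And>t. t \<in> {0..1} \<Longrightarrow> (f2 has_vector_derivative \<gamma> t * f1 t - \<alpha> t * f2 t + s2 t) (at t)"
    and \<phi>: "\<And>t. t \<in> {0..1} \<Longrightarrow> (\<phi> has_vector_derivative \<phi>' t) (at t)"
      "\<And>t. t \<in> {0..1} \<Longrightarrow> cmod (r1 t) + cmod (r2 t) \<le> \<phi>' t"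
      "\<And>t. t \<in> {0..1} \<Longrightarrow> cmod (s1 t) + cmod (s2 t) \<le> \<phi>' t" "\<phi> 1 - \<phi> 0 \<le> q"
    and K: "\<And>t. t \<in> {0..1} \<Longrightarrow> cmod (e1 t) \<le> K" "\<And>t. t \<in> {0..1} \<Longrightarrow> cmod (f2 t) \<le> K"
      "\<And>t. t \<in> {0..1} \<Longrightarrow> cmod (e2 t) \<le> \<theta> * K" "\<And>t. t \<in> {0..1} \<Longrightarrow> cmod (f1 t) \<le> \<theta> * K"
    and D: "\<And>t. t \<in> {0..1} \<Longrightarrow> cmod (e1 t * f2 t - e2 t * f1 t - 1) \<le> \<theta>\<^sup>2"
    and init: "m1 0 = 1" "m2 0 = 0" "f2 0 = 1" "cmod (e2 0) \<le> \<theta>"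
    and small: "8 * K * q \<le> 1" "0 \<le> \<theta>" "\<theta> \<le> 1/2" "1 \<le> K"
  shows "cmod (m1 1 - e1 1) \<le> 16 * K\<^sup>2 * q + 9 * K * \<theta>"
proof -
  have cm: "continuous_on {0..1} m1" "continuous_on {0..1} m2"
    using m has_vector_derivative_continuous by (blast intro: continuous_at_imp_continuous_on)+
  then have cmax: "continuous_on {0..1} (\<lambda>t. max (cmod (m1 t)) (cmod (m2 t)))"
    by (intro continuous_intros)
  have "{0..1::real} \<noteq> {}" by simp
  from continuous_attains_sup[OF compact_Icc this cmax] obtain t0 where t0: "t0 \<in> {0..1}"
    and "\<forall>t\<in>{0..1}. max (cmod (m1 t)) (cmod (m2 t)) \<le> max (cmod (m1 t0)) (cmod (m2 t0))"
    by blast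
  define S where "S = max (cmod (m1 t0)) (cmod (m2 t0))"
  have S: "cmod (m1 t) \<le> S" "cmod (m2 t) \<le> S" if "t \<in> {0..1}" for t
    using \<open>\<forall>t\<in>{0..1}. _\<close> that by (auto simp: S_def)
  have S0: "S \<ge> 0" by (simp add: S_def le_max_iff_disj)
  have \<phi>0: "\<phi>' t \<ge> 0" if "t \<in> {0..1}" for t
    using \<phi>(2)[OF that] norm_ge_zero[of "r1 t"] norm_ge_zero[of "r2 t"] by linarith
  have \<phi>c: "continuous_on {a..b} \<phi>" if "0 \<le> a" "b \<le> 1" for a b
  proof (intro continuous_at_imp_continuous_on ballI)
    fix x assume "x \<in> {a..b}"
    with that show "isCont \<phi> x"
      by (intro has_vector_derivative_continuous[OF \<phi>(1)]) auto
  qed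
  have mono: "\<phi> t - \<phi> 0 \<le> q" if t: "t \<in> {0..1}" for t
  proof (cases "t = 1")
    case True
    then show ?thesis using \<phi>(4) by simp
  next
    case False
    have "norm ((0::real) - 0) \<le> \<phi> 1 - \<phi> t"
      by (rule differentiable_bound_general[where f = "\<lambda>_. 0" and f' = "\<lambda>_. 0" and \<phi>' = \<phi>'])
        (use False t \<phi>(1) \<phi>0 \<phi>c in auto)
    then show ?thesis using \<phi>(4) by simp
  qed
  have W: "cmod ((m1 t * n2 t - m2 t * n1 t) - (m1 0 * n2 0 - m2 0 * n1 0)) \<le> S * q"
    if n: "\<And>t. t \<in> {0..1} \<Longrightarrow> (n1 has_vector_derivative \<alpha> t * n1 t + \<beta> t * n2 t + x1 t) (at t)"
      "\<And>t. t \<in> {0..1} \<Longrightarrow> (n2 has_vector_derivative \<gamma> t * n1 t - \<alpha> t * n2 t + x2 t) (at t)"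
      and x: "\<And>t. t \<in> {0..1} \<Longrightarrow> cmod (x1 t) + cmod (x2 t) \<le> \<phi>' t" and t: "t \<in> {0..1}" for n1 n2 x1 x2 t
  proof -
    have d: "((\<lambda>t. m1 t * n2 t - m2 t * n1 t) has_vector_derivative m1 s * x2 s - m2 s * x1 s) (at s)"
      if s: "s \<in> {0..1}" for s
      by (rule has_vector_derivative_eq_rhs,
          (rule has_vector_derivative_diff has_vector_derivative_mult m[OF s] n[OF s])+)
        (simp add: algebra_simps)
    have bd: "cmod (m1 s * x2 s - m2 s * x1 s) \<le> S * \<phi>' s" if s: "s \<in> {0..1}" for s
    proof -
      have "cmod (m1 s * x2 s - m2 s * x1 s) \<le> cmod (m1 s) * cmod (x2 s) + cmod (m2 s) * cmod (x1 s)"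
        by (metis norm_mult norm_triangle_ineq4)
      also have "\<dots> \<le> S * cmod (x2 s) + S * cmod (x1 s)"
        using S[OF s] by (intro add_mono mult_right_mono) auto
      also have "\<dots> \<le> S * \<phi>' s"
        using mult_left_mono[OF x[OF s] S0] by (simp add: algebra_simps)
      finally show ?thesis .
    qed
    have "cmod ((m1 t * n2 t - m2 t * n1 t) - (m1 0 * n2 0 - m2 0 * n1 0)) \<le> S * \<phi> t - S * \<phi> 0"
    proof (cases "t = 0")
      case False
      show ?thesis
      proof (rule differentiable_bound_general[where \<phi> = "\<lambda>t. S * \<phi> t" and \<phi>' = "\<lambda>t. S * \<phi>' t"
            and f' = "\<lambda>s. m1 s * x2 s - m2 s * x1 s"])
        show "continuous_on {0..t} (\<lambda>t. m1 t * n2 t - m2 t * n1 t)"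
        proof (intro continuous_at_imp_continuous_on ballI)
          fix s assume "s \<in> {0..t}"
          with t show "isCont (\<lambda>t. m1 t * n2 t - m2 t * n1 t) s"
            by (intro has_vector_derivative_continuous[OF d]) auto
        qed
        show "continuous_on {0..t} (\<lambda>t. S * \<phi> t)"
          using t by (intro continuous_intros \<phi>c) auto
        show "((\<lambda>t. S * \<phi> t) has_vector_derivative S * \<phi>' s) (at s)" if "0 < s" "s < t" for s
          using that t \<phi>(1)[of s] by (intro has_vector_derivative_mult_right) auto
      qed (use False t d bd in auto)
    qed auto
    also have "\<dots> \<le> S * q"
      using mult_left_mono[OF mono[OF t] S0] by (simp add: algebra_simps)
    finally show ?thesis .
  qed
  define We Wf De where "We t = m1 t * e2 t - m2 t * e1 t" and "Wf t = m1 t * f2 t - m2 t * f1 t"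
    and "De t = e1 t * f2 t - e2 t * f1 t" for t
  have We: "cmod (We t - e2 0) \<le> S * q" and Wf: "cmod (Wf t - 1) \<le> S * q" if "t \<in> {0..1}" for t
    using W[where ?n1.0 = e1 and ?n2.0 = e2 and ?x1.0 = r1 and ?x2.0 = r2, OF e \<phi>(2) that]
      W[where ?n1.0 = f1 and ?n2.0 = f2 and ?x1.0 = s1 and ?x2.0 = s2, OF f \<phi>(3) that]
    by (simp_all add: We_def Wf_def init)
  have We': "cmod (We t) \<le> \<theta> + S * q" if "t \<in> {0..1}" for t
    using We[OF that] init(4) norm_triangle_ineq2[of "We t" "e2 0"] by linarith
  have Wf': "cmod (Wf t) \<le> 1 + S * q" if "t \<in> {0..1}" for t
    using Wf[OF that] norm_triangle_ineq2[of "Wf t" 1] by simp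
  \<comment> \<open>The approximate solutions stay independent: their determinant differs from 1 by at most \<open>\<theta>\<^sup>2 \<le> 1/4\<close>.\<close>
  have th2: "\<theta>\<^sup>2 \<le> \<theta> / 2"
    using small mult_mono[of \<theta> "1/2" \<theta> \<theta>] by (simp add: power2_eq_square)
  have De: "cmod (De t) \<ge> 1 / 2" if "t \<in> {0..1}" for t
    using D[OF that] th2 small norm_triangle_ineq2[of 1 "1 - De t"] by (simp add: De_def norm_minus_commute)
  have m1D: "m1 t * De t = e1 t * Wf t - f1 t * We t" and m2D: "m2 t * De t = e2 t * Wf t - f2 t * We t" for t
    by (auto simp: De_def We_def Wf_def algebra_simps)
  have K4: "cmod (e1 t) \<le> K" "cmod (e2 t) \<le> K" "cmod (f1 t) \<le> K" "cmod (f2 t) \<le> K" if "t \<in> {0..1}" for t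
  proof -
    have "\<theta> * K \<le> 1 * K" using small by (intro mult_right_mono) auto
    then show "cmod (e1 t) \<le> K" "cmod (e2 t) \<le> K" "cmod (f1 t) \<le> K" "cmod (f2 t) \<le> K"
      using K[OF that] by auto
  qed
  have Sb: "S \<le> 8 * K"
  proof -
    have *: "cmod x \<le> 4 * K * (1 + S * q)"
      if eq: "x * De t0 = y * Wf t0 - w * We t0" and yw: "cmod y \<le> K" "cmod w \<le> K" for x y w
    proof -
      have "cmod x * (1 / 2) \<le> cmod (x * De t0)"
        using mult_left_mono[OF De[OF t0] norm_ge_zero[of x]] by (simp add: norm_mult)
      also have "\<dots> \<le> cmod y * cmod (Wf t0) + cmod w * cmod (We t0)"
        unfolding eq by (metis norm_mult norm_triangle_ineq4)
      also have "\<dots> \<le> K * (1 + S * q) + K * (1 + S * q)"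
        using yw Wf'[OF t0] We'[OF t0] small by (intro add_mono mult_mono) auto
      finally show ?thesis by simp
    qed
    have "S \<le> 4 * K * (1 + S * q)"

      using *[OF m1D[of t0] K4(1,3)[OF t0]] *[OF m2D[of t0] K4(2,4)[OF t0]] by (auto simp: S_def)
    also have "\<dots> = 4 * K + S * (8 * K * q) / 2" by (simp add: algebra_simps)
    also have "\<dots> \<le> 4 * K + S / 2" using mult_left_mono[OF small(1) S0] by (simp add: mult_ac)
    finally show ?thesis by simp
  qed
  have one: "(1::real) \<in> {0..1}" by simp
  have q0: "q \<ge> 0" using mono[of 0] by simp
  have Sq: "S * q \<le> 8 * K * q" using Sb q0 by (intro mult_right_mono)
  have "m1 1 - e1 1 = e1 1 * (Wf 1 - 1) - f1 1 * We 1 - m1 1 * (De 1 - 1)"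
    using m1D[of 1] by (simp add: algebra_simps)
  also have "cmod \<dots> \<le> cmod (e1 1) * cmod (Wf 1 - 1) + cmod (f1 1) * cmod (We 1) + cmod (m1 1) * cmod (De 1 - 1)"
    unfolding norm_mult[symmetric] by (metis (no_types) add_right_mono norm_triangle_ineq4 order_trans)
  also have "\<dots> \<le> K * (8 * K * q) + (\<theta> * K) * (1/2 + 1) + (8 * K) * (\<theta> / 2)"
  proof (intro add_mono mult_mono)
    show "cmod (We 1) \<le> 1 / 2 + 1" using We'[OF one] Sq small by linarith
    show "cmod (m1 1) \<le> 8 * K" using S(1)[OF one] Sb by linarith
    show "cmod (De 1 - 1) \<le> \<theta> / 2" using D[OF one] th2 by (simp add: De_def)
    show "cmod (Wf 1 - 1) \<le> 8 * K * q" using Wf[OF one] Sq by linarith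
  qed (use K[OF one] small q0 in auto)
  also have "\<dots> \<le> 16 * K\<^sup>2 * q + 9 * K * \<theta>"
    using small q0 by (simp add: power2_eq_square algebra_simps)
  finally show ?thesis .
qed

text \<open>
  The choice \<open>g = \<iota> p\<^sub>2 / (2 z)\<close> makes the terms of positive order in \<open>z\<close> cancel: the second row leaves
  \<open>2 z (p\<^sub>2 - \<psi>\<^sub>2)\<close>, and in the first row \<open>2 z \<psi>\<^sub>1 g = \<iota> \<psi>\<^sub>1 p\<^sub>2\<close> compensates the diagonal entry. The
  approximation \<open>p\<^sub>2\<close> of \<open>\<psi>\<^sub>2\<close> has an error of order \<open>r / \<bar>z\<bar>\<close>, just enough for the first difference, and its
  derivative enters only divided by \<open>2 z\<close>. The square root \<open>\<iota>\<close> of \<open>-1\<close> is left open because changing its sign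
  and interchanging the components of the potential yields the other quasimode.
\<close>
lemma quasimode_residual:
  fixes p2 p2' \<psi>1 \<psi>2 \<psi>3 \<psi>4 :: "real \<Rightarrow> complex"
  assumes \<iota>: "\<iota> * \<iota> = -1" and z: "cmod z \<ge> 1/2"
    and p: "(p2 has_vector_derivative p2' t) (at t)" "cmod (p2 t - \<psi>2 t) \<le> r / (1 + cmod z)"
    and r: "0 \<le> r" "r \<le> 1" "cmod (\<psi>1 t) \<le> r" "cmod (\<psi>2 t) \<le> r" "cmod (\<psi>3 t) \<le> r" "cmod (\<psi>4 t) \<le> r"
    and K: "cmod (exp (- 2 * \<iota> * z\<^sup>2 * of_real t)) \<le> K"
  defines "e \<equiv> \<lambda>t. exp (- 2 * \<iota> * z\<^sup>2 * of_real t)" and "g \<equiv> \<lambda>t. \<iota> * p2 t / (2 * z)"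
    and "\<alpha> \<equiv> - 2 * \<iota> * z\<^sup>2 - \<iota> * \<psi>1 t * \<psi>2 t"
  obtains r1 r2 where
    "(e has_vector_derivative \<alpha> * e t + (2 * z * \<psi>1 t + \<iota> * \<psi>3 t) * (g t * e t) + r1) (at t)"
    "((\<lambda>t. g t * e t) has_vector_derivative (2 * z * \<psi>2 t - \<iota> * \<psi>4 t) * e t - \<alpha> * (g t * e t) + r2) (at t)"
    "cmod r1 + cmod r2 \<le> K * (cmod (p2' t) + 8 * r)" "cmod (g t) \<le> 2 * r" "cmod (g t * e t) \<le> 2 * r * K"
proof -
  have z0: "z \<noteq> 0" using z by auto
  have ni: "cmod \<iota> = 1"
  proof -
    have "cmod \<iota> * cmod \<iota> = 1" by (metis \<iota> norm_minus_cancel norm_mult norm_one)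
    then show ?thesis by (metis abs_norm_cancel abs_square_eq_1 power2_eq_square)
  qed
  have de: "(e has_vector_derivative - 2 * \<iota> * z\<^sup>2 * e t) (at t)"
    unfolding e_def
    by (auto intro!: derivative_eq_intros has_vector_derivative_real_field simp: field_simps)
  have dg: "(g has_vector_derivative \<iota> * p2' t / (2 * z)) (at t)"
    unfolding g_def by (intro has_vector_derivative_divide has_vector_derivative_mult_right p)
  have dge: "((\<lambda>t. g t * e t) has_vector_derivative g t * (- 2 * \<iota> * z\<^sup>2 * e t) + \<iota> * p2' t / (2 * z) * e t) (at t)"
    by (intro has_vector_derivative_mult de dg)
  define r1 where "r1 = e t * (\<iota> * \<psi>1 t * (\<psi>2 t - p2 t) - \<iota> * \<psi>3 t * g t)"
  define r2 where "r2 = e t * (\<iota> * p2' t / (2 * z) + 2 * z * (p2 t - \<psi>2 t) + \<iota> * \<psi>4 t - \<iota> * \<psi>1 t * \<psi>2 t * g t)"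
  have 1: "- 2 * \<iota> * z\<^sup>2 * e t = \<alpha> * e t + (2 * z * \<psi>1 t + \<iota> * \<psi>3 t) * (g t * e t) + r1"
    using z0 by (simp add: r1_def \<alpha>_def g_def field_simps)
  have g2: "4 * \<iota> * z\<^sup>2 * g t = - 2 * z * p2 t"
  proof -
    have "4 * \<iota> * z\<^sup>2 * g t = (\<iota> * \<iota>) * (2 * z * p2 t)"
      using z0 by (simp add: g_def field_simps power2_eq_square)
    then show ?thesis by (simp add: \<iota>)
  qed
  have 2: "g t * (- 2 * \<iota> * z\<^sup>2 * e t) + \<iota> * p2' t / (2 * z) * e t =
    (2 * z * \<psi>2 t - \<iota> * \<psi>4 t) * e t - \<alpha> * (g t * e t) + r2"
  proof -
    have "r2 = e t * (\<iota> * p2' t / (2 * z) - 4 * \<iota> * z\<^sup>2 * g t - 2 * z * \<psi>2 t + \<iota> * \<psi>4 t - \<iota> * \<psi>1 t * \<psi>2 t * g t)"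
      unfolding r2_def g2 by (simp add: algebra_simps)
    then show ?thesis by (simp add: \<alpha>_def algebra_simps)
  qed
  have ez: "r / (1 + cmod z) \<le> r" "r / (1 + cmod z) * cmod z \<le> r"
    using z r(1) by (auto simp: field_simps mult_left_mono)
  have "cmod (p2 t) \<le> 2 * r"
    using norm_triangle_ineq2[of "p2 t" "\<psi>2 t"] p(2) ez r by linarith
  have half: "x / (2 * cmod z) \<le> x" if "x \<ge> 0" for x
    using mult_left_mono[of 1 "2 * cmod z" x] z that z0 by (subst pos_divide_le_eq) auto
  have "cmod (g t) \<le> cmod (p2 t)"
    using half[of "cmod (p2 t)"] by (simp add: g_def norm_mult norm_divide ni)
  with \<open>cmod (p2 t) \<le> 2 * r\<close> have g: "cmod (g t) \<le> 2 * r" by linarith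
  have K0: "K \<ge> 0" using K norm_ge_zero order_trans by blast
  have eK: "cmod (e t) \<le> K" using K by (simp add: e_def)
  have rr: "r * r \<le> r" using r by (simp add: mult_left_le)
  have ab: "cmod (x * y) \<le> c * d" if "cmod x \<le> c" "cmod y \<le> d" for x y :: complex and c d
    unfolding norm_mult using that norm_ge_zero[of x] by (intro mult_mono) (auto intro: order_trans[OF norm_ge_zero])
  have i: "cmod (\<iota> * x) = cmod x" for x by (simp add: norm_mult ni)
  have "cmod (\<iota> * \<psi>1 t * (\<psi>2 t - p2 t) - \<iota> * \<psi>3 t * g t) \<le> r * r + r * (2 * r)"
    using p(2) ez r g unfolding mult.assoc[of \<iota>]
    by (intro order_trans[OF norm_triangle_ineq4] add_mono, unfold i) (auto intro!: ab simp: norm_minus_commute)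
  then have A: "cmod (\<iota> * \<psi>1 t * (\<psi>2 t - p2 t) - \<iota> * \<psi>3 t * g t) \<le> 3 * r" using rr by simp
  have B1: "cmod (\<iota> * p2' t / (2 * z)) \<le> cmod (p2' t)"
    using half[of "cmod (p2' t)"] by (simp add: norm_mult norm_divide ni)
  have B2: "cmod (2 * z * (p2 t - \<psi>2 t)) \<le> 2 * r"
  proof -
    have "cmod (2 * z * w) = 2 * (cmod w * cmod z)" for w by (simp add: norm_mult)
    then show ?thesis using mult_right_mono[OF p(2), of "cmod z"] ez(2) by simp
  qed
  have B3: "cmod (\<iota> * \<psi>4 t) \<le> r" using r by (simp add: i)
  have "cmod (\<iota> * \<psi>1 t * \<psi>2 t * g t) \<le> (r * r) * (2 * r)"
    unfolding mult.assoc[of \<iota>] i using r g by (intro ab) (auto simp: mult.assoc intro!: ab)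
  also have "\<dots> \<le> r * (2 * 1)"
    using rr r by (intro mult_mono) auto
  finally have B4: "cmod (\<iota> * \<psi>1 t * \<psi>2 t * g t) \<le> 2 * r" by simp
  have "cmod (\<iota> * p2' t / (2 * z) + 2 * z * (p2 t - \<psi>2 t) + \<iota> * \<psi>4 t - \<iota> * \<psi>1 t * \<psi>2 t * g t)
    \<le> cmod (p2' t) + 2 * r + r + 2 * r"
    by (intro order_trans[OF norm_triangle_ineq4] order_trans[OF norm_triangle_ineq] add_mono B1 B2 B3 B4)
  then have B: "cmod (\<iota> * p2' t / (2 * z) + 2 * z * (p2 t - \<psi>2 t) + \<iota> * \<psi>4 t - \<iota> * \<psi>1 t * \<psi>2 t * g t)
    \<le> cmod (p2' t) + 5 * r" by simp
  have "cmod r1 + cmod r2 \<le> K * (3 * r) + K * (cmod (p2' t) + 5 * r)"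
    unfolding r1_def r2_def by (intro add_mono ab eK A B)
  then have "cmod r1 + cmod r2 \<le> K * (cmod (p2' t) + 8 * r)" by (simp add: algebra_simps)
  with that[OF de[unfolded 1] dge[unfolded 2] _ g ab[OF g eK]] show thesis by simp
qed

text \<open>
  The second quasimode is the first one for the system with its two components interchanged, in which
  \<open>\<iota>\<close> becomes \<open>-\<iota>\<close> and \<open>\<psi>\<^sub>1, \<psi>\<^sub>3\<close> trade places with \<open>\<psi>\<^sub>2, \<psi>\<^sub>4\<close>. By the same symmetry this one
  statement covers both diagonal entries of the fundamental solution.
\<close>
lemma first_entry_estimate:
  fixes m1 m2 \<psi>1 \<psi>2 \<psi>3 \<psi>4 :: "real \<Rightarrow> complex" and v1 v2 :: "real \<Rightarrow> real"
  assumes \<iota>: "\<iota> * \<iota> = -1" and z: "cmod z \<ge> 1/2"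
    and m: "\<And>t. t \<in> {0..1} \<Longrightarrow> (m1 has_vector_derivative
         (- 2 * \<iota> * z\<^sup>2 - \<iota> * \<psi>1 t * \<psi>2 t) * m1 t + (2 * z * \<psi>1 t + \<iota> * \<psi>3 t) * m2 t) (at t)"
      "\<And>t. t \<in> {0..1} \<Longrightarrow> (m2 has_vector_derivative
         (2 * z * \<psi>2 t - \<iota> * \<psi>4 t) * m1 t - (- 2 * \<iota> * z\<^sup>2 - \<iota> * \<psi>1 t * \<psi>2 t) * m2 t) (at t)"
    and init: "m1 0 = 1" "m2 0 = 0"
    and v: "continuous_on {0..1} v1" "continuous_on {0..1} v2"
      "\<And>a b. 0 \<le> a \<Longrightarrow> a \<le> b \<Longrightarrow> b \<le> 1 \<Longrightarrow> cmod (\<psi>1 b - \<psi>1 a) \<le> v1 b - v1 a"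
      "\<And>a b. 0 \<le> a \<Longrightarrow> a \<le> b \<Longrightarrow> b \<le> 1 \<Longrightarrow> cmod (\<psi>2 b - \<psi>2 a) \<le> v2 b - v2 a"
      "v1 1 - v1 0 \<le> r" "v2 1 - v2 0 \<le> r"
    and r: "\<And>t. cmod (\<psi>1 t) \<le> r" "\<And>t. cmod (\<psi>2 t) \<le> r" "\<And>t. cmod (\<psi>3 t) \<le> r" "\<And>t. cmod (\<psi>4 t) \<le> r"
    and K: "\<And>t. t \<in> {0..1} \<Longrightarrow> cmod (exp (- 2 * \<iota> * z\<^sup>2 * of_real t)) \<le> K"
      "\<And>t. t \<in> {0..1} \<Longrightarrow> cmod (exp (2 * \<iota> * z\<^sup>2 * of_real t)) \<le> K"
    and small: "80 * K\<^sup>2 * r \<le> 1" "4 * r \<le> 1" "0 < r" "1 \<le> K"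
  shows "cmod (m1 1 - exp (- 2 * \<iota> * z\<^sup>2)) \<le> 178 * K ^ 3 * r"
proof -
  have e: "r / (1 + cmod z) > 0" using small(3) norm_ge_zero[of z] by (intro divide_pos_pos) linarith+
  obtain p1 p1' \<phi>1 \<phi>1' where P1:
    "\<forall>t\<in>{0..1}. (p1 has_vector_derivative p1' t) (at t)"
    "\<forall>t\<in>{0..1}. cmod (p1 t - \<psi>1 t) \<le> r / (1 + cmod z)"
    "\<forall>t\<in>{0..1}. (\<phi>1 has_vector_derivative \<phi>1' t) (at t)"
    "\<forall>t\<in>{0..1}. cmod (p1' t) \<le> \<phi>1' t" "\<phi>1 1 - \<phi>1 0 \<le> v1 1 - v1 0"
    by (rule smooth_approximation[OF v(1,3) e])
  note p1 = P1[rule_format]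
  obtain p2 p2' \<phi>2 \<phi>2' where P2:
    "\<forall>t\<in>{0..1}. (p2 has_vector_derivative p2' t) (at t)"
    "\<forall>t\<in>{0..1}. cmod (p2 t - \<psi>2 t) \<le> r / (1 + cmod z)"
    "\<forall>t\<in>{0..1}. (\<phi>2 has_vector_derivative \<phi>2' t) (at t)"
    "\<forall>t\<in>{0..1}. cmod (p2' t) \<le> \<phi>2' t" "\<phi>2 1 - \<phi>2 0 \<le> v2 1 - v2 0"
    by (rule smooth_approximation[OF v(2,4) e])
  note p2 = P2[rule_format]
  define \<alpha> where "\<alpha> t = - 2 * \<iota> * z\<^sup>2 - \<iota> * \<psi>1 t * \<psi>2 t" for t
  define e1 where "e1 t = exp (- 2 * \<iota> * z\<^sup>2 * of_real t)" for t
  define f2 where "f2 t = exp (- 2 * (-\<iota>) * z\<^sup>2 * of_real t)" for t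
  define g where "g t = \<iota> * p2 t / (2 * z)" for t
  define h where "h t = -\<iota> * p1 t / (2 * z)" for t
  define e2 where "e2 t = g t * e1 t" for t
  define f1 where "f1 t = h t * f2 t" for t
  have r1: "0 \<le> r" "r \<le> 1" using small by auto
  have "\<exists>r1 r2. (e1 has_vector_derivative \<alpha> t * e1 t + (2 * z * \<psi>1 t + \<iota> * \<psi>3 t) * e2 t + r1) (at t) \<and>
    (e2 has_vector_derivative (2 * z * \<psi>2 t - \<iota> * \<psi>4 t) * e1 t - \<alpha> t * e2 t + r2) (at t) \<and>
    cmod r1 + cmod r2 \<le> K * (cmod (p2' t) + 8 * r) \<and> cmod (g t) \<le> 2 * r \<and> cmod (e2 t) \<le> 2 * r * K" if t: "t \<in> {0..1}" for t
    unfolding e1_def[abs_def] e2_def[abs_def] g_def \<alpha>_def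
    by (rule quasimode_residual[where \<iota> = \<iota> and ?\<psi>1.0 = \<psi>1 and ?\<psi>2.0 = \<psi>2 and ?\<psi>3.0 = \<psi>3 and ?\<psi>4.0 = \<psi>4 and t = t and z = z and ?p2.0 = p2 and ?p2' = p2' and r = r and K = K, OF \<iota> z p2(1)[OF t] p2(2)[OF t] r1 r(1)[of t] r(2)[of t] r(3)[of t] r(4)[of t] K(1)[OF t]]) blast
  then obtain r1 r2 where E:
    "\<And>t. t \<in> {0..1} \<Longrightarrow> (e1 has_vector_derivative \<alpha> t * e1 t + (2 * z * \<psi>1 t + \<iota> * \<psi>3 t) * e2 t + r1 t) (at t)"
    "\<And>t. t \<in> {0..1} \<Longrightarrow> (e2 has_vector_derivative (2 * z * \<psi>2 t - \<iota> * \<psi>4 t) * e1 t - \<alpha> t * e2 t + r2 t) (at t)"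
    "\<And>t. t \<in> {0..1} \<Longrightarrow> cmod (r1 t) + cmod (r2 t) \<le> K * (cmod (p2' t) + 8 * r)"
    "\<And>t. t \<in> {0..1} \<Longrightarrow> cmod (g t) \<le> 2 * r" "\<And>t. t \<in> {0..1} \<Longrightarrow> cmod (e2 t) \<le> 2 * r * K"
    by metis
  have "\<exists>s2 s1. (f2 has_vector_derivative (- \<alpha> t) * f2 t + (2 * z * \<psi>2 t + -\<iota> * \<psi>4 t) * f1 t + s2) (at t) \<and>
    (f1 has_vector_derivative (2 * z * \<psi>1 t - -\<iota> * \<psi>3 t) * f2 t - (- \<alpha> t) * f1 t + s1) (at t) \<and>
    cmod s2 + cmod s1 \<le> K * (cmod (p1' t) + 8 * r) \<and> cmod (h t) \<le> 2 * r \<and> cmod (f1 t) \<le> 2 * r * K" if t: "t \<in> {0..1}" for t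
  proof -
    have \<iota>': "(-\<iota>) * (-\<iota>) = -1" using \<iota> by simp
    have K': "cmod (exp (- 2 * (-\<iota>) * z\<^sup>2 * of_real t)) \<le> K" using K(2)[OF t] by simp
    have \<alpha>': "- \<alpha> t = - 2 * (-\<iota>) * z\<^sup>2 - (-\<iota>) * \<psi>2 t * \<psi>1 t" by (simp add: \<alpha>_def mult_ac)
    show ?thesis
      unfolding f1_def[abs_def] f2_def[abs_def] h_def \<alpha>'
      by (rule quasimode_residual[where \<iota> = "-\<iota>" and ?\<psi>1.0 = \<psi>2 and ?\<psi>2.0 = \<psi>1 and ?\<psi>3.0 = \<psi>4 and ?\<psi>4.0 = \<psi>3 and t = t and z = z and ?p2.0 = p1 and ?p2' = p1' and r = r and K = K, OF \<iota>' z p1(1)[OF t] p1(2)[OF t] r1 r(2)[of t] r(1)[of t] r(4)[of t] r(3)[of t] K']) blast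
  qed
  then obtain s1 s2 where F0:
    "\<And>t. t \<in> {0..1} \<Longrightarrow> (f2 has_vector_derivative (- \<alpha> t) * f2 t + (2 * z * \<psi>2 t + -\<iota> * \<psi>4 t) * f1 t + s2 t) (at t)"
    "\<And>t. t \<in> {0..1} \<Longrightarrow> (f1 has_vector_derivative (2 * z * \<psi>1 t - -\<iota> * \<psi>3 t) * f2 t - (- \<alpha> t) * f1 t + s1 t) (at t)"
    "\<And>t. t \<in> {0..1} \<Longrightarrow> cmod (s2 t) + cmod (s1 t) \<le> K * (cmod (p1' t) + 8 * r)"
    "\<And>t. t \<in> {0..1} \<Longrightarrow> cmod (h t) \<le> 2 * r" "\<And>t. t \<in> {0..1} \<Longrightarrow> cmod (f1 t) \<le> 2 * r * K"
    by metis
  have F: "\<And>t. t \<in> {0..1} \<Longrightarrow> (f1 has_vector_derivative \<alpha> t * f1 t + (2 * z * \<psi>1 t + \<iota> * \<psi>3 t) * f2 t + s1 t) (at t)"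
    "\<And>t. t \<in> {0..1} \<Longrightarrow> (f2 has_vector_derivative (2 * z * \<psi>2 t - \<iota> * \<psi>4 t) * f1 t - \<alpha> t * f2 t + s2 t) (at t)"
    using F0(1,2) by (auto simp: algebra_simps)
  have ef: "e1 t * f2 t = 1" for t
    by (simp add: e1_def f2_def flip: exp_add)
  have "cmod (m1 1 - e1 1) \<le> 16 * K\<^sup>2 * (10 * K * r) + 9 * K * (2 * r)"
  proof (rule approximate_fundamental_system_bound[where \<alpha> = \<alpha> and ?e1.0 = e1 and ?e2.0 = e2 and ?f1.0 = f1 and ?f2.0 = f2
        and \<phi> = "\<lambda>t. K * (\<phi>1 t + \<phi>2 t + 8 * r * t)" and \<phi>' = "\<lambda>t. K * (\<phi>1' t + \<phi>2' t + 8 * r)",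
        OF m[folded \<alpha>_def] E(1,2) F])
    show "((\<lambda>t. K * (\<phi>1 t + \<phi>2 t + 8 * r * t)) has_vector_derivative K * (\<phi>1' t + \<phi>2' t + 8 * r)) (at t)"
      if t: "t \<in> {0..1}" for t
    proof -
      have "((\<lambda>t. 8 * r * t) has_vector_derivative 8 * r) (at t)"
        by (auto intro!: derivative_eq_intros simp flip: has_real_derivative_iff_has_vector_derivative)
      then show ?thesis
        by (intro has_vector_derivative_mult_right has_vector_derivative_add p1(3)[OF t] p2(3)[OF t])
    qed
    show "cmod (r1 t) + cmod (r2 t) \<le> K * (\<phi>1' t + \<phi>2' t + 8 * r)" if t: "t \<in> {0..1}" for t
    proof -
      have "K * (cmod (p2' t) + 8 * r) \<le> K * (\<phi>1' t + \<phi>2' t + 8 * r)"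
        using p1(4)[OF t] p2(4)[OF t] norm_ge_zero[of "p1' t"] small by (intro mult_left_mono) linarith+
      then show ?thesis using E(3)[OF t] by linarith
    qed
    show "cmod (s1 t) + cmod (s2 t) \<le> K * (\<phi>1' t + \<phi>2' t + 8 * r)" if t: "t \<in> {0..1}" for t
    proof -
      have "K * (cmod (p1' t) + 8 * r) \<le> K * (\<phi>1' t + \<phi>2' t + 8 * r)"
        using p1(4)[OF t] p2(4)[OF t] norm_ge_zero[of "p2' t"] small by (intro mult_left_mono) linarith+
      then show ?thesis using F0(3)[OF t] by linarith
    qed
    have "K * (\<phi>1 1 + \<phi>2 1 + 8 * r * 1 - (\<phi>1 0 + \<phi>2 0 + 8 * r * 0)) \<le> K * (10 * r)"
      using p1(5) p2(5) v(5,6) small by (intro mult_left_mono) linarith+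
    then show "K * (\<phi>1 1 + \<phi>2 1 + 8 * r * 1) - K * (\<phi>1 0 + \<phi>2 0 + 8 * r * 0) \<le> 10 * K * r"
      by (simp add: algebra_simps)
    show "cmod (e1 t * f2 t - e2 t * f1 t - 1) \<le> (2 * r)\<^sup>2" if t: "t \<in> {0..1}" for t
    proof -
      have "e1 t * f2 t - e2 t * f1 t - 1 = - (g t * h t) * (e1 t * f2 t)"
        by (simp add: e2_def f1_def ef algebra_simps)
      then have "cmod (e1 t * f2 t - e2 t * f1 t - 1) = cmod (g t) * cmod (h t)"
        by (simp add: ef norm_mult)
      also have "\<dots> \<le> (2 * r) * (2 * r)" using E(4)[OF t] F0(4)[OF t] r1 by (intro mult_mono) auto
      finally show ?thesis by (simp add: power2_eq_square)
    qed
    show "cmod (e2 0) \<le> 2 * r" using E(4)[of 0] by (simp add: e2_def e1_def)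
    show "8 * K * (10 * K * r) \<le> 1" using small by (simp add: power2_eq_square mult_ac)
    show "cmod (e1 t) \<le> K" "cmod (f2 t) \<le> K" if "t \<in> {0..1}" for t
      using K[OF that] by (simp_all add: e1_def f2_def)
  qed (use E(5) F0(5) init small in \<open>auto simp: f2_def\<close>)
  also have "\<dots> = 160 * (K ^ 3 * r) + 18 * (K * r)" by (simp add: power2_eq_square power3_eq_cube)
  also have "K * r \<le> K ^ 3 * r"
    using small power_increasing[of 1 3 K] by (intro mult_right_mono) auto
  finally show ?thesis by (simp add: e1_def mult_ac)
qed

lemma X_continuous: "\<psi> \<in> X \<Longrightarrow> continuous_on UNIV (\<lambda>t. \<psi> t $ j)"
  for \<psi> :: potential
  by (rule H1_variation[of "\<lambda>t. \<psi> t $ j"]) (auto simp: X_def)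

text \<open>
  In the region considered the exponentials \<open>exp (\<plusminus> 2 \<i> z\<^sup>2 t)\<close> are bounded by \<open>exp 2\<close>, so the constants in the
  estimates of the two diagonal entries do not depend on \<open>z\<close>.
\<close>
lemma discr_estimate:
  assumes \<eta>: "\<eta> > 0"
  obtains \<rho> where "\<rho> > 0"
    "\<And>(\<psi> :: potential) z. \<psi> \<in> X \<Longrightarrow> X_norm \<psi> < \<rho> \<Longrightarrow> cmod z \<ge> 1/2 \<Longrightarrow> \<bar>Im (2 * z\<^sup>2)\<bar> \<le> 2 \<Longrightarrow>
       cmod (discr z \<psi> - 2 * cos (2 * z\<^sup>2)) \<le> \<eta>"
proof -
  define K :: real where "K = exp 2"
  have K1: "K \<ge> 1" by (simp add: K_def)
  \<comment> \<open>Each diagonal entry contributes an error of at most \<open>178 K\<^sup>3 r \<le> \<eta> / 2\<close>.\<close>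
  define r where "r = min (1/4) (min (1 / (80 * K\<^sup>2)) (\<eta> / (356 * K ^ 3)))"
  have r: "r > 0" "4 * r \<le> 1" using \<eta> K1 by (auto simp: r_def)
  have r2: "80 * K\<^sup>2 * r \<le> 1"
    using mult_left_mono[of r "1 / (80 * K\<^sup>2)" "80 * K\<^sup>2"] K1 by (simp add: r_def)
  have r3: "178 * K ^ 3 * r \<le> \<eta> / 2"
    using mult_left_mono[of r "\<eta> / (356 * K ^ 3)" "178 * K ^ 3"] K1 by (simp add: r_def)
  show thesis
  proof (rule that[of "r / 2"])
    fix \<psi> :: potential and z
    assume \<psi>: "\<psi> \<in> X" "X_norm \<psi> < r / 2" and z: "cmod z \<ge> 1/2" "\<bar>Im (2 * z\<^sup>2)\<bar> \<le> 2"
    have nj: "H1_norm (\<lambda>t. \<psi> t $ j) < r / 2" for j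
      using H1_norm_le_X_norm[of \<psi> j] \<psi>(2) by linarith
    have "\<exists>v. continuous_on {0..1} v \<and> (\<forall>a b. 0 \<le> a \<longrightarrow> a \<le> b \<longrightarrow> b \<le> 1 \<longrightarrow> cmod (\<psi> b $ j - \<psi> a $ j) \<le> v b - v a) \<and>
      v 1 - v 0 \<le> r \<and> (\<forall>t. cmod (\<psi> t $ j) \<le> r)" for j
    proof (rule H1_variation[of "\<lambda>t. \<psi> t $ j"])
      fix v :: "real \<Rightarrow> real"
      assume v: "continuous_on {0..1} v"
        "\<And>a b. 0 \<le> a \<Longrightarrow> a \<le> b \<Longrightarrow> b \<le> 1 \<Longrightarrow> cmod (\<psi> b $ j - \<psi> a $ j) \<le> v b - v a"
        "\<And>r. H1_norm (\<lambda>t. \<psi> t $ j) < r \<Longrightarrow> v 1 - v 0 \<le> r"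
        "\<And>r t. H1_norm (\<lambda>t. \<psi> t $ j) < r \<Longrightarrow> cmod (\<psi> t $ j) \<le> 2 * r"
      have "v 1 - v 0 \<le> r" using v(3)[OF nj] r by linarith
      moreover have "cmod (\<psi> t $ j) \<le> r" for t using v(4)[OF nj, of t] by simp
      ultimately show ?thesis using v(1,2) by (intro exI[of _ v]) simp
    qed (use \<psi> in \<open>simp add: X_def\<close>)
    then obtain v where v: "\<And>j. continuous_on {0..1} (v j)"
      "\<And>j a b. 0 \<le> a \<Longrightarrow> a \<le> b \<Longrightarrow> b \<le> 1 \<Longrightarrow> cmod (\<psi> b $ j - \<psi> a $ j) \<le> v j b - v j a"
      "\<And>j. v j 1 - v j 0 \<le> r" "\<And>j t. cmod (\<psi> t $ j) \<le> r"
      by metis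
    obtain a b c d where s: "zs_solution z \<psi> a b" "zs_solution z \<psi> c d"
      and i: "a 0 = 1" "b 0 = 0" "c 0 = 0" "d 0 = 1" and tr: "discr z \<psi> = a 1 + d 1"
      using fundamental_solution_entries[OF X_continuous[OF \<psi>(1)]] by metis
    have E: "cmod (exp (- 2 * \<i> * z\<^sup>2 * of_real t)) \<le> K" "cmod (exp (2 * \<i> * z\<^sup>2 * of_real t)) \<le> K"
      if t: "t \<in> {0..1}" for t :: real
    proof -
      have "\<bar>Im (2 * z\<^sup>2) * t\<bar> \<le> 2 * 1"
        unfolding abs_mult using t z(2) by (intro mult_mono) auto
      moreover have "Re (- 2 * \<i> * z\<^sup>2 * of_real t) = Im (2 * z\<^sup>2) * t"
        "Re (2 * \<i> * z\<^sup>2 * of_real t) = - (Im (2 * z\<^sup>2) * t)" by simp_all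
      ultimately show "cmod (exp (- 2 * \<i> * z\<^sup>2 * of_real t)) \<le> K" "cmod (exp (2 * \<i> * z\<^sup>2 * of_real t)) \<le> K"
        by (simp_all only: norm_exp_eq_Re K_def exp_le_cancel_iff)
    qed
    have A: "cmod (a 1 - exp (- 2 * \<i> * z\<^sup>2)) \<le> 178 * K ^ 3 * r"
      by (rule first_entry_estimate[where \<iota> = \<i> and ?m2.0 = b and ?\<psi>1.0 = "\<lambda>t. \<psi> t $ 1" and ?\<psi>2.0 = "\<lambda>t. \<psi> t $ 2"
            and ?\<psi>3.0 = "\<lambda>t. \<psi> t $ 3" and ?\<psi>4.0 = "\<lambda>t. \<psi> t $ 4" and ?v1.0 = "v 1" and ?v2.0 = "v 2"])
        (use s(1) i v E r r2 K1 z in \<open>auto simp: zs_solution_def coef11_def coef12_def coef21_def\<close>)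
    have D: "cmod (d 1 - exp (- 2 * (-\<i>) * z\<^sup>2)) \<le> 178 * K ^ 3 * r"
    proof (rule first_entry_estimate[where \<iota> = "-\<i>" and ?m2.0 = c and ?\<psi>1.0 = "\<lambda>t. \<psi> t $ 2" and ?\<psi>2.0 = "\<lambda>t. \<psi> t $ 1"
            and ?\<psi>3.0 = "\<lambda>t. \<psi> t $ 4" and ?\<psi>4.0 = "\<lambda>t. \<psi> t $ 3" and ?v1.0 = "v 2" and ?v2.0 = "v 1"])
      fix t
      have "- coef11 z (\<psi> t) = - 2 * - \<i> * z\<^sup>2 - - \<i> * \<psi> t $ 2 * \<psi> t $ 1" by (simp add: coef11_def mult_ac)
      then show "(d has_vector_derivative (- 2 * - \<i> * z\<^sup>2 - - \<i> * \<psi> t $ 2 * \<psi> t $ 1) * d t + (2 * z * \<psi> t $ 2 + - \<i> * \<psi> t $ 4) * c t) (at t)"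
        "(c has_vector_derivative (2 * z * \<psi> t $ 1 - - \<i> * \<psi> t $ 3) * d t - (- 2 * - \<i> * z\<^sup>2 - - \<i> * \<psi> t $ 2 * \<psi> t $ 1) * c t) (at t)"
        using s(2) unfolding zs_solution_def coef12_def coef21_def
        by (metis (no_types, lifting) add.commute diff_conv_add_uminus minus_mult_left minus_minus)+
    qed (use i v E r r2 K1 z in auto)
    have "2 * cos (2 * z\<^sup>2) = exp (- 2 * \<i> * z\<^sup>2) + exp (- 2 * (-\<i>) * z\<^sup>2)"
      by (simp add: cos_exp_eq mult_ac)
    then have "cmod (discr z \<psi> - 2 * cos (2 * z\<^sup>2)) \<le> cmod (a 1 - exp (- 2 * \<i> * z\<^sup>2)) + cmod (d 1 - exp (- 2 * (-\<i>) * z\<^sup>2))"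
      unfolding tr by (simp only: add_diff_add norm_triangle_ineq)
    then show "cmod (discr z \<psi> - 2 * cos (2 * z\<^sup>2)) \<le> \<eta>" using A D r3 by linarith
  qed (use r in auto)
qed

section \<open>Real values of a holomorphic function near a nondegenerate critical point\<close>

text \<open>
  If \<open>F\<close> commutes with conjugation and \<open>x\<close>, \<open>y\<close> are real, this is \<open>Im (F (x + \<i> y)) / y\<close>. Dividing by \<open>y\<close>
  removes the real axis from the set where \<open>F\<close> is real; the formula makes sense for complex \<open>x\<close> and \<open>y\<close>.
\<close>
definition odd_quotient :: "(complex \<Rightarrow> complex) \<Rightarrow> complex \<Rightarrow> complex \<Rightarrow> complex" where
  "odd_quotient F x y = (if y = 0 then deriv F x else (F (x + \<i> * y) - F (x - \<i> * y)) / (2 * \<i> * y))"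

lemma odd_quotient_minus: "odd_quotient F x (- y) = odd_quotient F x y"
  by (simp add: odd_quotient_def divide_simps)

lemma holomorphic_odd_quotient:
  assumes F: "F holomorphic_on ball 0 R" and c: "2 * c \<le> R" "c > 0"
    and x: "x holomorphic_on ball 0 c" "\<And>y. y \<in> ball 0 c \<Longrightarrow> cmod (x y) < c"
  shows "(\<lambda>y. odd_quotient F (x y) y) holomorphic_on ball 0 c"
proof -
  define N where "N y = F (x y + \<i> * y) - F (x y - \<i> * y)" for y
  have in_ball: "x y + \<i> * y \<in> ball 0 R" "x y - \<i> * y \<in> ball 0 R" if "y \<in> ball 0 c" for y
    using x(2)[OF that] that c norm_triangle_ineq[of "x y" "\<i> * y"] norm_triangle_ineq4[of "x y" "\<i> * y"]
    by (auto simp: norm_mult)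
  have hF: "(\<lambda>y. F (g y)) holomorphic_on ball 0 c" if "g holomorphic_on ball 0 c" "\<And>y. y \<in> ball 0 c \<Longrightarrow> g y \<in> ball 0 R" for g
  proof -
    have "g ` ball 0 c \<subseteq> ball 0 R" using that(2) by blast
    then show ?thesis using holomorphic_on_compose_gen[OF that(1) F] by (simp add: o_def)
  qed
  have hN: "N holomorphic_on ball 0 c"
    unfolding N_def
    by (intro holomorphic_on_diff hF[OF _ in_ball(1)] hF[OF _ in_ball(2)] holomorphic_on_add holomorphic_on_mult
        holomorphic_on_const holomorphic_on_ident x(1))
  have z: "0 \<in> ball (0::complex) c" using c by simp
  have dF: "(F has_field_derivative deriv F (x 0)) (at (x 0))"
    using x(2)[OF z] c by (intro holomorphic_derivI[OF F]) auto
  have dx: "(x has_field_derivative deriv x 0) (at 0)"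
    by (rule holomorphic_derivI[OF x(1) _ z]) auto
  have "((\<lambda>y. x y + \<i> * y) has_field_derivative deriv x 0 + \<i>) (at 0)"
    "((\<lambda>y. x y - \<i> * y) has_field_derivative deriv x 0 - \<i>) (at 0)"
    using dx by (auto intro!: derivative_eq_intros)
  with dF have "((\<lambda>y. F (x y + \<i> * y)) has_field_derivative deriv F (x 0) * (deriv x 0 + \<i>)) (at 0)"
    "((\<lambda>y. F (x y - \<i> * y)) has_field_derivative deriv F (x 0) * (deriv x 0 - \<i>)) (at 0)"
    by (auto intro!: DERIV_chain2[where f = F])
  then have "(N has_field_derivative deriv F (x 0) * (deriv x 0 + \<i>) - deriv F (x 0) * (deriv x 0 - \<i>)) (at 0)"
    unfolding N_def by (rule DERIV_diff)
  then have dN: "deriv N 0 = 2 * \<i> * deriv F (x 0)"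
    by (auto simp: DERIV_imp_deriv algebra_simps)
  have "(\<lambda>y. (if y = 0 then deriv N 0 else (N y - N 0) / (y - 0)) / (2 * \<i>)) holomorphic_on ball 0 c"
    by (intro holomorphic_on_divide pole_lemma_open hN holomorphic_on_const) auto
  moreover have "(if y = 0 then deriv N 0 else (N y - N 0) / (y - 0)) / (2 * \<i>) = odd_quotient F (x y) y" for y
    by (auto simp: odd_quotient_def dN N_def field_simps)
  ultimately show ?thesis by simp
qed

text \<open>
  As a function of \<open>x\<close> the quotient \<open>odd_quotient F x y\<close> has derivative close to \<open>-2\<close>, since this derivative
  is an average of \<open>F''\<close>. So \<open>x \<mapsto> x + odd_quotient F x y / 2\<close> is a contraction, whose fixed point \<open>\<xi> y\<close> is
  the only zero. The iterates starting at \<open>0\<close> are holomorphic in \<open>y\<close> and converge uniformly, hence \<open>\<xi>\<close> is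
  holomorphic. Uniqueness of the zero transfers the symmetries of \<open>F\<close> to \<open>\<xi>\<close>: it is even, and it
  is real for real \<open>y\<close>.
\<close>
lemma graph_of_real_level:
  fixes F :: "complex \<Rightarrow> complex"
  assumes F: "F holomorphic_on ball 0 R" and c: "2 * c \<le> R" "c > 0"
    and F2: "\<And>w. w \<in> ball 0 R \<Longrightarrow> cmod (deriv (deriv F) w + 2) \<le> 1/2"
    and F1: "cmod (deriv F 0) \<le> c / 4"
    and sym: "\<And>w. w \<in> ball 0 R \<Longrightarrow> F (cnj w) = cnj (F w)"
  obtains \<xi> where "\<xi> holomorphic_on ball 0 c" "\<And>y. y \<in> ball 0 c \<Longrightarrow> cmod (\<xi> y) < c"
    "\<And>t. \<bar>t\<bar> < c \<Longrightarrow> \<xi> (of_real t) \<in> \<real>" "\<And>y. y \<in> ball 0 c \<Longrightarrow> \<xi> (- y) = \<xi> y"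
    "\<And>s t. \<bar>s\<bar> < c \<Longrightarrow> \<bar>t\<bar> < c \<Longrightarrow> t \<noteq> 0 \<Longrightarrow> F (Complex s t) \<in> \<real> \<longleftrightarrow> of_real s = \<xi> (of_real t)"
    "deriv F (\<xi> 0) = 0"
proof -
  let ?E = "odd_quotient F"
  have hF': "deriv F holomorphic_on ball 0 R"
    by (intro holomorphic_deriv F) auto
  have dF: "(F has_field_derivative deriv F w) (at w)" "(deriv F has_field_derivative deriv (deriv F) w) (at w)"
    if "w \<in> ball 0 R" for w
    by (rule holomorphic_derivI[OF F open_ball that] holomorphic_derivI[OF hF' open_ball that])+
  have L1: "cmod (deriv F p - deriv F q + 2 * (p - q)) \<le> 1/2 * cmod (p - q)"
    if "p \<in> ball 0 R" "q \<in> ball 0 R" for p q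
  proof -
    have "cmod ((deriv F p + 2 * p) - (deriv F q + 2 * q)) \<le> 1/2 * cmod (p - q)"
    proof (rule field_differentiable_bound[of "ball 0 R" _ "\<lambda>w. deriv (deriv F) w + 2"])
      show "((\<lambda>w. deriv F w + 2 * w) has_field_derivative deriv (deriv F) w + 2) (at w within ball 0 R)"
        if "w \<in> ball 0 R" for w
      proof -
        have "((\<lambda>w. deriv F w + 2 * w) has_field_derivative deriv (deriv F) w + 2 * 1) (at w)"
          by (intro DERIV_add DERIV_cmult DERIV_ident dF that)
        then show ?thesis by (simp add: has_field_derivative_at_within)
      qed
    qed (use F2 that in auto)
    then show ?thesis by (simp add: algebra_simps)
  qed
  have in_ball: "x + \<i> * y \<in> ball 0 R" "x - \<i> * y \<in> ball 0 R" if "x \<in> cball 0 c" "y \<in> ball 0 c" for x y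
    using that c norm_triangle_ineq[of x "\<i> * y"] norm_triangle_ineq4[of x "\<i> * y"]
    by (auto simp: norm_mult)
  have L2: "cmod (?E 0 y) \<le> cmod (deriv F 0) + cmod y / 2" if y: "y \<in> ball 0 c" for y
  proof (cases "y = 0")
    case False
    define G where "G w = F w + w\<^sup>2 - deriv F 0 * w" for w
    have yR: "cball 0 (cmod y) \<subseteq> ball 0 R" using y c by auto
    have "cmod (G (\<i> * y) - G (- \<i> * y)) \<le> (cmod y / 2) * cmod (\<i> * y - (- \<i> * y))"
    proof (rule field_differentiable_bound[of "cball 0 (cmod y)" _ "\<lambda>w. deriv F w + 2 * w - deriv F 0"])
      fix w :: complex assume w: "w \<in> cball 0 (cmod y)"
      have wR: "w \<in> ball 0 R" using w subsetD[OF yR, of w] by simp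
      show "(G has_field_derivative deriv F w + 2 * w - deriv F 0) (at w within cball 0 (cmod y))"
      proof -
        have "((\<lambda>w. w\<^sup>2) has_field_derivative 2 * w) (at w)" by (auto intro!: derivative_eq_intros)
        then have "(G has_field_derivative deriv F w + 2 * w - deriv F 0 * 1) (at w)"
          unfolding G_def by (intro DERIV_diff DERIV_add DERIV_cmult DERIV_ident dF(1) wR)
        then show ?thesis by (simp add: has_field_derivative_at_within)
      qed
      show "cmod (deriv F w + 2 * w - deriv F 0) \<le> cmod y / 2"
        using L1[OF wR, of 0] w c by (auto simp: algebra_simps)
    qed (auto simp: norm_mult)
    also have "\<dots> = (cmod y)\<^sup>2" by (simp add: norm_mult power2_eq_square)
    also have "G (\<i> * y) - G (- \<i> * y) = (?E 0 y - deriv F 0) * (2 * \<i> * y)"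
      using False by (simp add: G_def odd_quotient_def field_simps power2_eq_square)
    finally have "cmod (?E 0 y - deriv F 0) * 2 * cmod y \<le> cmod y * cmod y"
      by (simp add: norm_mult power2_eq_square)
    then have "cmod (?E 0 y - deriv F 0) \<le> cmod y / 2" using False by (simp add: field_simps)
    then show ?thesis using norm_triangle_ineq2[of "?E 0 y" "deriv F 0"] by linarith
  qed (simp add: odd_quotient_def)
  have L3: "cmod (?E x y - ?E x' y + 2 * (x - x')) \<le> 1/2 * cmod (x - x')"
    if x: "x \<in> cball 0 c" "x' \<in> cball 0 c" and y: "y \<in> ball 0 c" for x x' y
  proof (cases "y = 0")
    case True
    then show ?thesis using L1[of x x'] in_ball[OF x(1) y] in_ball[OF x(2) y] by (simp add: odd_quotient_def)
  next
    case False
    define G where "G w = F (w + \<i> * y) - F (w - \<i> * y) + 4 * \<i> * y * w" for w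
    have "cmod (G x - G x') \<le> cmod y * cmod (x - x')"
    proof (rule field_differentiable_bound[of "cball 0 c" _ "\<lambda>w. deriv F (w + \<i> * y) - deriv F (w - \<i> * y) + 4 * \<i> * y"])
      fix w :: complex assume w: "w \<in> cball 0 c"
      note wR = in_ball[OF w y]
      have d: "((\<lambda>w. w + \<i> * y) has_field_derivative 1) (at w)" "((\<lambda>w. w - \<i> * y) has_field_derivative 1) (at w)"
        by (auto intro!: derivative_eq_intros)
      have "(G has_field_derivative deriv F (w + \<i> * y) * 1 - deriv F (w - \<i> * y) * 1 + 4 * \<i> * y * 1) (at w)"
        unfolding G_def
        by (intro DERIV_diff DERIV_add DERIV_cmult DERIV_ident DERIV_chain2[OF dF(1)[OF wR(1)] d(1)]
            DERIV_chain2[OF dF(1)[OF wR(2)] d(2)])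
      then show "(G has_field_derivative deriv F (w + \<i> * y) - deriv F (w - \<i> * y) + 4 * \<i> * y) (at w within cball 0 c)"
        by (simp add: has_field_derivative_at_within)
      show "cmod (deriv F (w + \<i> * y) - deriv F (w - \<i> * y) + 4 * \<i> * y) \<le> cmod y"
        using L1[OF wR] by (simp add: norm_mult algebra_simps)
    qed (use x in auto)
    moreover have "G x - G x' = (?E x y - ?E x' y + 2 * (x - x')) * (2 * \<i> * y)"
      using False by (simp add: G_def odd_quotient_def field_simps)
    moreover have "cmod (w * (2 * \<i> * y)) = cmod y * (2 * cmod w)" for w by (simp add: norm_mult)
    ultimately have "cmod y * (2 * cmod (?E x y - ?E x' y + 2 * (x - x'))) \<le> cmod y * cmod (x - x')"
      by simp
    then have "2 * cmod (?E x y - ?E x' y + 2 * (x - x')) \<le> cmod (x - x')"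
      using False mult_le_cancel_left_pos[of "cmod y"] by simp
    then show ?thesis by simp
  qed
  define T where "T y x = x + ?E x y / 2" for y x
  have T: "cmod (T y x - T y x') \<le> 1/4 * cmod (x - x')"
    if "x \<in> cball 0 c" "x' \<in> cball 0 c" "y \<in> ball 0 c" for x x' y
  proof -
    have "T y x - T y x' = (?E x y - ?E x' y + 2 * (x - x')) / 2" by (simp add: T_def field_simps)
    then have "cmod (T y x - T y x') = cmod (?E x y - ?E x' y + 2 * (x - x')) / 2"
      by (simp only: norm_divide norm_numeral)
    then show ?thesis using L3[OF that] by linarith
  qed
  let ?B = "cball (0::complex) (5/8 * c)"
  have B: "?B \<subseteq> cball 0 c" using c by (intro subset_cball) auto
  have TB: "T y x \<in> ?B" if "x \<in> ?B" and y: "y \<in> ball 0 c" for x y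
  proof -
    have "cmod (T y 0) \<le> 3/8 * c" using L2[OF y] F1 y by (simp add: T_def norm_divide)
    moreover have "cmod (T y x - T y 0) \<le> 1/4 * (5/8 * c)" using T[of x 0 y] that B c by auto
    ultimately have "cmod (T y x) \<le> 3/8 * c + 1/4 * (5/8 * c)"
      using norm_triangle_ineq2[of "T y x" "T y 0"] by linarith
    then show ?thesis using c by simp
  qed
  have "\<exists>!x\<in>?B. T y x = x" if y: "y \<in> ball 0 c" for y
  proof (rule Banach_fix[of ?B "1/4"])
    show "complete ?B" by (simp add: complete_eq_closed)
    show "dist (T y x) (T y x') \<le> 1/4 * dist x x'" if "x \<in> ?B" "x' \<in> ?B" for x x'
      unfolding dist_norm using that B by (intro T y) auto
  qed (use c TB y in auto)
  then obtain \<xi> where \<xi>: "\<And>y. y \<in> ball 0 c \<Longrightarrow> \<xi> y \<in> ?B" "\<And>y. y \<in> ball 0 c \<Longrightarrow> T y (\<xi> y) = \<xi> y"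
    by metis
  have \<xi>c: "\<xi> y \<in> cball 0 c" "cmod (\<xi> y) < c" if "y \<in> ball 0 c" for y
  proof -
    have "cmod (\<xi> y) \<le> 5/8 * c" using \<xi>(1)[OF that] by simp
    then show "cmod (\<xi> y) < c" using c by linarith
    then show "\<xi> y \<in> cball 0 c" by simp
  qed
  have \<xi>0: "?E (\<xi> y) y = 0" if "y \<in> ball 0 c" for y
    using \<xi>(2)[OF that] by (simp add: T_def)
  have uniq: "x = \<xi> y" if "x \<in> cball 0 c" "y \<in> ball 0 c" "?E x y = 0" for x y
  proof -
    have "cmod (2 * (x - \<xi> y)) \<le> 1/2 * cmod (x - \<xi> y)"
      using L3[OF that(1) \<xi>c(1)[OF that(2)] that(2)] \<xi>0[OF that(2)] that(3) by simp
    moreover have "cmod (2 * w) = 2 * cmod w" for w :: complex by (simp add: norm_mult)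
    ultimately have "2 * cmod (x - \<xi> y) \<le> 1/2 * cmod (x - \<xi> y)" by metis
    then have "cmod (x - \<xi> y) \<le> 0" by linarith
    then show ?thesis by simp
  qed
  \<comment> \<open>The fixed points were obtained separately for each \<open>y\<close>; holomorphy comes from the iterates.\<close>
  define it where "it k y = (T y ^^ k) 0" for k y
  have itS: "it (Suc k) y = it k y + ?E (it k y) y / 2" for k y by (simp add: it_def T_def)
  have itB: "it k y \<in> ?B" if "y \<in> ball 0 c" for k y
    by (induction k) (use c TB that in \<open>auto simp: it_def\<close>)
  have it_conv: "cmod (it k y - \<xi> y) \<le> c * (1/4) ^ k" if y: "y \<in> ball 0 c" for k y
  proof (induction k)
    case 0
    then show ?case using \<xi>c(2)[OF y] by (simp add: it_def)
  next
    case (Suc k)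
    have "it (Suc k) y - \<xi> y = T y (it k y) - T y (\<xi> y)" using \<xi>(2)[OF y] by (simp add: it_def)
    then have "cmod (it (Suc k) y - \<xi> y) \<le> 1/4 * cmod (it k y - \<xi> y)"
      using T[of "it k y" "\<xi> y" y] itB[OF y, of k] B \<xi>c(1)[OF y] y by auto
    then show ?case using Suc by simp
  qed
  have it_hol: "it k holomorphic_on ball 0 c" for k
  proof (induction k)
    case 0
    then show ?case by (simp add: it_def[abs_def])
  next
    case (Suc k)
    have "cmod (it k y) < c" if "y \<in> ball 0 c" for y using itB[OF that, of k] c by auto
    then have "(\<lambda>y. it k y + ?E (it k y) y / 2) holomorphic_on ball 0 c"
      by (intro holomorphic_intros Suc holomorphic_odd_quotient[OF F c]) auto
    then show ?case by (simp add: itS[abs_def])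
  qed
  have \<xi>_hol: "\<xi> holomorphic_on ball 0 c"
  proof (rule holomorphic_uniform_sequence[where f = it])
    fix y :: complex assume "y \<in> ball 0 c"
    then obtain d where d: "d > 0" "cball y d \<subseteq> ball 0 c"
      by (meson open_ball open_contains_cball)
    have "uniform_limit (cball y d) it \<xi> sequentially"
    proof (rule uniform_limitI)
      fix e :: real assume "e > 0"
      have "(\<lambda>k. c * (1/4) ^ k) \<longlonglongrightarrow> c * 0"
        by (intro tendsto_intros LIMSEQ_power_zero) auto
      then have "\<forall>\<^sub>F k in sequentially. c * (1/4) ^ k < e"
        by (rule order_tendstoD(2)) (use \<open>e > 0\<close> in simp)
      then show "\<forall>\<^sub>F k in sequentially. \<forall>x\<in>cball y d. dist (it k x) (\<xi> x) < e"
      proof eventually_elim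
        case (elim k)
        show ?case
        proof
          fix x assume "x \<in> cball y d"
          then have "x \<in> ball 0 c" using d(2) by blast
          from it_conv[OF this, of k] elim show "dist (it k x) (\<xi> x) < e"
            unfolding dist_norm by linarith
        qed
      qed
    qed
    then show "\<exists>d>0. cball y d \<subseteq> ball 0 c \<and> uniform_limit (cball y d) it \<xi> sequentially"
      using d by blast
  qed (use it_hol in auto)
  have even: "\<xi> (- y) = \<xi> y" if "y \<in> ball 0 c" for y
    using uniq[of "\<xi> (- y)" y] \<xi>c(1)[of "- y"] \<xi>0[of "- y"] that by (simp add: odd_quotient_minus)
  have \<xi>_real: "\<xi> (of_real t) \<in> \<real>" if t: "\<bar>t\<bar> < c" for t
  proof -
    have tb: "of_real t \<in> ball (0::complex) c" using t by simp
    let ?x = "\<xi> (of_real t)"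
    have "?E (cnj ?x) (of_real t) = cnj (?E ?x (of_real t))"
    proof (cases "t = 0")
      case True
      \<comment> \<open>Here the quotient is the derivative of \<open>F\<close>, which inherits the symmetry.\<close>
      have xR: "?x \<in> ball 0 R" using \<xi>c(2)[OF tb] c by simp
      have "((cnj \<circ> F \<circ> cnj) has_field_derivative cnj (deriv F ?x)) (at (cnj ?x))"
        using dF(1)[OF xR] by (intro has_field_derivative_cnj_cnj) auto
      then have "(F has_field_derivative cnj (deriv F ?x)) (at (cnj ?x))"
      proof (rule DERIV_cong_ev[THEN iffD1, rotated -1])
        have "\<forall>\<^sub>F w in nhds (cnj ?x). w \<in> ball 0 R"
          using xR by (intro eventually_nhds_in_open) auto
        then show "\<forall>\<^sub>F w in nhds (cnj ?x). (cnj \<circ> F \<circ> cnj) w = F w"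
          by eventually_elim (use sym in auto)
      qed auto
      then show ?thesis using True by (simp add: odd_quotient_def DERIV_imp_deriv)
    next
      case False
      have "F (cnj ?x + \<i> * of_real t) = cnj (F (?x - \<i> * of_real t))"
        "F (cnj ?x - \<i> * of_real t) = cnj (F (?x + \<i> * of_real t))"
        using sym[OF in_ball(2)[OF \<xi>c(1)[OF tb] tb]] sym[OF in_ball(1)[OF \<xi>c(1)[OF tb] tb]] by auto
      then show ?thesis using False by (simp add: odd_quotient_def field_simps)
    qed
    then have "cnj ?x = ?x"
      using \<xi>0[OF tb] uniq[of "cnj ?x" "of_real t"] \<xi>c(1)[OF tb] tb by simp
    then show ?thesis by (simp add: Reals_cnj_iff)
  qed
  have level: "F (Complex s t) \<in> \<real> \<longleftrightarrow> of_real s = \<xi> (of_real t)"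
    if s: "\<bar>s\<bar> < c" and t: "\<bar>t\<bar> < c" "t \<noteq> 0" for s t
  proof -
    have C: "Complex s t = of_real s + \<i> * of_real t" by (simp add: complex_eq_iff)
    have sb: "of_real s \<in> cball (0::complex) c" and tb: "of_real t \<in> ball (0::complex) c" using s t by auto
    have "cnj (F (Complex s t)) = F (of_real s - \<i> * of_real t)"
      unfolding C using sym[OF in_ball(1)[OF sb tb]] by simp
    then have "F (Complex s t) \<in> \<real> \<longleftrightarrow> ?E (of_real s) (of_real t) = 0"
      using t by (auto simp: Reals_cnj_iff odd_quotient_def C)
    then show ?thesis using uniq[OF sb tb] \<xi>0[OF tb] by metis
  qed
  have "deriv F (\<xi> 0) = 0" using \<xi>0[of 0] c by (simp add: odd_quotient_def)
  with that[OF \<xi>_hol \<xi>c(2) \<xi>_real even level] show thesis by blast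
qed

section \<open>Real analytic functions, Cauchy estimates and zeros\<close>

lemma real_analytic_on_of_holomorphic:
  assumes "f holomorphic_on ball 0 e"
  shows "real_analytic_on (\<lambda>t. f (of_real t)) {-e<..<e}"
  unfolding real_analytic_on_def
proof
  fix x assume x: "x \<in> {-e<..<e}"
  define r where "r = e - \<bar>x\<bar>"
  have sub: "ball (of_real x) r \<subseteq> ball (0::complex) e"
    by (simp add: ball_subset_ball_iff r_def dist_norm)
  have hol: "f holomorphic_on ball (of_real x) r"
    using assms sub holomorphic_on_subset by blast
  define a where "a k = (deriv ^^ k) f (of_real x) / fact k" for k
  have "(\<lambda>k. (y - x) ^ k *\<^sub>R a k) sums f (of_real y)" if "\<bar>y - x\<bar> < r" for y
  proof -
    have "complex_of_real y \<in> ball (of_real x) r"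
      using that unfolding mem_ball dist_of_real dist_real_def by simp
    from holomorphic_power_series[OF hol this] show ?thesis
      by (simp add: a_def scaleR_conv_of_real mult.commute)
  qed
  moreover have "r > 0" using x by (auto simp: r_def)
  ultimately show "\<exists>r>0. \<exists>a. \<forall>y. \<bar>y - x\<bar> < r \<longrightarrow> (\<lambda>k. (y - x) ^ k *\<^sub>R a k) sums f (of_real y)"
    by blast
qed

lemma real_analytic_on_cong:
  assumes "real_analytic_on f S" "open S" "\<And>x. x \<in> S \<Longrightarrow> f x = g x"
  shows "real_analytic_on g S"
  unfolding real_analytic_on_def
proof
  fix x assume x: "x \<in> S"
  then obtain r a where r: "r > 0" "\<And>y. \<bar>y - x\<bar> < r \<Longrightarrow> (\<lambda>k. (y - x) ^ k *\<^sub>R a k) sums f y"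
    using assms(1) unfolding real_analytic_on_def by blast
  obtain d where d: "d > 0" "ball x d \<subseteq> S"
    using assms(2) x open_contains_ball by blast
  have "(\<lambda>k. (y - x) ^ k *\<^sub>R a k) sums g y" if "\<bar>y - x\<bar> < min r d" for y
  proof -
    have "y \<in> S" using that d by (auto simp: dist_real_def abs_minus_commute subset_iff)
    then show ?thesis using r(2)[of y] that assms(3)[of y] by simp
  qed
  then show "\<exists>r>0. \<exists>a. \<forall>y. \<bar>y - x\<bar> < r \<longrightarrow> (\<lambda>k. (y - x) ^ k *\<^sub>R a k) sums g y"
    using r(1) d(1) by (intro exI[of _ "min r d"]) auto
qed

lemma real_analytic_on_ident: "real_analytic_on (\<lambda>t::real. t) S"
  unfolding real_analytic_on_def
proof
  fix x :: real
  define a :: "nat \<Rightarrow> real" where "a k = (if k = 0 then x else if k = 1 then 1 else 0)" for k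
  have "(\<lambda>k. (y - x) ^ k *\<^sub>R a k) sums y" for y
  proof -
    have "(\<lambda>k. (y - x) ^ k *\<^sub>R a k) sums (\<Sum>k\<in>{0,1}. (y - x) ^ k *\<^sub>R a k)"
      by (rule sums_finite) (auto simp: a_def)
    then show ?thesis by (simp add: a_def)
  qed
  then show "\<exists>r>0. \<exists>a. \<forall>y. \<bar>y - x\<bar> < r \<longrightarrow> (\<lambda>k. (y - x) ^ k *\<^sub>R a k) sums y"
    by (intro exI[of _ 1] conjI exI[of _ a]) auto
qed

lemma norm_sin_le_small:
  fixes u :: complex
  assumes "cmod u \<le> 2/5"
  shows "cmod (sin u) \<le> 6/5 * cmod u"
proof -
  have "cmod (sin u - sin 0) \<le> 6/5 * cmod (u - 0)"
  proof (rule field_differentiable_bound[of "cball 0 (2/5)" sin cos])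
    show "(sin has_field_derivative cos w) (at w within cball 0 (2/5))" for w :: complex
      by (auto intro!: derivative_eq_intros)
    fix w :: complex assume "w \<in> cball 0 (2/5)"
    then have y: "\<bar>Im w\<bar> \<le> 2/5" using abs_Im_le_cmod[of w] by simp
    define b where "b = exp \<bar>Im w\<bar>"
    have b: "1 \<le> b" "b \<le> 39/25"
    proof -
      have "b \<le> 1 + \<bar>Im w\<bar> + \<bar>Im w\<bar>\<^sup>2" unfolding b_def using y by (intro exp_bound) auto
      also have "\<dots> \<le> 1 + 2/5 + (2/5)\<^sup>2" using y by (intro add_mono power_mono) auto
      finally show "b \<le> 39/25" by (simp add: power2_eq_square)
      show "1 \<le> b" by (simp add: b_def)
    qed
    have ib: "3/5 \<le> inverse b" "inverse b \<le> 1"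
      using b le_imp_inverse_le[of b "39/25"] le_imp_inverse_le[of 1 b] by auto
    have "(exp (Im w) - inverse (exp (Im w)))\<^sup>2 = (b - inverse b)\<^sup>2"
      by (cases "Im w \<ge> 0") (auto simp: b_def exp_minus power2_commute)
    also have "\<dots> \<le> 1\<^sup>2"
      using b ib by (intro power_mono) linarith+
    finally have "(exp (Im w) - inverse (exp (Im w)))\<^sup>2 \<le> 1" by (simp only: power_one)
    moreover have "(cos (Re w))\<^sup>2 \<le> 1" by (simp add: cos_squared_eq)
    ultimately have "(cmod (cos w))\<^sup>2 \<le> 1 + 1 / 4"
      unfolding norm_cos_squared by linarith
    also have "\<dots> \<le> (6/5)\<^sup>2" by (simp add: power2_eq_square)
    finally show "cmod (cos w) \<le> 6/5" by (rule power2_le_imp_le) simp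
  qed (use assms in auto)
  then show ?thesis by simp
qed

text \<open>
  The factor \<open>18/25\<close> is a crude version of \<open>1/2\<close>. It keeps \<open>\<bar>cos w - 1\<bar>\<close> below \<open>1/2\<close> on the disc of
  radius \<open>\<pi>/4\<close>, as is needed for a contraction on all of this disc.
\<close>
lemma norm_cos_minus_one_le_small:
  fixes w :: complex
  assumes "cmod w \<le> 4/5"
  shows "cmod (cos w - 1) \<le> 18/25 * (cmod w)\<^sup>2"
proof -
  have "cos w = 1 - 2 * (sin (w / 2))\<^sup>2"
    using cos_double_sin[of "w / 2"] by simp
  then have "cmod (cos w - 1) = 2 * (cmod (sin (w / 2)))\<^sup>2"
    by (simp add: norm_mult norm_power)
  also have "\<dots> \<le> 2 * (6/5 * cmod (w / 2))\<^sup>2"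
    using assms by (intro mult_left_mono power_mono norm_sin_le_small) (auto simp: norm_divide)
  finally show ?thesis by (simp add: norm_divide power2_eq_square)
qed

text \<open>
  Cauchy's inequalities for the difference of the two functions.
\<close>
lemma derivatives_close:
  assumes F: "F holomorphic_on S" "G holomorphic_on S" and S: "open S" "cball w r \<subseteq> S" "r > 0"
    and close: "\<And>z. z \<in> S \<Longrightarrow> cmod (F z - G z) \<le> \<eta>"
  shows "cmod (deriv F w - deriv G w) \<le> \<eta> / r"
    "cmod (deriv (deriv F) w - deriv (deriv G) w) \<le> 2 * \<eta> / r\<^sup>2"
proof -
  define E where "E z = F z - G z" for z
  have E: "E holomorphic_on S" unfolding E_def by (intro holomorphic_on_diff F)
  have w: "w \<in> S" using S(2,3) by auto
  have dE: "deriv E z = deriv F z - deriv G z" if "z \<in> S" for z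
    unfolding E_def using F S(1) that by (intro deriv_diff) (auto intro: holomorphic_on_imp_differentiable_at)
  have "(deriv F has_field_derivative deriv (deriv F) w) (at w)" "(deriv G has_field_derivative deriv (deriv G) w) (at w)"
    using holomorphic_derivI[OF holomorphic_deriv[OF F(1) S(1)] S(1) w]
      holomorphic_derivI[OF holomorphic_deriv[OF F(2) S(1)] S(1) w] by auto
  then have "((\<lambda>z. deriv F z - deriv G z) has_field_derivative deriv (deriv F) w - deriv (deriv G) w) (at w)"
    by (rule DERIV_diff)
  then have "(deriv E has_field_derivative deriv (deriv F) w - deriv (deriv G) w) (at w)"
    by (rule has_field_derivative_transform_within_open) (use S(1) w dE in auto)
  then have ddE: "deriv (deriv E) w = deriv (deriv F) w - deriv (deriv G) w"
    by (rule DERIV_imp_deriv)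
  have *: "cmod ((deriv ^^ k) E w) \<le> fact k * \<eta> / r ^ k" for k
  proof (rule Cauchy_inequality)
    show "E holomorphic_on ball w r"
      using E S(2) ball_subset_cball holomorphic_on_subset by blast
    show "continuous_on (cball w r) E"
      using E S(2) holomorphic_on_imp_continuous_on continuous_on_subset by blast
    show "cmod (E x) \<le> \<eta>" if "cmod (w - x) = r" for x
      using close[of x] S(2) that by (auto simp: E_def dist_norm)
  qed (use S in auto)
  show "cmod (deriv F w - deriv G w) \<le> \<eta> / r"
    "cmod (deriv (deriv F) w - deriv (deriv G) w) \<le> 2 * \<eta> / r\<^sup>2"
    using *[of 1] *[of 2] by (auto simp: dE[OF w] ddE numeral_2_eq_2)
qed

text \<open>
  The map \<open>w \<mapsto> w + g w / 2\<close> is a contraction with constant \<open>1/2\<close> and its fixed points are the zeros of \<open>g\<close>.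
\<close>
lemma unique_zero_in_ball:
  fixes g :: "complex \<Rightarrow> complex"
  assumes g: "\<And>w. w \<in> ball 0 \<rho> \<Longrightarrow> (g has_field_derivative g' w) (at w)"
    and g': "\<And>w. w \<in> ball 0 \<rho> \<Longrightarrow> cmod (g' w + 2) \<le> 1" and g0: "2 * cmod (g 0) < \<rho>"
  shows "\<exists>!w. w \<in> ball 0 \<rho> \<and> g w = 0"
proof -
  define T where "T w = w + g w / 2" for w
  have \<rho>: "\<rho> > 0" using g0 norm_ge_zero[of "g 0"] by linarith
  have T: "cmod (T x - T y) \<le> 1/2 * cmod (x - y)" if "x \<in> ball 0 \<rho>" "y \<in> ball 0 \<rho>" for x y
  proof (rule field_differentiable_bound[of "ball 0 \<rho>" T "\<lambda>w. 1 + g' w / 2"])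
    fix w :: complex assume w: "w \<in> ball 0 \<rho>"
    have "(T has_field_derivative 1 + g' w / 2) (at w)"
      unfolding T_def by (intro DERIV_add DERIV_ident DERIV_cdivide g w)
    then show "(T has_field_derivative 1 + g' w / 2) (at w within ball 0 \<rho>)"
      by (rule has_field_derivative_at_within)
    have "1 + g' w / 2 = (g' w + 2) / 2" by (simp add: field_simps)
    then have "cmod (1 + g' w / 2) = cmod (g' w + 2) / 2" by (simp only: norm_divide norm_numeral)
    then show "cmod (1 + g' w / 2) \<le> 1/2" using g'[OF w] by simp
  qed (use that in auto)
  define B where "B = cball (0::complex) (cmod (g 0))"
  have B: "B \<subseteq> ball 0 \<rho>" using g0 \<rho> by (auto simp: B_def)
  have "\<exists>!w\<in>B. T w = w"
  proof (rule Banach_fix[of B "1/2"])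
    show "complete B" by (simp add: B_def complete_eq_closed)
    show "dist (T x) (T y) \<le> 1/2 * dist x y" if "x \<in> B" "y \<in> B" for x y
      unfolding dist_norm using that B by (intro T) auto
    show "T ` B \<subseteq> B"
    proof
      fix y assume "y \<in> T ` B"
      then obtain x where x: "x \<in> B" "y = T x" by blast
      have "cmod (T x - T 0) \<le> 1/2 * cmod (g 0)"
        using T[of x 0] x B \<rho> by (force simp: B_def)
      moreover have "cmod (T 0) = cmod (g 0) / 2" by (simp add: T_def norm_divide)
      ultimately show "y \<in> B" using norm_triangle_ineq2[of "T x" "T 0"] x by (simp add: B_def)
    qed
  qed (auto simp: B_def)
  then obtain w where "w \<in> B" "T w = w" by blast
  then have "w \<in> ball 0 \<rho> \<and> g w = 0" using B by (auto simp: T_def)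
  moreover have "x = y" if "x \<in> ball 0 \<rho> \<and> g x = 0" "y \<in> ball 0 \<rho> \<and> g y = 0" for x y
    using T[of x y] that by (simp add: T_def)
  ultimately show ?thesis by blast
qed

section \<open>Critical points of functions close to \<open>2 cos (2 z\<^sup>2)\<close>\<close>

lemma cos_int_pi_add: "cos (of_real (real n * pi) + w) = (-1) ^ n * cos (w :: complex)"
proof -
  have "cos (of_real (real n * pi)) = ((-1) ^ n :: complex)"
    by (simp only: cos_of_real cos_npi) simp
  moreover have "sin (complex_of_real (real n * pi)) = 0"
    by (simp only: sin_of_real sin_npi) simp
  ultimately show ?thesis by (simp only: cos_add) simp
qed

lemma Re_csqrt_pos: "Re x > 0 \<Longrightarrow> Re (csqrt x) > 0"
  by (simp add: add_nonneg_pos)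

text \<open>
  On the set in question \<open>z\<close> may be replaced by the coordinate \<open>w = 2 z\<^sup>2 - n \<pi>\<close>, with inverse
  \<open>L w = s csqrt ((n \<pi> + w) / 2)\<close> whose derivative has no zeros. In this coordinate \<open>h\<close> is, up to the sign
  \<open>(-1)\<^sup>n\<close>, close to \<open>2 cos w\<close> on a disc of radius 2, and the derivative of \<open>2 cos w\<close> has the nondegenerate zero \<open>0\<close>.
\<close>
lemma unique_critical_point:
  fixes h :: "complex \<Rightarrow> complex"
  assumes n: "n > 0" and s: "s = 1 \<or> s = -1"
    and h: "h holomorphic_on UNIV"
    and close: "\<And>z. cmod z \<ge> 1/2 \<Longrightarrow> \<bar>Im (2 * z\<^sup>2)\<bar> \<le> 2 \<Longrightarrow> cmod (h z - 2 * cos (2 * z\<^sup>2)) \<le> 1/200"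
  shows "\<exists>!z. cmod (2 * z\<^sup>2 - of_real (real n * pi)) < pi / 4 \<and> s * Re z > 0 \<and> deriv h z = 0"
proof -
  let ?a = "complex_of_real (real n * pi)"
  have npi: "real n * pi > 3"
  proof -
    have "1 * pi \<le> real n * pi" using n by (intro mult_right_mono) auto
    then show ?thesis using pi_gt3 by linarith
  qed
  define L where "L w = of_real s * csqrt ((?a + w) / 2)" for w
  have pos: "Re ((?a + w) / 2) > 0" if "w \<in> ball 0 2" for w
    using npi that abs_Re_le_cmod[of w] by auto
  have L2: "2 * (L w)\<^sup>2 = ?a + w" for w
    using s by (auto simp: L_def power_mult_distrib)
  have ReL: "s * Re (L w) > 0" if "w \<in> ball 0 2" for w
  proof -
    have "Re (csqrt ((?a + w) / 2)) > 0"
      using pos[OF that] Re_csqrt_pos by blast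
    then show ?thesis using s by (auto simp: L_def)
  qed
  have L_hol: "L holomorphic_on ball 0 2"
    unfolding L_def
  proof (intro holomorphic_on_mult holomorphic_on_const holomorphic_on_csqrt' holomorphic_on_divide
      holomorphic_on_add holomorphic_on_ident)
    fix w :: complex assume "w \<in> ball 0 2"
    from pos[OF this] show "(?a + w) / 2 \<notin> \<real>\<^sub>\<le>\<^sub>0" by (metis complex_nonpos_Reals_iff not_le)
  qed auto
  have dL: "(L has_field_derivative deriv L w) (at w)" if "w \<in> ball 0 2" for w
    by (rule holomorphic_derivI[OF L_hol open_ball that])
  have dL0: "deriv L w \<noteq> 0" if w: "w \<in> ball 0 2" for w
  proof
    assume 0: "deriv L w = 0"
    have "((\<lambda>w. 2 * (L w)\<^sup>2) has_field_derivative 0) (at w)"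
      using dL[OF w] unfolding 0 by (auto intro!: derivative_eq_intros)
    moreover have "((\<lambda>w. 2 * (L w)\<^sup>2) has_field_derivative 1) (at w)"
      unfolding L2 by (auto intro!: derivative_eq_intros)
    ultimately show False using DERIV_unique by fastforce
  qed
  define \<sigma> :: complex where "\<sigma> = (-1) ^ n"
  have \<sigma>: "cmod \<sigma> = 1" "\<sigma> * \<sigma> = 1"
    by (auto simp: \<sigma>_def norm_power simp flip: power_mult_distrib)
  define f where "f w = \<sigma> * h (L w)" for w
  define G :: "complex \<Rightarrow> complex" where "G w = 2 * cos w" for w
  have dh: "(h has_field_derivative deriv h z) (at z)" for z
    by (rule holomorphic_derivI[OF h]) auto
  have df: "(f has_field_derivative \<sigma> * (deriv h (L w) * deriv L w)) (at w)" if "w \<in> ball 0 2" for w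
    unfolding f_def by (intro DERIV_cmult DERIV_chain2[OF dh dL] that)
  have f_hol: "f holomorphic_on ball 0 2"
    using df by (intro holomorphic_onI) (meson field_differentiable_at_within field_differentiable_def)
  have G_hol: "G holomorphic_on ball 0 2"
    unfolding G_def by (intro holomorphic_on_mult holomorphic_on_const holomorphic_on_cos holomorphic_on_ident)
  have fG: "cmod (f w - G w) \<le> 1/200" if w: "w \<in> ball 0 2" for w
  proof -
    have "cmod ?a = real n * pi" by (simp only: norm_of_real) simp
    moreover have "cmod w < 2" using w by simp
    ultimately have "cmod (2 * (L w)\<^sup>2) \<ge> 1"
      unfolding L2 using norm_diff_ineq[of ?a w] npi by linarith
    then have "(cmod (L w))\<^sup>2 \<ge> (1/2)\<^sup>2"
      by (simp add: norm_mult norm_power power2_eq_square)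
    then have "cmod (L w) \<ge> 1/2" by (rule power2_le_imp_le) simp
    moreover have "\<bar>Im (2 * (L w)\<^sup>2)\<bar> \<le> 2"
      unfolding L2 using w abs_Im_le_cmod[of w] by simp
    ultimately have "cmod (h (L w) - 2 * cos (2 * (L w)\<^sup>2)) \<le> 1/200" by (rule close)
    moreover have "f w - G w = \<sigma> * (h (L w) - 2 * cos (2 * (L w)\<^sup>2))"
    proof -
      have "2 * cos (2 * (L w)\<^sup>2) = \<sigma> * G w" unfolding L2 cos_int_pi_add G_def \<sigma>_def by simp
      then show ?thesis using \<sigma>(2) unfolding f_def by (simp add: right_diff_distrib flip: mult.assoc)
    qed
    ultimately show ?thesis using \<sigma>(1) by (simp add: norm_mult)
  qed
  have G1: "deriv G = (\<lambda>w. - 2 * sin w)"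
    unfolding G_def by (intro ext DERIV_imp_deriv) (auto intro!: derivative_eq_intros)
  have G2: "deriv (deriv G) = (\<lambda>w. - 2 * cos w)"
    unfolding G1 by (intro ext DERIV_imp_deriv) (auto intro!: derivative_eq_intros)
  have pi8: "pi / 4 < 4/5" using pi_less_4 pi_approx by simp
  have sub: "cball w 1 \<subseteq> ball 0 2" if "w \<in> ball 0 (pi/4)" for w :: complex
    using that pi8 by (simp add: cball_subset_ball_iff)
  note cl = derivatives_close[OF f_hol G_hol open_ball sub zero_less_one fG]
  have "\<exists>!w. w \<in> ball 0 (pi/4) \<and> deriv f w = 0"
  proof (rule unique_zero_in_ball)
    fix w :: complex assume w: "w \<in> ball 0 (pi/4)"
    then have w': "cmod w \<le> 4/5" "w \<in> ball 0 2" using pi8 by auto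
    show "(deriv f has_field_derivative deriv (deriv f) w) (at w)"
      by (rule holomorphic_derivI[OF holomorphic_deriv[OF f_hol open_ball] open_ball w'(2)])
    have 1: "cmod (deriv (deriv f) w - (- 2 * cos w)) \<le> 1/100" using cl(2)[OF w] unfolding G2 by simp
    have "18/25 * (cmod w)\<^sup>2 \<le> 18/25 * (4/5)\<^sup>2" using w' by (intro mult_left_mono power_mono) auto
    then have "cmod (cos w - 1) \<le> 1/2 - 1/50"
      using norm_cos_minus_one_le_small[OF w'(1)] by (simp add: power2_eq_square)
    moreover have "cmod (2 * (cos w - 1)) = 2 * cmod (cos w - 1)" by (simp only: norm_mult norm_numeral)
    moreover have "deriv (deriv f) w + 2 = (deriv (deriv f) w - (- 2 * cos w)) - 2 * (cos w - 1)"
      by (simp add: algebra_simps)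
    then have "cmod (deriv (deriv f) w + 2) \<le> cmod (deriv (deriv f) w - (- 2 * cos w)) + cmod (2 * (cos w - 1))"
      using norm_triangle_ineq4 by metis
    ultimately show "cmod (deriv (deriv f) w + 2) \<le> 1" using 1 by linarith
  next
    have "cmod (deriv f 0) \<le> 1/200" using cl(1)[of 0] by (simp add: G1)
    then show "2 * cmod (deriv f 0) < pi / 4" using pi_gt3 by linarith
  qed
  then obtain w where w: "w \<in> ball 0 (pi/4)" "deriv f w = 0"
    and w_uniq: "\<And>v. v \<in> ball 0 (pi/4) \<Longrightarrow> deriv f v = 0 \<Longrightarrow> v = w" by metis
  have crit: "deriv f v = 0 \<longleftrightarrow> deriv h (L v) = 0" if "v \<in> ball 0 (pi/4)" for v
  proof -
    have v: "v \<in> ball 0 2" using that pi8 by auto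
    show ?thesis using DERIV_imp_deriv[OF df[OF v]] dL0[OF v] \<sigma>(1) by auto
  qed
  show ?thesis
  proof (rule ex1I[of _ "L w"])
    have "w \<in> ball 0 2" using w pi8 by auto
    then show "cmod (2 * (L w)\<^sup>2 - ?a) < pi / 4 \<and> s * Re (L w) > 0 \<and> deriv h (L w) = 0"
      using w crit ReL by (simp add: L2)
    fix z assume z: "cmod (2 * z\<^sup>2 - ?a) < pi / 4 \<and> s * Re z > 0 \<and> deriv h z = 0"
    let ?v = "2 * z\<^sup>2 - ?a"
    have v: "?v \<in> ball 0 (pi/4)" using z by simp
    then have "?v \<in> ball 0 2" using pi8 by auto
    from ReL[OF this] have "s * Re (L ?v) > 0" .
    moreover have "(L ?v)\<^sup>2 = z\<^sup>2" using L2[of ?v] by simp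
    then have "L ?v = z \<or> L ?v = - z" by (simp add: power2_eq_iff)
    ultimately have Lz: "L ?v = z" using z by auto
    then have "?v = w" using w_uniq[OF v] crit[OF v] z by simp
    then show "z = L w" using Lz by simp
  qed
qed

text \<open>
  In the affine coordinate \<open>w = 4 l (z - l)\<close> one has \<open>2 z\<^sup>2 = n \<pi> + w + \<kappa> w\<^sup>2\<close> with \<open>0 < \<kappa> \<le> 1/12\<close>. So, up to the
  sign \<open>(-1)\<^sup>n\<close>, the function \<open>h\<close> is close to \<open>2 cos (w + \<kappa> w\<^sup>2)\<close>, whose second derivative is near \<open>-2\<close> for small
  \<open>w\<close>, uniformly in \<open>\<kappa>\<close>. An affine coordinate, unlike \<open>2 z\<^sup>2 - n \<pi>\<close>, maps the rectangles to squares and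
  vertical lines to vertical lines. The half width \<open>e\<close> corresponds to \<open>1/20\<close> in the coordinate \<open>w\<close>.
\<close>
lemma arc_near_critical_point:
  fixes h :: "complex \<Rightarrow> complex" and l e :: real
  assumes n: "n > 0" and s: "s = 1 \<or> s = -1"
    and h: "h holomorphic_on UNIV"
    and close: "\<And>z. cmod z \<ge> 1/2 \<Longrightarrow> \<bar>Im (2 * z\<^sup>2)\<bar> \<le> 2 \<Longrightarrow> cmod (h z - 2 * cos (2 * z\<^sup>2)) \<le> 1/200"
    and sym: "\<And>z. h (cnj z) = cnj (h z)"
    and l: "l = s * sqrt (real n * pi / 2)" and e: "e = 1 / (80 * sqrt (real n * pi / 2))"
  obtains \<Xi> where "\<Xi> holomorphic_on ball 0 e"
    "\<forall>t. \<bar>t\<bar> < e \<longrightarrow> Im (\<Xi> (of_real t)) = t" "\<forall>t. \<bar>t\<bar> < e \<longrightarrow> \<bar>Re (\<Xi> (of_real t)) - l\<bar> < e"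
    "\<forall>t. \<bar>t\<bar> < e \<longrightarrow> Re (\<Xi> (- of_real t)) = Re (\<Xi> (of_real t))"
    "\<forall>z. \<bar>Re z - l\<bar> < e \<longrightarrow> \<bar>Im z\<bar> < e \<longrightarrow> Im z \<noteq> 0 \<longrightarrow> (h z \<in> \<real> \<longleftrightarrow> z = \<Xi> (of_real (Im z)))"
    "cmod (2 * (\<Xi> 0)\<^sup>2 - of_real (real n * pi)) < pi / 4" "s * Re (\<Xi> 0) > 0" "deriv h (\<Xi> 0) = 0"
proof -
  let ?a = "complex_of_real (real n * pi)"
  have npi: "real n * pi > 3"
  proof -
    have "1 * pi \<le> real n * pi" using n by (intro mult_right_mono) auto
    then show ?thesis using pi_gt3 by linarith
  qed
  define k where "k = 4 * l"
  have ss: "s * s = 1" using s by auto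
  have l2: "l\<^sup>2 = real n * pi / 2"
    using n s by (auto simp: l power_mult_distrib)
  have k2: "k\<^sup>2 = 8 * (real n * pi)" by (simp add: k_def power_mult_distrib l2)
  have k0: "k \<noteq> 0" using k2 npi by auto
  have absl: "\<bar>l\<bar> = sqrt (real n * pi / 2)" using s n by (auto simp: l)
  have abskl: "\<bar>k\<bar> = 4 * sqrt (real n * pi / 2)" using absl by (simp add: k_def)
  have ek: "\<bar>k\<bar> * e = 1/20"
    using n by (simp add: abskl e)
  have sl: "s * l > 0" using ss n by (simp add: l flip: mult.assoc)
  define \<kappa> where "\<kappa> = 2 / k\<^sup>2"
  have \<kappa>: "\<kappa> > 0" "\<kappa> \<le> 1/12"
    unfolding \<kappa>_def k2 using npi by (auto simp: field_simps)
  define L where "L w = of_real l + w / of_real k" for w :: complex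
  define \<theta> where "\<theta> w = w + of_real \<kappa> * w\<^sup>2" for w :: complex
  have L2: "2 * (L w)\<^sup>2 = ?a + \<theta> w" for w
  proof -
    have "2 * (L w)\<^sup>2 = of_real (2 * l\<^sup>2) + of_real (4 * l / k) * w + of_real (2 / k\<^sup>2) * w\<^sup>2"
      using k0 by (simp add: L_def power2_eq_square field_simps)
    also have "4 * l / k = 1" using k0 by (simp add: k_def)
    also have "2 * l\<^sup>2 = real n * pi" using l2 by simp
    finally show ?thesis by (simp add: \<theta>_def \<kappa>_def)
  qed
  have n\<theta>: "cmod (\<theta> w) \<le> cmod w + 1/12 * (cmod w)\<^sup>2" for w
  proof -
    have "cmod (of_real \<kappa> * w\<^sup>2) \<le> 1/12 * (cmod w)\<^sup>2"
    proof -
      have "cmod (of_real \<kappa> * w\<^sup>2) = \<kappa> * (cmod w)\<^sup>2" using \<kappa>(1) by (simp add: norm_mult norm_power)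
      also have "\<dots> \<le> 1/12 * (cmod w)\<^sup>2" by (intro mult_right_mono \<kappa>) auto
      finally show ?thesis .
    qed
    then show ?thesis unfolding \<theta>_def using norm_triangle_ineq[of w "of_real \<kappa> * w\<^sup>2"] by linarith
  qed
  define \<sigma> :: complex where "\<sigma> = (-1) ^ n"
  have \<sigma>: "cmod \<sigma> = 1" "\<sigma> * \<sigma> = 1" "cnj \<sigma> = \<sigma>" "\<sigma> \<in> \<real>" "\<sigma> \<noteq> 0"
    by (auto simp: \<sigma>_def norm_power simp flip: power_mult_distrib)
  define F where "F w = \<sigma> * h (L w)" for w
  define G where "G w = 2 * cos (\<theta> w)" for w
  have dh: "(h has_field_derivative deriv h z) (at z)" for z
    by (rule holomorphic_derivI[OF h]) auto
  have dL: "(L has_field_derivative 1 / of_real k) (at w)" for w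
    unfolding L_def using k0 by (auto intro!: derivative_eq_intros)
  have dF: "(F has_field_derivative \<sigma> * (deriv h (L w) * (1 / of_real k))) (at w)" for w
    unfolding F_def by (intro DERIV_cmult DERIV_chain2[OF dh dL])
  have F_hol: "F holomorphic_on S" for S
    using dF by (intro holomorphic_onI) (meson field_differentiable_at_within field_differentiable_def)
  have d\<theta>: "(\<theta> has_field_derivative 1 + 2 * of_real \<kappa> * w) (at w)" for w
    unfolding \<theta>_def by (auto intro!: derivative_eq_intros)
  have dG: "(G has_field_derivative 2 * (- sin (\<theta> w) * (1 + 2 * of_real \<kappa> * w))) (at w)" for w
    unfolding G_def by (intro DERIV_cmult DERIV_chain2[OF DERIV_cos d\<theta>])
  have G_hol: "G holomorphic_on S" for S
    using dG by (intro holomorphic_onI) (meson field_differentiable_at_within field_differentiable_def)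
  have G1: "deriv G = (\<lambda>w. 2 * (- sin (\<theta> w) * (1 + 2 * of_real \<kappa> * w)))"
    by (intro ext DERIV_imp_deriv dG)
  have dG1: "((\<lambda>w. 2 * (- sin (\<theta> w) * (1 + 2 * of_real \<kappa> * w))) has_field_derivative
      - 2 * cos (\<theta> w) * (1 + 2 * of_real \<kappa> * w)\<^sup>2 - 4 * of_real \<kappa> * sin (\<theta> w)) (at w)" for w
  proof -
    have "((\<lambda>w. - sin (\<theta> w)) has_field_derivative - (cos (\<theta> w) * (1 + 2 * of_real \<kappa> * w))) (at w)"
      by (intro DERIV_minus DERIV_chain2[OF DERIV_sin d\<theta>])
    moreover have "((\<lambda>w. 1 + 2 * of_real \<kappa> * w) has_field_derivative 2 * of_real \<kappa>) (at w)"
      by (auto intro!: derivative_eq_intros)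
    ultimately have "((\<lambda>w. 2 * (- sin (\<theta> w) * (1 + 2 * of_real \<kappa> * w))) has_field_derivative
      2 * (- (cos (\<theta> w) * (1 + 2 * of_real \<kappa> * w)) * (1 + 2 * of_real \<kappa> * w) + 2 * of_real \<kappa> * - sin (\<theta> w))) (at w)"
      by (intro DERIV_cmult DERIV_mult)
    then show ?thesis by (simp add: algebra_simps power2_eq_square)
  qed
  have G2: "deriv (deriv G) = (\<lambda>w. - 2 * cos (\<theta> w) * (1 + 2 * of_real \<kappa> * w)\<^sup>2 - 4 * of_real \<kappa> * sin (\<theta> w))"
    unfolding G1 by (intro ext DERIV_imp_deriv dG1)
  have FG: "cmod (F w - G w) \<le> 1/200" if w: "w \<in> ball 0 1" for w
  proof -
    have "(cmod w)\<^sup>2 \<le> 1" using w by (simp add: power_le_one)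
    then have \<theta>2: "cmod (\<theta> w) \<le> 2" using n\<theta>[of w] w by simp
    have "cmod ?a = real n * pi" by (simp only: norm_of_real) simp
    then have "cmod (2 * (L w)\<^sup>2) \<ge> 1"
      unfolding L2 using norm_diff_ineq[of ?a "\<theta> w"] npi \<theta>2 by linarith
    then have "(cmod (L w))\<^sup>2 \<ge> (1/2)\<^sup>2"
      by (simp add: norm_mult norm_power power2_eq_square)
    then have "cmod (L w) \<ge> 1/2" by (rule power2_le_imp_le) simp
    moreover have "\<bar>Im (2 * (L w)\<^sup>2)\<bar> \<le> 2"
      unfolding L2 using \<theta>2 abs_Im_le_cmod[of "\<theta> w"] by simp
    ultimately have "cmod (h (L w) - 2 * cos (2 * (L w)\<^sup>2)) \<le> 1/200" by (rule close)
    moreover have "F w - G w = \<sigma> * (h (L w) - 2 * cos (2 * (L w)\<^sup>2))"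
    proof -
      have "2 * cos (2 * (L w)\<^sup>2) = \<sigma> * G w" unfolding L2 cos_int_pi_add G_def \<sigma>_def by simp
      then show ?thesis using \<sigma>(2) unfolding F_def by (simp add: right_diff_distrib flip: mult.assoc)
    qed
    ultimately show ?thesis using \<sigma>(1) by (simp add: norm_mult)
  qed
  have sub: "cball w (1/2) \<subseteq> ball 0 1" if "w \<in> ball 0 (1/10)" for w :: complex
    using that by (simp add: cball_subset_ball_iff)
  have half: "(0::real) < 1/2" by simp
  note cl = derivatives_close[OF F_hol G_hol open_ball sub half FG]
  have F2: "cmod (deriv (deriv F) w + 2) \<le> 1/2" if w: "w \<in> ball 0 (1/10)" for w
  proof -
    define x where "x = 1 + 2 * of_real \<kappa> * w"
    have w1: "cmod w \<le> 1/10" using w by simp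
    have "(cmod w)\<^sup>2 \<le> (1/10)\<^sup>2" using w1 by (intro power_mono) auto
    then have \<theta>1: "cmod (\<theta> w) \<le> 11/100" using n\<theta>[of w] w1 by (simp add: power2_eq_square)
    then have "(cmod (\<theta> w))\<^sup>2 \<le> (11/100)\<^sup>2" by (intro power_mono) auto
    then have c: "cmod (cos (\<theta> w) - 1) \<le> 1/100"
      using norm_cos_minus_one_le_small[of "\<theta> w"] \<theta>1 by (simp add: power2_eq_square)
    have sn: "cmod (sin (\<theta> w)) \<le> 1/5" using norm_sin_le_small[of "\<theta> w"] \<theta>1 by simp
    have kw: "cmod (2 * of_real \<kappa> * w) \<le> 1/60"
    proof -
      have "\<kappa> * cmod w \<le> 1/12 * (1/10)" using \<kappa> w1 by (intro mult_mono) auto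
      then show ?thesis using \<kappa> by (simp add: norm_mult)
    qed
    have "cmod (x\<^sup>2 - 1) \<le> 1/25"
    proof -
      have "x\<^sup>2 - 1 = 2 * of_real \<kappa> * w * (2 + 2 * of_real \<kappa> * w)" by (simp add: x_def power2_eq_square algebra_simps)
      also have "cmod \<dots> \<le> 1/60 * (2 + 1/60)"
        unfolding norm_mult[of "2 * of_real \<kappa> * w"] using kw norm_triangle_ineq[of 2 "2 * of_real \<kappa> * w"]
        by (intro mult_mono) auto
      finally show ?thesis by simp
    qed
    moreover have "cmod (cos (\<theta> w)) \<le> 11/10" using c norm_triangle_ineq2[of "cos (\<theta> w)" 1] by simp
    ultimately have A: "cmod (cos (\<theta> w) * (x\<^sup>2 - 1)) \<le> 11/10 * (1/25)"
      unfolding norm_mult by (intro mult_mono) auto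
    have B: "cmod (of_real \<kappa> * sin (\<theta> w)) \<le> 1/12 * (1/5)"
      unfolding norm_mult using \<kappa> sn by (intro mult_mono) auto
    have D: "cmod (deriv (deriv F) w - deriv (deriv G) w) \<le> 1/25"
      using cl(2)[OF w] by (simp add: power2_eq_square)
    have "deriv (deriv F) w + 2 = (deriv (deriv F) w - deriv (deriv G) w) - 2 * (cos (\<theta> w) - 1)
       - 2 * (cos (\<theta> w) * (x\<^sup>2 - 1)) - 4 * (of_real \<kappa> * sin (\<theta> w))"
      unfolding G2 x_def[symmetric] by (simp add: algebra_simps)
    also have "cmod \<dots> \<le> cmod (deriv (deriv F) w - deriv (deriv G) w) + cmod (2 * (cos (\<theta> w) - 1))
       + cmod (2 * (cos (\<theta> w) * (x\<^sup>2 - 1))) + cmod (4 * (of_real \<kappa> * sin (\<theta> w)))"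
      by (intro order_trans[OF norm_triangle_ineq4] add_mono order_refl)
    also have "\<dots> = cmod (deriv (deriv F) w - deriv (deriv G) w) + 2 * cmod (cos (\<theta> w) - 1)
       + 2 * cmod (cos (\<theta> w) * (x\<^sup>2 - 1)) + 4 * cmod (of_real \<kappa> * sin (\<theta> w))"
      by (simp only: norm_mult[of 2] norm_mult[of 4] norm_numeral)
    also have "\<dots> \<le> 1/2" using A B c D by linarith
    finally show ?thesis .
  qed
  have F1: "cmod (deriv F 0) \<le> 1/20 / 4"
    using cl(1)[of 0] by (simp add: G1 \<theta>_def)
  have symF: "F (cnj w) = cnj (F w)" for w
    unfolding F_def using sym[of "L w"] \<sigma>(3) by (simp add: L_def)
  obtain \<xi> where \<xi>: "\<xi> holomorphic_on ball 0 (1/20)" "\<And>y. y \<in> ball 0 (1/20) \<Longrightarrow> cmod (\<xi> y) < 1/20"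
    "\<And>t. \<bar>t\<bar> < 1/20 \<Longrightarrow> \<xi> (of_real t) \<in> \<real>" "\<And>y. y \<in> ball 0 (1/20) \<Longrightarrow> \<xi> (- y) = \<xi> y"
    "\<And>s t. \<bar>s\<bar> < 1/20 \<Longrightarrow> \<bar>t\<bar> < 1/20 \<Longrightarrow> t \<noteq> 0 \<Longrightarrow> F (Complex s t) \<in> \<real> \<longleftrightarrow> of_real s = \<xi> (of_real t)"
    "deriv F (\<xi> 0) = 0"
    by (rule graph_of_real_level[of F "1/10" "1/20"]) (use F_hol F2 F1 symF in auto)
  define \<Xi> where "\<Xi> t = L (\<xi> (of_real k * t) + \<i> * (of_real k * t))" for t
  have kt: "\<bar>k * t\<bar> < 1/20" if "\<bar>t\<bar> < e" for t
    using mult_strict_left_mono[OF that, of "\<bar>k\<bar>"] k0 ek by (simp add: abs_mult)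
  have ktb: "of_real k * t \<in> ball 0 (1/20)" if "t \<in> ball 0 e" for t :: complex
    using kt[of "cmod t"] that by (simp add: norm_mult abs_mult)
  have \<Xi>_t: "\<Xi> (of_real t) = of_real l + \<xi> (of_real (k * t)) / of_real k + \<i> * of_real t" for t
    using k0 by (simp add: \<Xi>_def L_def field_simps)
  have 1: "\<Xi> holomorphic_on ball 0 e"
  proof -
    have "(\<lambda>t. \<xi> (of_real k * t)) holomorphic_on ball 0 e"
      using holomorphic_on_compose_gen[of "\<lambda>t. of_real k * t" "ball 0 e" \<xi> "ball 0 (1/20)"] \<xi>(1) ktb
      by (auto simp: o_def image_subset_iff intro!: holomorphic_on_mult holomorphic_on_const holomorphic_on_ident)
    then show ?thesis unfolding \<Xi>_def L_def using k0
      by (intro holomorphic_on_add holomorphic_on_divide holomorphic_on_mult holomorphic_on_const holomorphic_on_ident) auto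
  qed
  have Im\<xi>: "Im (\<xi> (of_real (k * t)) / of_real k) = 0" if "\<bar>t\<bar> < e" for t
    using \<xi>(3)[OF kt[OF that]] by (simp add: complex_is_Real_iff del: of_real_mult)
  have 2: "Im (\<Xi> (of_real t)) = t" if "\<bar>t\<bar> < e" for t
    using Im\<xi>[OF that] by (simp add: \<Xi>_t del: of_real_mult)
  have ltk: "\<bar>x / k\<bar> < e" if "\<bar>x\<bar> < 1/20" for x
  proof -
    have "\<bar>k\<bar> > 0" using k0 by simp
    then have "\<bar>x\<bar> / \<bar>k\<bar> < e" using that ek by (subst pos_divide_less_eq) (auto simp: mult.commute)
    then show ?thesis by simp
  qed
  have 3: "\<bar>Re (\<Xi> (of_real t)) - l\<bar> < e" if t: "\<bar>t\<bar> < e" for t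
  proof -
    have "\<bar>Re (\<xi> (of_real (k * t)))\<bar> < 1/20"
      using abs_Re_le_cmod[of "\<xi> (of_real (k * t))"] \<xi>(2)[of "of_real (k * t)"] kt[OF t]
      by (simp del: of_real_mult)
    from ltk[OF this] show ?thesis by (simp add: \<Xi>_t del: of_real_mult)
  qed
  have 4: "Re (\<Xi> (- of_real t)) = Re (\<Xi> (of_real t))" if t: "\<bar>t\<bar> < e" for t
  proof -
    have "\<xi> (- of_real (k * t)) = \<xi> (of_real (k * t))"
      by (rule \<xi>(4)) (use kt[OF t] in \<open>simp del: of_real_mult\<close>)
    then show ?thesis using \<Xi>_t[of "-t"] \<Xi>_t[of t] by simp
  qed
  have 5: "h z \<in> \<real> \<longleftrightarrow> z = \<Xi> (of_real (Im z))"
    if z: "\<bar>Re z - l\<bar> < e" "\<bar>Im z\<bar> < e" "Im z \<noteq> 0" for z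
  proof -
    let ?x = "k * (Re z - l)" and ?y = "k * Im z"
    have xy: "\<bar>?x\<bar> < 1/20" "\<bar>?y\<bar> < 1/20" "?y \<noteq> 0" using kt[OF z(1)] kt[OF z(2)] z(3) k0 by auto
    have "L (Complex ?x ?y) = z"
      using k0 by (simp add: L_def complex_eq_iff)
    then have "F (Complex ?x ?y) = \<sigma> * h z" by (simp add: F_def)
    then have "h z \<in> \<real> \<longleftrightarrow> F (Complex ?x ?y) \<in> \<real>"
    proof -
      have "\<sigma> = 1 \<or> \<sigma> = -1" unfolding \<sigma>_def by (cases "even n") auto
      then show ?thesis using \<open>F (Complex ?x ?y) = \<sigma> * h z\<close> by auto
    qed
    also have "\<dots> \<longleftrightarrow> of_real ?x = \<xi> (of_real ?y)" by (rule \<xi>(5)[OF xy])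
    also have "\<dots> \<longleftrightarrow> z = \<Xi> (of_real (Im z))"
    proof -
      have "z = of_real l + of_real ?x / of_real k + \<i> * of_real (Im z)"
        using k0 by (simp add: complex_eq_iff)
      then have "z = \<Xi> (of_real (Im z)) \<longleftrightarrow> of_real ?x / complex_of_real k = \<xi> (of_real ?y) / of_real k"
        unfolding \<Xi>_t by (metis add_left_cancel add_right_cancel)
      then show ?thesis by (metis divide_cancel_right k0 of_real_eq_0_iff)
    qed
    finally show ?thesis .
  qed
  have \<xi>0: "cmod (\<xi> 0) < 1/20" using \<xi>(2)[of 0] by simp
  have \<Xi>0: "\<Xi> 0 = L (\<xi> 0)" by (simp add: \<Xi>_def)
  have 6: "cmod (2 * (\<Xi> 0)\<^sup>2 - ?a) < pi / 4"
  proof -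
    have "(cmod (\<xi> 0))\<^sup>2 \<le> 1" using \<xi>0 by (simp add: power_le_one)
    then have "cmod (\<theta> (\<xi> 0)) < 3/4" using n\<theta>[of "\<xi> 0"] \<xi>0 by linarith
    then show ?thesis using pi_gt3 by (simp add: \<Xi>0 L2)
  qed
  have 7: "s * Re (\<Xi> 0) > 0"
  proof -
    have e0: "e > 0" using n by (simp add: e)
    have "e < \<bar>l\<bar>"
    proof -
      have "\<bar>l\<bar> * e < \<bar>l\<bar> * \<bar>l\<bar>"
        using ek l2 npi by (simp add: k_def abs_mult power2_eq_square)
      moreover have "\<bar>l\<bar> > 0" using sl by auto
      ultimately show ?thesis using mult_less_cancel_left_pos by blast
    qed
    moreover have "\<bar>Re (\<Xi> 0) - l\<bar> < e" using 3[of 0] e0 by simp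
    ultimately show ?thesis using s sl by auto
  qed
  have 8: "deriv h (\<Xi> 0) = 0"
    using \<xi>(6) DERIV_imp_deriv[OF dF[of "\<xi> 0"]] \<sigma>(5) k0 by (simp add: \<Xi>0)
  show thesis
    by (rule that[OF 1 _ _ _ _ 6 7 8]) (use 2 3 4 5 in blast)+
qed

section \<open>Rectangles and arcs\<close>

text \<open>
  For \<open>n \<noteq> 0\<close> this is \<open>1 / (80 \<bar>\<lambda>\<^sub>n\<bar>)\<close>, of the order \<open>\<bar>n\<bar>\<close> to the power \<open>-1/2\<close>, where \<open>\<lambda>\<^sub>n\<close> is the critical
  point of the zero potential. The value at \<open>0\<close> is an arbitrary positive number.
\<close>
definition half_width :: "int \<Rightarrow> real" where
  "half_width n = (if n = 0 then 1 else 1 / (80 * sqrt (of_int \<bar>n\<bar> * pi / 2)))"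

lemma half_width_pos: "half_width n > 0"
  by (simp add: half_width_def)

lemma half_width_linf_half: "half_width \<in> linf_half"
proof -
  have "(1 + (of_int n)\<^sup>2) powr (1/4) * \<bar>half_width n\<bar> \<le> 2" for n
  proof (cases "n = 0")
    case False
    define m :: real where "m = of_int \<bar>n\<bar>"
    have "1 \<le> \<bar>n\<bar>" using False by linarith
    then have m: "m \<ge> 1" unfolding m_def by (metis of_int_1_le_iff)
    have "(1 + (of_int n)\<^sup>2) = 1 + m\<^sup>2" by (simp add: m_def)
    also have "\<dots> powr (1/4) \<le> ((4 * m) powr 2) powr (1/4)"
    proof (rule powr_mono2)
      have "1 \<le> m\<^sup>2" using m by simp
      moreover have "(4 * m) powr 2 = 16 * m\<^sup>2" using m by (simp add: powr_realpow power_mult_distrib)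
      ultimately show "1 + m\<^sup>2 \<le> (4 * m) powr 2" by linarith
    qed auto
    also have "\<dots> = sqrt (4 * m)" unfolding powr_powr using m by (simp add: powr_half_sqrt)
    also have "\<dots> = 2 * sqrt m" by (simp add: real_sqrt_mult)
    finally have 1: "(1 + (of_int n)\<^sup>2) powr (1/4) \<le> 2 * sqrt m" .
    have "m * 1 \<le> m * (pi / 2)" using m pi_ge_two by (intro mult_left_mono) auto
    then have "sqrt m \<le> sqrt (m * pi / 2)" by simp
    then have "80 * sqrt (m * pi / 2) \<ge> sqrt m" using m by (smt (verit) real_sqrt_ge_zero)
    moreover have "sqrt m > 0" using m by simp
    ultimately have "1 / (80 * sqrt (m * pi / 2)) \<le> 1 / sqrt m" by (intro frac_le) auto
    moreover have "half_width n = 1 / (80 * sqrt (m * pi / 2))" using False by (simp add: half_width_def m_def)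
    ultimately have 2: "\<bar>half_width n\<bar> \<le> 1 / sqrt m" using half_width_pos[of n] by simp
    have "(1 + (of_int n)\<^sup>2) powr (1/4) * \<bar>half_width n\<bar> \<le> (2 * sqrt m) * (1 / sqrt m)"
      using 1 2 m by (intro mult_mono) auto
    then show ?thesis using m by simp
  qed (simp add: half_width_def)
  then show ?thesis by (auto simp: linf_half_def intro!: bdd_aboveI2)
qed

text \<open>
  The sign \<open>s\<close> of the index and its absolute value \<open>N\<close> allow positive and negative indices to be treated together.
\<close>
lemma nonzero_index:
  assumes "n \<noteq> 0"
  obtains N :: nat and s :: real where "N > 0" "s = 1 \<or> s = -1"
    "D1 n = {z. cmod (2 * z\<^sup>2 - of_real (real N * pi)) < pi / 4 \<and> s * Re z > 0}"
    "crit_point_zero n = s * sqrt (real N * pi / 2)" "half_width n = 1 / (80 * sqrt (real N * pi / 2))"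
proof (cases "n > 0")
  case True
  then obtain N where "n = int N" "N > 0" by (metis of_nat_0_less_iff zero_less_imp_eq_int)
  then show ?thesis
    by (intro that[of N 1]) (auto simp: D1_def U_def crit_point_zero_def half_width_def)
next
  case False
  then obtain N where "- n = int N" "N > 0" using assms
    by (metis neg_0_less_iff_less linorder_neqE_linordered_idom of_nat_0_less_iff zero_less_imp_eq_int)
  then have "n = - int N" "N > 0" by auto
  then show ?thesis
    by (intro that[of N "-1"]) (auto simp: D1_def U_def crit_point_zero_def half_width_def)
qed

text \<open>
  A curve parametrized by its imaginary part has the imaginary part as the inverse of its
  parametrization, its tangents have imaginary part one, and in this chart the projection is the identity.
\<close>
lemma analytic_graph_over_imaginary_axis:
  assumes e: "e > 0" and \<Xi>: "\<Xi> holomorphic_on ball 0 e" and Im: "\<And>t. \<bar>t\<bar> < e \<Longrightarrow> Im (\<Xi> (of_real t)) = t"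
  defines "c \<equiv> \<lambda>t. \<Xi> (of_real t)" and "J \<equiv> {-e<..<e}"
  shows "analytic_arc c J (c ` J)" "transversal_to_reals c J" "Im_projection_diffeo c J (c ` J)"
proof -
  have Im': "Im (c t) = t" if "t \<in> J" for t using that Im[of t] by (auto simp: J_def c_def)
  have J: "open J" "J \<noteq> {}" "is_interval J" using e by (auto simp: J_def is_interval_convex_1)
  have an: "real_analytic_on c J" unfolding c_def J_def by (rule real_analytic_on_of_holomorphic[OF \<Xi>])
  have vd: "(c has_vector_derivative deriv \<Xi> (of_real t)) (at t)" if "t \<in> J" for t
  proof -
    have "complex_of_real t \<in> ball 0 e" using that by (auto simp: J_def)
    from holomorphic_derivI[OF \<Xi> open_ball this] show ?thesis
      unfolding c_def by (rule has_vector_derivative_real_field)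
  qed
  have vd1: "Im (vector_derivative c (at t)) = 1" if t: "t \<in> J" for t
  proof -
    have "((\<lambda>t. Im (c t)) has_vector_derivative Im (deriv \<Xi> (of_real t))) (at t)"
      by (rule bounded_linear.has_vector_derivative[OF bounded_linear_Im vd[OF t]])
    then have "((\<lambda>t. t) has_vector_derivative Im (deriv \<Xi> (of_real t))) (at t)"
      by (rule has_vector_derivative_transform_within_open[OF _ J(1) t]) (rule Im')
    moreover have "((\<lambda>t::real. t) has_vector_derivative 1) (at t)"
      by (auto intro!: derivative_eq_intros simp flip: has_real_derivative_iff_has_vector_derivative)
    ultimately have "Im (deriv \<Xi> (of_real t)) = 1" by (rule vector_derivative_unique_at)
    then show ?thesis using vector_derivative_at[OF vd[OF t]] by simp
  qed
  have cont: "continuous_on J c"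
    using vd has_vector_derivative_continuous by (intro continuous_at_imp_continuous_on) blast
  have ImJ: "Im ` c ` J = J" using Im' by force
  have "homeomorphism J (c ` J) c Im"
    unfolding homeomorphism_def ImJ using cont Im' by (auto intro!: continuous_intros)
  moreover have "vector_derivative c (at t) \<noteq> 0" if "t \<in> J" for t
    using vd1[OF that] by auto
  ultimately show "analytic_arc c J (c ` J)"
    unfolding analytic_arc_def using J an by blast
  show "transversal_to_reals c J"
    unfolding transversal_to_reals_def using vd1 by simp
  have inj: "inj_on (Im \<circ> c) J" using Im' by (auto simp: inj_on_def)
  have inv: "inv_into J (Im \<circ> c) t = t" if "t \<in> J" for t
    using inv_into_f_f[OF inj that] Im'[OF that] by simp
  have "real_analytic_on (Im \<circ> c) J" "real_analytic_on (inv_into J (Im \<circ> c)) J"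
    by (rule real_analytic_on_cong[OF real_analytic_on_ident J(1)]; simp add: Im' inv)+
  moreover have "bij_betw (Im \<circ> c) J J"
    using inj ImJ by (simp add: bij_betw_def image_comp)
  ultimately show "Im_projection_diffeo c J (c ` J)"
    unfolding Im_projection_diffeo_def real_analytic_diffeo_def ImJ using J by blast
qed

theorem theorem4p4:
  shows "\<exists>(W :: potential set) (\<epsilon> :: int \<Rightarrow> real) (\<delta> :: int \<Rightarrow> real).
    nbhd_of_zero W \<and>
    (\<forall>\<psi>\<in>W. \<forall>n. n \<noteq> 0 \<longrightarrow> (\<exists>!z. z \<in> D1 n \<and> discr_dot z \<psi> = 0)) \<and>
    \<epsilon> \<in> linf_half \<and> \<delta> \<in> linf_half \<and>
    (\<forall>n. 0 < \<epsilon> n \<and> 0 < \<delta> n) \<and>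
    (\<forall>\<psi> \<in> W \<inter> (X_real \<union> X_imag). \<forall>n. n \<noteq> 0 \<longrightarrow>
      (\<exists>\<gamma> :: complex set.
        {z. discr z \<psi> \<in> \<real>} \<inter> rect \<epsilon> \<delta> n = \<gamma> \<union> (rect \<epsilon> \<delta> n \<inter> \<real>) \<and>
        \<gamma> \<inter> \<real> = {crit_point \<psi> n} \<and>
        cnj ` \<gamma> = \<gamma> \<and>
        (\<exists>c J. analytic_arc c J \<gamma> \<and> transversal_to_reals c J \<and> Im_projection_diffeo c J \<gamma>)))"
proof -
  have "(1/200 :: real) > 0" by simp
  then obtain \<rho> where \<rho>: "\<rho> > 0"
    "\<And>(\<psi> :: potential) z. \<psi> \<in> X \<Longrightarrow> X_norm \<psi> < \<rho> \<Longrightarrow> cmod z \<ge> 1/2 \<Longrightarrow> \<bar>Im (2 * z\<^sup>2)\<bar> \<le> 2 \<Longrightarrow>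
       cmod (discr z \<psi> - 2 * cos (2 * z\<^sup>2)) \<le> 1/200"
    using discr_estimate by metis
  define W where "W = {\<psi>\<in>X. X_norm \<psi> < \<rho>}"
  have W: "nbhd_of_zero W" unfolding nbhd_of_zero_def W_def using \<rho>(1) by blast
  have hol: "(\<lambda>z. discr z \<psi>) holomorphic_on UNIV" if "\<psi> \<in> W" for \<psi>
    using that X_continuous by (intro discr_holomorphic) (auto simp: W_def)
  have close: "cmod (discr z \<psi> - 2 * cos (2 * z\<^sup>2)) \<le> 1/200"
    if "\<psi> \<in> W" "cmod z \<ge> 1/2" "\<bar>Im (2 * z\<^sup>2)\<bar> \<le> 2" for \<psi> z
    using that by (intro \<rho>(2)) (auto simp: W_def)
  have crit: "\<exists>!z. z \<in> D1 n \<and> discr_dot z \<psi> = 0" if \<psi>: "\<psi> \<in> W" and n: "n \<noteq> 0" for \<psi> n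
  proof -
    obtain N s where N: "N > 0" "s = 1 \<or> s = -1"
      "D1 n = {z. cmod (2 * z\<^sup>2 - of_real (real N * pi)) < pi / 4 \<and> s * Re z > 0}"
      "crit_point_zero n = s * sqrt (real N * pi / 2)" "half_width n = 1 / (80 * sqrt (real N * pi / 2))"
      by (rule nonzero_index[OF n])
    show ?thesis
      unfolding N(3) mem_Collect_eq discr_dot_def conj_assoc
      by (rule unique_critical_point[OF N(1,2) hol[OF \<psi>] close[OF \<psi>]])
  qed
  have arc: "\<exists>\<gamma> :: complex set.
        {z. discr z \<psi> \<in> \<real>} \<inter> rect half_width half_width n = \<gamma> \<union> (rect half_width half_width n \<inter> \<real>) \<and>
        \<gamma> \<inter> \<real> = {crit_point \<psi> n} \<and> cnj ` \<gamma> = \<gamma> \<and>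
        (\<exists>c J. analytic_arc c J \<gamma> \<and> transversal_to_reals c J \<and> Im_projection_diffeo c J \<gamma>)"
    if \<psi>: "\<psi> \<in> W \<inter> (X_real \<union> X_imag)" and n: "n \<noteq> 0" for \<psi> n
  proof -
    have \<psi>W: "\<psi> \<in> W" using \<psi> by blast
    have sym: "discr (cnj z) \<psi> = cnj (discr z \<psi>)" for z
      using \<psi> X_continuous by (intro discr_cnj) (auto simp: W_def)
    obtain N s where N: "N > 0" "s = 1 \<or> s = -1"
      "D1 n = {z. cmod (2 * z\<^sup>2 - of_real (real N * pi)) < pi / 4 \<and> s * Re z > 0}"
      "crit_point_zero n = s * sqrt (real N * pi / 2)" "half_width n = 1 / (80 * sqrt (real N * pi / 2))"
      by (rule nonzero_index[OF n])
    let ?l = "crit_point_zero n" and ?e = "half_width n"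
    obtain \<Xi> where \<Xi>': "\<Xi> holomorphic_on ball 0 ?e"
      "\<forall>t. \<bar>t\<bar> < ?e \<longrightarrow> Im (\<Xi> (of_real t)) = t" "\<forall>t. \<bar>t\<bar> < ?e \<longrightarrow> \<bar>Re (\<Xi> (of_real t)) - ?l\<bar> < ?e"
      "\<forall>t. \<bar>t\<bar> < ?e \<longrightarrow> Re (\<Xi> (- of_real t)) = Re (\<Xi> (of_real t))"
      "\<forall>z. \<bar>Re z - ?l\<bar> < ?e \<longrightarrow> \<bar>Im z\<bar> < ?e \<longrightarrow> Im z \<noteq> 0 \<longrightarrow> (discr z \<psi> \<in> \<real> \<longleftrightarrow> z = \<Xi> (of_real (Im z)))"
      "cmod (2 * (\<Xi> 0)\<^sup>2 - of_real (real N * pi)) < pi / 4" "s * Re (\<Xi> 0) > 0" "deriv (\<lambda>z. discr z \<psi>) (\<Xi> 0) = 0"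
      by (rule arc_near_critical_point[OF N(1,2) hol[OF \<psi>W] close[OF \<psi>W] sym N(4,5)])
    note \<Xi> = \<Xi>'[rule_format]
    define J where "J = {- ?e<..<?e}"
    define c where "c t = \<Xi> (of_real t)" for t :: real
    define \<gamma> where "\<gamma> = c ` J"
    have e: "?e > 0" by (rule half_width_pos)
    note g = analytic_graph_over_imaginary_axis[OF e \<Xi>(1,2), folded c_def[abs_def] J_def, folded \<gamma>_def]
    have cJ: "Im (c t) = t" "\<bar>Re (c t) - ?l\<bar> < ?e" "\<bar>t\<bar> < ?e" if "t \<in> J" for t
      using that \<Xi>(2,3)[of t] by (auto simp: c_def J_def)
    have \<gamma>_iff: "z \<in> \<gamma> \<longleftrightarrow> \<bar>Im z\<bar> < ?e \<and> z = c (Im z)" for z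
    proof
      assume "z \<in> \<gamma>"
      then show "\<bar>Im z\<bar> < ?e \<and> z = c (Im z)" using cJ by (auto simp: \<gamma>_def)
    next
      assume "\<bar>Im z\<bar> < ?e \<and> z = c (Im z)"
      then show "z \<in> \<gamma>" by (auto simp: \<gamma>_def J_def abs_less_iff)
    qed
    have crit0: "\<Xi> 0 = crit_point \<psi> n"
      unfolding crit_point_def
      by (rule the1_equality[OF crit[OF \<psi>W n], symmetric]) (use \<Xi>(6-8) in \<open>simp add: N(3) discr_dot_def\<close>)
    have c0: "c 0 = crit_point \<psi> n" by (simp add: c_def crit0)
    have real: "discr z \<psi> \<in> \<real>" if "z \<in> \<real>" for z
      using sym[of z] that by (simp add: Reals_cnj_iff)
    have "{z. discr z \<psi> \<in> \<real>} \<inter> rect half_width half_width n = \<gamma> \<union> (rect half_width half_width n \<inter> \<real>)"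
    proof (intro set_eqI)
      fix z
      have "0 \<in> J" using e by (simp add: J_def)
      from cJ(1)[OF this] have "c 0 \<in> \<real>" by (simp add: complex_is_Real_iff)
      show "z \<in> {z. discr z \<psi> \<in> \<real>} \<inter> rect half_width half_width n \<longleftrightarrow> z \<in> \<gamma> \<union> (rect half_width half_width n \<inter> \<real>)"
      proof (cases "z \<in> rect half_width half_width n")
        case True
        then have z: "\<bar>Re z - ?l\<bar> < ?e" "\<bar>Im z\<bar> < ?e" by (auto simp: rect_def)
        show ?thesis
        proof (cases "z \<in> \<real>")
          case True
          then show ?thesis using real \<open>z \<in> rect _ _ _\<close> by simp
        next
          case False
          then have "Im z \<noteq> 0" by (simp add: complex_is_Real_iff)
          then show ?thesis using \<Xi>(5)[OF z] z False True by (simp add: \<gamma>_iff c_def)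
        qed
      next
        case False
        have "z \<notin> \<gamma>"
        proof
          assume "z \<in> \<gamma>"
          then obtain t where "t \<in> J" "z = c t" by (auto simp: \<gamma>_def)
          then show False using False cJ[of t] by (simp add: rect_def)
        qed
        then show ?thesis using False by simp
      qed
    qed
    moreover have "\<gamma> \<inter> \<real> = {crit_point \<psi> n}"
    proof -
      have "0 \<in> J" using e by (simp add: J_def)
      then have "c 0 \<in> \<gamma>" "Im (c 0) = 0" using cJ(1) by (auto simp: \<gamma>_def)
      moreover have "z = c 0" if "z \<in> \<gamma>" "z \<in> \<real>" for z
        using that by (metis \<gamma>_iff complex_is_Real_iff)
      moreover have "c 0 \<in> \<real>" using \<open>Im (c 0) = 0\<close> by (simp add: complex_is_Real_iff)
      ultimately show ?thesis unfolding c0[symmetric] by blast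
    qed
    moreover have "cnj ` \<gamma> = \<gamma>"
    proof -
      have "cnj (c t) = c (- t)" if "t \<in> J" for t
        using that cJ(1)[of t] cJ(1)[of "- t"] \<Xi>(4)[of t] by (auto simp: complex_eq_iff J_def c_def)
      then have "cnj ` \<gamma> = (\<lambda>t. c (- t)) ` J" unfolding \<gamma>_def image_image by (rule image_cong[OF refl])
      also have "\<dots> = c ` uminus ` J" by (simp add: image_image)
      also have "uminus ` J = J" by (simp add: J_def)
      finally show ?thesis by (simp add: \<gamma>_def)
    qed
    ultimately show ?thesis using g by blast
  qed
  show ?thesis
    by (rule exI[of _ W], rule exI[of _ half_width], rule exI[of _ half_width], intro conjI ballI allI impI)
      (assumption | rule W crit half_width_linf_half half_width_pos arc)+
qed

end
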